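(* Let $\mathcal{T}$ be the theory QCD, and let $C\in M_{N,4}(\mathbb{Q})$ be a matrix such that $\deg(G)=CV_G-(C\ \ 0)S_G$ defines a connected $\mathbb{N}^N$-graduation of the Hopf algebra of QCD Feynman graphs. Then, for the graduation induced by $C$, the SDSE $(S'_{\mathcal{T}})$ is Hopf (i.e. $\mathcal{H}_{(S'_{\mathcal{T}})}$ is a Hopf subalgebra of $\mathcal{H}^P$) if, and only if, $\mathrm{Rank}(C)=4$.
   Context: $\mathbb{K}$ is a field of characteristic zero. QCD. The set of half-edge types is $\mathcal{HE}=\{q,\bar q,c,\bar c,g\}$ ($q,\bar q$: the two orientations of a fermion half-edge; $c,\bar c$: the two orientations of a ghost half-edge; $g$: gluon half-edge), with involution $\iota$: $q\leftrightarrow\bar q$, $c\leftrightarrow\bar c$, $g\leftrightarrow g$. The set of vertex types is $\mathcal{V}=\{t_1,t_2,t_3,t_4\}$ with multisets $t_1=\{q,\bar q,g\}$, $t_2=\{c,\bar c,g\}$, $t_3=\{g,g,g\}$, $t_4=\{g,g,g,g\}$. The set of edge types is $\mathcal{E}=\{t_5,t_6,t_7\}$ with $t_5=\{q,\bar q\}$, $t_6=\{c,\bar c\}$, $t_7=\{g,g\}$. FEYNMAN GRAPHS. A 1PI Feynman graph $G$ is given by a nonempty finite set $HE$ of half-edges with a map $type:HE\to\mathcal{HE}$, a nonempty finite set $V$ of vertices, an involution $i:HE\to HE$ and a source map $s:HE\to V$ such that: (1) if $i(e)\ne e$ then $\iota(type(e))=type(i(e))$; (2) for any $v\in V$ the multiset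 $type(v)=\{type(e)\mid s(e)=v\}$ belongs to $\mathcal{V}$; (3) with internal edges $Int(G)=\{\{e,i(e)\}\mid i(e)\neq e\}$ (the type of such an edge being $\{type(e),type(i(e))\}\in\mathcal E$), the graph $(V,Int(G))$ is connected, has at least one edge, and remains connected if any one edge is deleted; (4) with external half-edges $Ext(G)=\{e\mid i(e)=e\}$, the multiset $\{type(e)\mid e\in Ext(G)\}$ is an element of $\mathcal{E}$ or of $\mathcal{V}$, called the type of the external structure of $G$. A Feynman graph is a disjoint union of a finite number (possibly $0$, giving the empty graph $1$) of 1PI Feynman graphs, called its connected components; graphs are taken up to isomorphism. A Feynman graph $G'=(HE',V',i',s')$ is a subgraph of $G=(HE,V,i,s)$ if $HE'\subseteq HE$, $V'=s(HE')$, $s'=s_{|HE'}$ and, for all $e\in HE'$, $i'(e)=e$ or $i'(e)=i(e)$. For $G'$ a connected subgraph, $G/G'=(HE'',V'',i'',s'')$ is defined as follows. If the external structure of $G'$ is a vertex type: $HE''=(HE\setminus HE')\sqcup Ext(G')$, $V''=(V\setminus V')\sqcup\{0\}$, $s''=s$ on $HE\setminus HE'$ and $s''=0$ on $Ext(G')$, $i''=i$. If it is an edge type, with external half-edges $e_1,e_2$ of $G'$: $HE''=HE\setminus HE'$, $V''=V\setminus V'$, $s''=s$, $i''(i(e_1))=i(e_2)$, $i''(i(e_2))=i(e_1)$, $i''(e)=i(e)$ otherwise. For non-connected $G'$, contract its components successively. By convention $G/1=G$ and $G/G=1$ (a connected component contracted entirely disappears). $G'$ is admissible, written $G'\subseteq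 G$, if $G/G'$ is a Feynman graph. The Hopf algebra of QCD Feynman graphs has basis the Feynman graphs, product the disjoint union, coproduct $\Delta(G)=\sum_{G'\subseteq G}G'\otimes G/G'$. A graph $G$ is primitive if $\Delta(G)=G\otimes1+1\otimes G$. $V_G=(v_1(G),\dots,v_4(G))^T$, $v_j(G)$ being the number of vertices of type $t_j$; for $5\le j\le7$, $e_j(G)$ is the number of internal edges of type $t_j$; $S_G=(s_1(G),\dots,s_7(G))^T$, $s_j(G)$ being the number of connected components with external structure of type $t_j$. $(C\ \ 0)$ is $C$ completed with three zero columns. The graduation is a connected $\mathbb{N}^N$-graduation if $\deg(G)\in\mathbb{N}^N$ for all $G$, $\deg(G)\ne0$ if $G\neq1$, and there are finitely many graphs of each degree. DECORATED TREES. For a set $D$, $\mathcal{H}^D$ is the free commutative algebra generated by isoclasses of rooted trees with vertices decorated by $D$; its basis is the set of decorated rooted forests. For $d\in D$, $B_d$ is the linear map sending a forest to the tree obtained by grafting all its trees on a common root decorated by $d$. The coproduct of $\mathcal{H}^D$ is the unique algebra morphism with $\Delta\circ B_d(x)=B_d(x)\otimes1+(\mathrm{Id}\otimes B_d)\circ\Delta(x)$. $B_d$ extends to the algebra $\widehat{\mathcal{H}^D}$ of formal series of forests. THE SYSTEM. $P_i$ is the set of primitive 1PI QCD Feynman graphs with external structure of type $t_i$, $1\le i\le7$, and $P=\bigsqcup_iP_i$, graded by $\deg$; this induces an $\mathbb{N}^N$-graduation of $\mathcal{H}^P$ (degree of a forest = sum of the degrees of its decorations). $(S'_{\mathcal{T}})$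 is the system $$\forall i\in\{1,\dots,7\},\quad Y_i=\sum_{G\in P_i}B_G\left(\prod_{j=1}^4(1+Y_j)^{v_j(G)}\prod_{j=5}^{7}(1-Y_j)^{-e_j(G)}\right)$$ with unknowns $Y_i\in\widehat{\mathcal{H}^P}$; it has a unique solution. $Y_i(d)$ is the homogeneous component of $Y_i$ of degree $d\in\mathbb N^N$, and $\mathcal{H}_{(S'_{\mathcal{T}})}$ is the subalgebra of $\mathcal{H}^P$ generated by all the $Y_i(d)$. *)

theory Defs
  imports "HOL-Analysis.Analysis" "HOL-Library.Multiset" "HOL-Library.Poly_Mapping"
    "HOL-Library.Product_Plus" "HOL-Library.FuncSet"
begin

section \<open>QCD Feynman graphs\<close>

datatype half_edge_type = Quark | Antiquark | Ghost | Antighost | Gluon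

fun conj_type :: "half_edge_type \<Rightarrow> half_edge_type" where
  "conj_type Quark = Antiquark"
| "conj_type Antiquark = Quark"
| "conj_type Ghost = Antighost"
| "conj_type Antighost = Ghost"
| "conj_type Gluon = Gluon"

datatype vertex_type = T1 | T2 | T3 | T4
datatype edge_type = T5 | T6 | T7

text \<open>The index set \<open>{1..7}\<close> of all types is the disjoint sum of the vertex types \<open>{1..4}\<close>
  and the edge types \<open>{5..7}\<close>.\<close>

type_synonym ext_type = "vertex_type + edge_type"

instance vertex_type :: finite
proof
  have "(UNIV :: vertex_type set) = {T1, T2, T3, T4}"
    by (auto intro: vertex_type.exhaust)
  then show "finite (UNIV :: vertex_type set)" by (metis finite.emptyI finite_insert)
qed

instance edge_type :: finite
proof
  have "(UNIV :: edge_type set) = {T5, T6, T7}"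
    by (auto intro: edge_type.exhaust)
  then show "finite (UNIV :: edge_type set)" by (metis finite.emptyI finite_insert)
qed

fun vertex_mset :: "vertex_type \<Rightarrow> half_edge_type multiset" where
  "vertex_mset T1 = {#Quark, Antiquark, Gluon#}"
| "vertex_mset T2 = {#Ghost, Antighost, Gluon#}"
| "vertex_mset T3 = {#Gluon, Gluon, Gluon#}"
| "vertex_mset T4 = {#Gluon, Gluon, Gluon, Gluon#}"

fun edge_mset :: "edge_type \<Rightarrow> half_edge_type multiset" where
  "edge_mset T5 = {#Quark, Antiquark#}"
| "edge_mset T6 = {#Ghost, Antighost#}"
| "edge_mset T7 = {#Gluon, Gluon#}"

definition ext_type_mset :: "ext_type \<Rightarrow> half_edge_type multiset" where
  "ext_type_mset = case_sum vertex_mset edge_mset"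

text \<open>Only isomorphism classes of finite graphs matter, so half-edges and vertices are taken
  to be natural numbers.  The maps are required to be \<^const>\<open>extensional\<close> below, so
  that a graph is determined by its sets and by the values of its maps on these sets.\<close>

record fgraph =
  half_edges :: "nat set"
  he_type :: "nat \<Rightarrow> half_edge_type"
  verts :: "nat set"
  flip :: "nat \<Rightarrow> nat"
  src :: "nat \<Rightarrow> nat"

definition pregraph :: "fgraph \<Rightarrow> bool" where
  "pregraph G \<longleftrightarrow>
     finite (half_edges G) \<and> finite (verts G) \<and>
     he_type G \<in> extensional (half_edges G) \<and>
     flip G \<in> half_edges G \<rightarrow>\<^sub>E half_edges G \<and>
     (\<forall>e\<in>half_edges G. flip G (flip G e) = e) \<and>
     src G \<in> half_edges G \<rightarrow>\<^sub>E verts G"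

definition empty_graph :: fgraph where
  "empty_graph = \<lparr>half_edges = {}, he_type = (\<lambda>_. undefined), verts = {},
     flip = (\<lambda>_. undefined), src = (\<lambda>_. undefined)\<rparr>"

definition int_edges :: "fgraph \<Rightarrow> nat set set" where
  "int_edges G = {{e, flip G e} | e. e \<in> half_edges G \<and> flip G e \<noteq> e}"

definition ext_half_edges :: "fgraph \<Rightarrow> nat set" where
  "ext_half_edges G = {e \<in> half_edges G. flip G e = e}"

definition type_mset :: "fgraph \<Rightarrow> nat set \<Rightarrow> half_edge_type multiset" where
  "type_mset G A = image_mset (he_type G) (mset_set A)"

definition vertex_type_mset :: "fgraph \<Rightarrow> nat \<Rightarrow> half_edge_type multiset" where
  "vertex_type_mset G v = type_mset G {e \<in> half_edges G. src G e = v}"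

definition reachable :: "fgraph \<Rightarrow> nat set set \<Rightarrow> nat \<Rightarrow> nat \<Rightarrow> bool" where
  "reachable G E u v \<longleftrightarrow> (u, v) \<in> {(src G a, src G b) | a b. {a, b} \<in> E}\<^sup>*"

definition connected_graph :: "fgraph \<Rightarrow> nat set set \<Rightarrow> bool" where
  "connected_graph G E \<longleftrightarrow> (\<forall>u\<in>verts G. \<forall>v\<in>verts G. reachable G E u v)"

definition one_PI :: "fgraph \<Rightarrow> bool" where
  "one_PI G \<longleftrightarrow> pregraph G \<and> half_edges G \<noteq> {} \<and> verts G \<noteq> {} \<and>
     (\<forall>e\<in>half_edges G. flip G e \<noteq> e \<longrightarrow> conj_type (he_type G e) = he_type G (flip G e)) \<and>
     (\<forall>v\<in>verts G. \<exists>j. vertex_type_mset G v = vertex_mset j) \<and>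
     connected_graph G (int_edges G) \<and> int_edges G \<noteq> {} \<and>
     (\<forall>E\<in>int_edges G. connected_graph G (int_edges G - {E})) \<and>
     (\<exists>i. type_mset G (ext_half_edges G) = ext_type_mset i)"

definition induced :: "fgraph \<Rightarrow> nat set \<Rightarrow> fgraph" where
  "induced G W = (let H = {e \<in> half_edges G. src G e \<in> W} in
     \<lparr>half_edges = H, he_type = restrict (he_type G) H, verts = W,
      flip = restrict (flip G) H, src = restrict (src G) H\<rparr>)"

definition components :: "fgraph \<Rightarrow> fgraph set" where
  "components G = (\<lambda>v. induced G {u. reachable G (int_edges G) v u}) ` verts G"

definition feynman :: "fgraph \<Rightarrow> bool" where
  "feynman G \<longleftrightarrow> pregraph G \<and> (\<forall>K\<in>components G. one_PI K)"

definition graph_iso :: "fgraph \<Rightarrow> fgraph \<Rightarrow> bool" where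
  "graph_iso G H \<longleftrightarrow> (\<exists>f g. bij_betw f (half_edges G) (half_edges H) \<and>
     bij_betw g (verts G) (verts H) \<and>
     (\<forall>e\<in>half_edges G. he_type H (f e) = he_type G e \<and> flip H (f e) = f (flip G e) \<and>
        src H (f e) = g (src G e)))"

type_synonym graph_class = "fgraph set"

definition iso_class :: "fgraph \<Rightarrow> graph_class" where
  "iso_class G = {H. feynman H \<and> graph_iso G H}"

definition class_rep :: "graph_class \<Rightarrow> fgraph" where
  "class_rep c = (SOME G. G \<in> c)"

subsection \<open>Subgraphs and contraction\<close>

definition subgraph :: "fgraph \<Rightarrow> fgraph \<Rightarrow> bool" where
  "subgraph K G \<longleftrightarrow> feynman K \<and> half_edges K \<subseteq> half_edges G \<and>
     verts K = src G ` half_edges K \<and>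
     he_type K = restrict (he_type G) (half_edges K) \<and>
     src K = restrict (src G) (half_edges K) \<and>
     (\<forall>e\<in>half_edges K. flip K e = e \<or> flip K e = flip G e)"

text \<open>\<open>contract G K\<close> is meant for connected \<open>K\<close>.  A connected component of \<open>G\<close> contracted
  entirely disappears.  A half-edge of \<open>G\<close> that does not belong to \<open>K\<close> but whose source is a vertex
  of \<open>K\<close> is left without a source, so that the result is not a graph; the choice of the new vertex
  in the second case ensures that this is not repaired by a later contraction.  In the third case, if \<open>K\<close> has external half-edges
  \<open>e\<^sub>1, e\<^sub>2\<close> and \<open>flip G e = e\<^sub>1\<close>, then \<open>the_elem\<close> picks \<open>e\<^sub>2\<close>.\<close>

definition contract :: "fgraph \<Rightarrow> fgraph \<Rightarrow> fgraph" where
  "contract G K =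
    (if K \<in> components G then
       (let H = half_edges G - half_edges K in
        \<lparr>half_edges = H, he_type = restrict (he_type G) H, verts = verts G - verts K,
         flip = restrict (flip G) H, src = restrict (src G) H\<rparr>)
     else if \<exists>j. type_mset K (ext_half_edges K) = vertex_mset j then
       (let H = (half_edges G - half_edges K) \<union> ext_half_edges K;
            w = (LEAST n. n \<notin> verts G \<union> src G ` half_edges G) in
        \<lparr>half_edges = H, he_type = restrict (he_type G) H,
         verts = insert w (verts G - verts K), flip = restrict (flip G) H,
         src = restrict (\<lambda>e. if e \<in> ext_half_edges K then w else src G e) H\<rparr>)
     else
       (let H = half_edges G - half_edges K in
        \<lparr>half_edges = H, he_type = restrict (he_type G) H, verts = verts G - verts K,
         flip = restrict (\<lambda>e. if flip G e \<in> ext_half_edges K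
           then flip G (the_elem (ext_half_edges K - {flip G e})) else flip G e) H,
         src = restrict (src G) H\<rparr>))"

text \<open>The order of the contractions only affects the names of the new vertices.\<close>

definition quotient_graph :: "fgraph \<Rightarrow> fgraph \<Rightarrow> fgraph" where
  "quotient_graph G K =
     foldl contract G (SOME Ks. distinct Ks \<and> set Ks = components K)"

definition admissible :: "fgraph \<Rightarrow> fgraph \<Rightarrow> bool" where
  "admissible K G \<longleftrightarrow> subgraph K G \<and> feynman (quotient_graph G K)"

text \<open>A tensor in the square of the space with basis the isomorphism classes is a finitely
  supported function on pairs of classes.\<close>

definition graph_coproduct :: "fgraph \<Rightarrow> (graph_class \<times> graph_class) \<Rightarrow>\<^sub>0 'k::field_char_0" where
  "graph_coproduct G =
     (\<Sum>K | admissible K G. Poly_Mapping.single (iso_class K, iso_class (quotient_graph G K)) 1)"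

definition primitive :: "'k::field_char_0 itself \<Rightarrow> fgraph \<Rightarrow> bool" where
  "primitive _ G \<longleftrightarrow> (graph_coproduct G :: _ \<Rightarrow>\<^sub>0 'k) =
     Poly_Mapping.single (iso_class G, iso_class empty_graph) 1 +
     Poly_Mapping.single (iso_class empty_graph, iso_class G) 1"

definition prim_graphs :: "'k::field_char_0 itself \<Rightarrow> ext_type \<Rightarrow> graph_class set" where
  "prim_graphs K i = {iso_class G | G. one_PI G \<and>
     type_mset G (ext_half_edges G) = ext_type_mset i \<and> primitive K G}"

subsection \<open>Graduations\<close>

definition num_vertices :: "fgraph \<Rightarrow> vertex_type \<Rightarrow> nat" where
  "num_vertices G j = card {v \<in> verts G. vertex_type_mset G v = vertex_mset j}"

definition num_edges :: "fgraph \<Rightarrow> edge_type \<Rightarrow> nat" where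
  "num_edges G j = card {E \<in> int_edges G. type_mset G E = edge_mset j}"

definition num_components :: "fgraph \<Rightarrow> ext_type \<Rightarrow> nat" where
  "num_components G i =
     card {K \<in> components G. type_mset K (ext_half_edges K) = ext_type_mset i}"

definition vertex_vector :: "fgraph \<Rightarrow> rat ^ vertex_type" where
  "vertex_vector G = (\<chi> j. of_nat (num_vertices G j))"

definition structure_vector :: "fgraph \<Rightarrow> rat ^ ext_type" where
  "structure_vector G = (\<chi> i. of_nat (num_components G i))"

definition zero_extend :: "rat ^ vertex_type ^ 'n \<Rightarrow> rat ^ ext_type ^ 'n" where
  "zero_extend C = (\<chi> k i. case i of Inl j \<Rightarrow> C $ k $ j | Inr _ \<Rightarrow> 0)"

definition graph_degree :: "rat ^ vertex_type ^ 'n \<Rightarrow> fgraph \<Rightarrow> rat ^ 'n" where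
  "graph_degree C G = C *v vertex_vector G - zero_extend C *v structure_vector G"

definition class_degree :: "rat ^ vertex_type ^ 'n \<Rightarrow> graph_class \<Rightarrow> rat ^ 'n" where
  "class_degree C c = graph_degree C (class_rep c)"

text \<open>Additivity of the degree on disjoint unions, and the homogeneity of the coproduct, are
  automatic for a degree of the form \<^const>\<open>graph_degree\<close>.\<close>

definition connected_graduation :: "rat ^ vertex_type ^ 'n \<Rightarrow> bool" where
  "connected_graduation C \<longleftrightarrow>
     (\<forall>G. feynman G \<longrightarrow> (\<forall>k. graph_degree C G $ k \<in> \<nat>)) \<and>
     (\<forall>G. feynman G \<and> G \<noteq> empty_graph \<longrightarrow> graph_degree C G \<noteq> 0) \<and>
     (\<forall>d. finite {iso_class G | G. feynman G \<and> graph_degree C G = d})"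

section \<open>The Hopf algebra of decorated rooted trees\<close>

datatype 'd dtree = Node 'd "'d dtree multiset"

type_synonym 'd forest = "'d dtree multiset"

primrec decorations :: "'d dtree \<Rightarrow> 'd set" where
  "decorations (Node d F) = insert d (\<Union> (set_mset (image_mset decorations F)))"

definition forests :: "'d set \<Rightarrow> 'd forest set" where
  "forests D = {F. \<forall>t\<in>#F. decorations t \<subseteq> D}"

text \<open>Forests form the free commutative monoid on trees, so the free commutative algebra on
  trees is the monoid algebra \<open>'d forest \<Rightarrow>\<^sub>0 'k\<close> with the convolution product of
  \<open>Poly_Mapping\<close>, and its tensor square is the monoid algebra of pairs of forests.\<close>

definition ck_algebra :: "'d set \<Rightarrow> ('d forest \<Rightarrow>\<^sub>0 'k::field_char_0) set" where
  "ck_algebra D = {x. Poly_Mapping.keys x \<subseteq> forests D}"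

definition scale :: "'k \<Rightarrow> ('a \<Rightarrow>\<^sub>0 'k) \<Rightarrow> 'a \<Rightarrow>\<^sub>0 'k::comm_ring_1" where
  "scale c x = Poly_Mapping.map ((*) c) x"

definition linear_ext :: "('a \<Rightarrow> 'b \<Rightarrow>\<^sub>0 'k) \<Rightarrow> ('a \<Rightarrow>\<^sub>0 'k) \<Rightarrow> 'b \<Rightarrow>\<^sub>0 'k::comm_ring_1" where
  "linear_ext f x = (\<Sum>a\<in>Poly_Mapping.keys x. scale (Poly_Mapping.lookup x a) (f a))"

text \<open>The second summand is \<open>Id \<otimes> B\<^sub>d\<close> applied to the coproduct of the forest.\<close>

primrec tree_coproduct :: "'d dtree \<Rightarrow> ('d forest \<times> 'd forest) \<Rightarrow>\<^sub>0 'k::comm_ring_1" where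
  "tree_coproduct (Node d F) =
     Poly_Mapping.single ({#Node d F#}, {#}) 1 +
     linear_ext (\<lambda>(A, B). Poly_Mapping.single (A, {#Node d B#}) 1)
       (prod_mset (image_mset tree_coproduct F))"

definition ck_coproduct ::
    "('d forest \<Rightarrow>\<^sub>0 'k::field_char_0) \<Rightarrow> ('d forest \<times> 'd forest) \<Rightarrow>\<^sub>0 'k" where
  "ck_coproduct = linear_ext (\<lambda>F. \<Prod>t\<in>#F. tree_coproduct t)"

definition ck_counit :: "('d forest \<Rightarrow>\<^sub>0 'k::field_char_0) \<Rightarrow> 'k" where
  "ck_counit x = Poly_Mapping.lookup x {#}"

definition is_antipode ::
    "'d set \<Rightarrow> (('d forest \<Rightarrow>\<^sub>0 'k::field_char_0) \<Rightarrow> ('d forest \<Rightarrow>\<^sub>0 'k)) \<Rightarrow> bool" where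
  "is_antipode D S \<longleftrightarrow>
     S ` ck_algebra D \<subseteq> ck_algebra D \<and>
     (\<forall>x\<in>ck_algebra D. \<forall>y\<in>ck_algebra D. S (x + y) = S x + S y) \<and>
     (\<forall>c. \<forall>x\<in>ck_algebra D. S (scale c x) = scale c (S x)) \<and>
     (\<forall>x\<in>ck_algebra D.
        linear_ext (\<lambda>(A, B). S (Poly_Mapping.single A 1) * Poly_Mapping.single B 1)
          (ck_coproduct x) = scale (ck_counit x) 1 \<and>
        linear_ext (\<lambda>(A, B). Poly_Mapping.single A 1 * S (Poly_Mapping.single B 1))
          (ck_coproduct x) = scale (ck_counit x) 1)"

definition subalgebra :: "('d forest \<Rightarrow>\<^sub>0 'k::field_char_0) set \<Rightarrow> bool" where
  "subalgebra A \<longleftrightarrow> 1 \<in> A \<and> (\<forall>x\<in>A. \<forall>y\<in>A. x + y \<in> A \<and> x * y \<in> A) \<and>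
     (\<forall>c. \<forall>x\<in>A. scale c x \<in> A)"

definition tensor :: "('a \<Rightarrow>\<^sub>0 'k) \<Rightarrow> ('b \<Rightarrow>\<^sub>0 'k) \<Rightarrow> ('a \<times> 'b) \<Rightarrow>\<^sub>0 'k::comm_ring_1" where
  "tensor x y = linear_ext (\<lambda>a. linear_ext (\<lambda>b. Poly_Mapping.single (a, b) 1) y) x"

definition tensor_square :: "('a \<Rightarrow>\<^sub>0 'k::comm_ring_1) set \<Rightarrow> (('a \<times> 'a) \<Rightarrow>\<^sub>0 'k) set" where
  "tensor_square A = {\<Sum>(x, y)\<leftarrow>xys. tensor x y | xys. set xys \<subseteq> A \<times> A}"

definition hopf_subalgebra :: "'d set \<Rightarrow> ('d forest \<Rightarrow>\<^sub>0 'k::field_char_0) set \<Rightarrow> bool" where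
  "hopf_subalgebra D A \<longleftrightarrow> A \<subseteq> ck_algebra D \<and> subalgebra A \<and>
     ck_coproduct ` A \<subseteq> tensor_square A \<and>
     (\<exists>S. is_antipode D S \<and> S ` A \<subseteq> A)"

subsection \<open>Formal series of forests\<close>

text \<open>For \<open>'a = 'd dtree\<close> this is the algebra of formal series of forests.\<close>

typedef ('a, 'k) mset_series = "UNIV :: ('a multiset \<Rightarrow> 'k) set"
  morphisms coeff Series ..

setup_lifting type_definition_mset_series

lemma mset_series_eqI: "(\<And>F. coeff f F = coeff g F) \<Longrightarrow> f = g"
  by (metis coeff_inject ext)

abbreviation splits :: "'a multiset \<Rightarrow> ('a multiset \<times> 'a multiset) set" where
  "splits F \<equiv> {p. fst p + snd p = F}"

lemma finite_subseteq_mset: "finite {A. A \<subseteq># F}"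
proof (induction F)
  case empty
  then show ?case by simp
next
  case (add x F)
  have "{A. A \<subseteq># add_mset x F} \<subseteq> {A. A \<subseteq># F} \<union> add_mset x ` {A. A \<subseteq># F}"
  proof
    fix A assume "A \<in> {A. A \<subseteq># add_mset x F}"
    then have A: "A \<subseteq># add_mset x F" by simp
    show "A \<in> {A. A \<subseteq># F} \<union> add_mset x ` {A. A \<subseteq># F}"
    proof (cases "x \<in># A")
      case True
      then obtain B where "A = add_mset x B" by (meson multi_member_split)
      with A show ?thesis by auto
    next
      case False
      with A have "A \<subseteq># F"
        by (metis add_mset_remove_trivial diff_single_trivial subset_eq_diff_conv
            add_mset_add_single)
      then show ?thesis by simp
    qed
  qed
  with add show ?case by (meson finite_UnI finite_imageI finite_subset)
qed

lemma finite_splits [simp]: "finite (splits F)"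
proof -
  have "splits F \<subseteq> {A. A \<subseteq># F} \<times> {A. A \<subseteq># F}" by auto
  then show ?thesis by (rule finite_subset) (simp add: finite_subseteq_mset)
qed

instantiation mset_series :: (type, comm_ring_1) comm_ring_1
begin

lift_definition zero_mset_series :: "('a, 'b) mset_series" is "\<lambda>_. 0" .
lift_definition one_mset_series :: "('a, 'b) mset_series" is "\<lambda>F. if F = {#} then 1 else 0" .
lift_definition plus_mset_series :: "('a, 'b) mset_series \<Rightarrow> ('a, 'b) mset_series \<Rightarrow> ('a, 'b) mset_series"
  is "\<lambda>f g F. f F + g F" .
lift_definition minus_mset_series :: "('a, 'b) mset_series \<Rightarrow> ('a, 'b) mset_series \<Rightarrow> ('a, 'b) mset_series"
  is "\<lambda>f g F. f F - g F" .
lift_definition uminus_mset_series :: "('a, 'b) mset_series \<Rightarrow> ('a, 'b) mset_series"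
  is "\<lambda>f F. - f F" .
lift_definition times_mset_series :: "('a, 'b) mset_series \<Rightarrow> ('a, 'b) mset_series \<Rightarrow> ('a, 'b) mset_series"
  is "\<lambda>f g F. \<Sum>(A, B)\<in>splits F. f A * g B" .

instance
proof
  fix a b c :: "('a, 'b) mset_series"
  show "a * b * c = a * (b * c)"
  proof (transfer, rule ext)
    fix a b c :: "'a multiset \<Rightarrow> 'b" and F
    have "(\<Sum>(A, B)\<in>splits F. (\<Sum>(A', B')\<in>splits A. a A' * b B') * c B) =
        (\<Sum>(p, q)\<in>Sigma (splits F) (\<lambda>p. splits (fst p)). a (fst q) * b (snd q) * c (snd p))"
      by (subst sum.Sigma [symmetric]) (auto simp: sum_distrib_right case_prod_unfold)
    also have "\<dots> = (\<Sum>(p, q)\<in>Sigma (splits F) (\<lambda>p. splits (snd p)).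
        a (fst p) * (b (fst q) * c (snd q)))"
      by (rule sum.reindex_bij_witness
          [where i = "\<lambda>((A, B), (A', B')). ((A + A', B'), (A, A'))"
             and j = "\<lambda>((A, B), (A', B')). ((A', B' + B), (B', B))"])
         (auto simp: mult.assoc add.assoc)
    also have "\<dots> = (\<Sum>(A, B)\<in>splits F. a A * (\<Sum>(A', B')\<in>splits B. b A' * c B'))"
      by (subst sum.Sigma [symmetric]) (auto simp: sum_distrib_left case_prod_unfold)
    finally show "(\<Sum>(A, B)\<in>splits F. (\<Sum>(A', B')\<in>splits A. a A' * b B') * c B) =
        (\<Sum>(A, B)\<in>splits F. a A * (\<Sum>(A', B')\<in>splits B. b A' * c B'))" .
  qed
  show "a * b = b * a"
  proof (transfer, rule ext)
    fix a b :: "'a multiset \<Rightarrow> 'b" and F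
    show "(\<Sum>(A, B)\<in>splits F. a A * b B) = (\<Sum>(A, B)\<in>splits F. b A * a B)"
      by (rule sum.reindex_bij_witness[where i = prod.swap and j = prod.swap])
         (auto simp: ac_simps)
  qed
  show "1 * a = a"
  proof (transfer, rule ext)
    fix a :: "'a multiset \<Rightarrow> 'b" and F
    have "(\<Sum>(A, B)\<in>splits F. (if A = {#} then 1 else 0) * a B) =
        (\<Sum>(A, B)\<in>{({#} :: 'a multiset, F)}. (if A = {#} then 1 else 0) * a B)"
      by (rule sum.mono_neutral_right) (auto split: if_splits)
    then show "(\<Sum>(A, B)\<in>splits F. (if A = {#} then 1 else 0) * a B) = a F" by simp
  qed
  show "(a + b) * c = a * c + b * c"
    by (transfer, rule ext) (simp add: case_prod_unfold distrib_right sum.distrib)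
  show "a + b + c = a + (b + c)" by transfer (simp add: add.assoc)
  show "a + b = b + a" by transfer (simp add: add.commute)
  show "0 + a = a" by transfer simp
  show "- a + a = 0" by transfer simp
  show "a - b = a + - b" by transfer simp
  show "0 \<noteq> (1 :: ('a, 'b) mset_series)" by transfer (metis zero_neq_one)
qed

end

definition series_inverse :: "('a, 'k::field) mset_series \<Rightarrow> ('a, 'k) mset_series" where
  "series_inverse f = (THE g. f * g = 1)"

definition series_over :: "'d set \<Rightarrow> ('d dtree, 'k::field) mset_series set" where
  "series_over D = {f. \<forall>F. coeff f F \<noteq> 0 \<longrightarrow> F \<in> forests D}"

definition series_graft :: "'d \<Rightarrow> ('d dtree, 'k::zero) mset_series \<Rightarrow> ('d dtree, 'k) mset_series" where
  "series_graft d f = Series (\<lambda>F. if \<exists>A. F = {#Node d A#} then coeff f (THE A. F = {#Node d A#}) else 0)"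

primrec tree_degree :: "('d \<Rightarrow> rat ^ 'n) \<Rightarrow> 'd dtree \<Rightarrow> rat ^ 'n" where
  "tree_degree \<delta> (Node d F) = \<delta> d + sum_mset (image_mset (tree_degree \<delta>) F)"

definition forest_degree :: "('d \<Rightarrow> rat ^ 'n) \<Rightarrow> 'd forest \<Rightarrow> rat ^ 'n" where
  "forest_degree \<delta> F = (\<Sum>t\<in>#F. tree_degree \<delta> t)"

text \<open>In a connected graduation there are only finitely many forests of each degree, so the
  function below has finite support.\<close>

definition hom_component ::
    "('d \<Rightarrow> rat ^ 'n) \<Rightarrow> ('d dtree, 'k::zero) mset_series \<Rightarrow> nat ^ 'n \<Rightarrow> 'd forest \<Rightarrow>\<^sub>0 'k" where
  "hom_component \<delta> f d = Abs_poly_mapping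
     (\<lambda>F. if forest_degree \<delta> F = (\<chi> k. of_nat (d $ k)) then coeff f F else 0)"

section \<open>The system associated with QCD\<close>

definition sdse_term ::
    "(ext_type \<Rightarrow> (graph_class dtree, 'k::field) mset_series) \<Rightarrow> graph_class \<Rightarrow>
      (graph_class dtree, 'k) mset_series" where
  "sdse_term Y c = series_graft c
     ((\<Prod>j\<in>UNIV. (1 + Y (Inl j)) ^ num_vertices (class_rep c) j) *
      (\<Prod>j\<in>UNIV. series_inverse (1 - Y (Inr j)) ^ num_edges (class_rep c) j))"

text \<open>The sum over \<open>P\<^sub>i\<close> may be infinite; it is taken coefficientwise, where at most one summand
  is nonzero.\<close>

definition solves_sdse :: "(ext_type \<Rightarrow> (graph_class dtree, 'k::field_char_0) mset_series) \<Rightarrow> bool" where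
  "solves_sdse Y \<longleftrightarrow> (\<forall>i.
     Y i \<in> series_over (\<Union>j. prim_graphs TYPE('k) j) \<and>
     (\<forall>F. coeff (Y i) F =
        (\<Sum>c | c \<in> prim_graphs TYPE('k) i \<and> coeff (sdse_term Y c) F \<noteq> 0. coeff (sdse_term Y c) F)))"

definition sdse_algebra ::
    "rat ^ vertex_type ^ 'n \<Rightarrow> (ext_type \<Rightarrow> (graph_class dtree, 'k::field_char_0) mset_series) \<Rightarrow>
      (graph_class forest \<Rightarrow>\<^sub>0 'k) set" where
  "sdse_algebra C Y = subalgebra hull {hom_component (class_degree C) (Y i) d | i d. True}"

definition sdse_hopf ::
    "rat ^ vertex_type ^ 'n \<Rightarrow> (ext_type \<Rightarrow> (graph_class dtree, 'k::field_char_0) mset_series) \<Rightarrow> bool" where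
  "sdse_hopf C Y \<longleftrightarrow> hopf_subalgebra (\<Union>i. prim_graphs TYPE('k) i) (sdse_algebra C Y)"

subsection \<open>Existence and uniqueness of the solution\<close>

primrec tree_size :: "'d dtree \<Rightarrow> nat" where
  "tree_size (Node d F) = Suc (sum_mset (image_mset tree_size F))"

definition forest_size :: "'d forest \<Rightarrow> nat" where
  "forest_size F = (\<Sum>t\<in>#F. tree_size t)"

lemma forest_size_add: "forest_size (A + B) = forest_size A + forest_size B"
  by (simp add: forest_size_def)

lemma forest_size_empty [simp]: "forest_size {#} = 0"
  by (simp add: forest_size_def)

lemma forest_size_graft: "forest_size {#Node d A#} = Suc (forest_size A)"
  by (simp add: forest_size_def)

definition agree :: "('a multiset \<Rightarrow> nat) \<Rightarrow> nat \<Rightarrow> ('a, 'k::comm_ring_1) mset_series \<Rightarrow> ('a, 'k) mset_series \<Rightarrow> bool" where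
  "agree w n f g \<longleftrightarrow> (\<forall>F. w F < n \<longrightarrow> coeff f F = coeff g F)"

lemma agree_refl: "agree w n f f" by (simp add: agree_def)
lemma agree_sym: "agree w n f g \<Longrightarrow> agree w n g f" by (simp add: agree_def)
lemma agree_trans: "agree w n f g \<Longrightarrow> agree w n g h \<Longrightarrow> agree w n f h" by (simp add: agree_def)
lemma agree_add: "agree w n f g \<Longrightarrow> agree w n f' g' \<Longrightarrow> agree w n (f + f') (g + g')"
  by (simp add: agree_def plus_mset_series.rep_eq)
lemma agree_diff: "agree w n f g \<Longrightarrow> agree w n f' g' \<Longrightarrow> agree w n (f - f') (g - g')"
  by (simp add: agree_def minus_mset_series.rep_eq)
lemma agree_mult:
  assumes w: "\<And>A B. w (A + B) = w A + w B"
    and "agree w n f g" "agree w n f' g'"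
  shows "agree w n (f * f') (g * g')"
  unfolding agree_def times_mset_series.rep_eq
proof (intro allI impI sum.cong refl)
  fix F p assume "w F < n" and "p \<in> splits F"
  moreover from this have "w F = w (fst p) + w (snd p)" using w[of "fst p" "snd p"] by simp
  ultimately show "(case p of (A, B) \<Rightarrow> coeff f A * coeff f' B) = (case p of (A, B) \<Rightarrow> coeff g A * coeff g' B)"
    using assms(2,3) by (auto simp: agree_def case_prod_unfold)
qed
lemma agree_power:
  assumes w: "\<And>A B. w (A + B) = w A + w B" and "agree w n f g"
  shows "agree w n (f ^ k) (g ^ k)"
  by (induction k) (auto intro: agree_mult assms agree_refl)
lemma agree_prod:
  assumes w: "\<And>A B. w (A + B) = w A + w B" and "finite J" and "\<And>j. j \<in> J \<Longrightarrow> agree w n (f j) (g j)"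
  shows "agree w n (\<Prod>j\<in>J. f j) (\<Prod>j\<in>J. g j)"
  using assms(2,3) by (induction J) (auto intro: agree_mult w agree_refl)

lemma inverse_exists:
  fixes f :: "('a, 'k::field) mset_series"
  assumes "coeff f {#} = 0"
  shows "\<exists>g. (1 - f) * g = 1"
proof -
  have pow0: "coeff (f ^ k) F = 0" if "size F < k" for k F
    using that
  proof (induction k arbitrary: F)
    case (Suc k)
    have "coeff (f ^ Suc k) F = (\<Sum>(A, B)\<in>splits F. coeff f A * coeff (f ^ k) B)"
      by (simp add: times_mset_series.rep_eq)
    also have "\<dots> = 0"
    proof (rule sum.neutral, clarify)
      fix A B :: "'a multiset" assume F: "F = fst (A, B) + snd (A, B)"
      show "coeff f A * coeff (f ^ k) B = 0"
      proof (cases "A = {#}")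
        case False
        then have "size B < k" using Suc.prems F by (simp add: size_eq_0_iff_empty[symmetric] del: size_eq_0_iff_empty)
        then show ?thesis using Suc.IH by simp
      qed (simp add: assms)
    qed
    finally show ?case .
  qed simp
  define g where "g = Series (\<lambda>F. coeff (\<Sum>k\<le>size F. f ^ k) F)"
  have cs: "coeff (\<Sum>k\<in>K. h k) F = (\<Sum>k\<in>K. coeff (h k) F)" if "finite K"
    for K :: "nat set" and h :: "nat \<Rightarrow> ('a, 'k) mset_series" and F
    using that by (induction K) (auto simp: zero_mset_series.rep_eq plus_mset_series.rep_eq)
  have geo: "agree size (Suc n) g (\<Sum>k\<le>n. f ^ k)" for n
    unfolding agree_def g_def
  proof (intro allI impI)
    fix F :: "'a multiset" assume "size F < Suc n"
    have "(\<Sum>k\<le>size F. coeff (f ^ k) F) = (\<Sum>k\<le>n. coeff (f ^ k) F)"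
      by (rule sum.mono_neutral_left) (use \<open>size F < Suc n\<close> pow0 in auto)
    then show "coeff (Series (\<lambda>F. coeff (\<Sum>k\<le>size F. f ^ k) F)) F = coeff (\<Sum>k\<le>n. f ^ k) F"
      by (simp add: Series_inverse cs)
  qed
  have "(1 - f) * g = 1"
  proof (rule mset_series_eqI)
    fix F :: "'a multiset"
    let ?n = "size F"
    have "agree size (Suc ?n) ((1 - f) * g) ((1 - f) * (\<Sum>k\<le>?n. f ^ k))"
      by (rule agree_mult [OF _ agree_refl geo]) simp
    then have "coeff ((1 - f) * g) F = coeff ((1 - f) * (\<Sum>k\<le>?n. f ^ k)) F"
      by (simp add: agree_def)
    also have "(1 - f) * (\<Sum>k\<le>?n. f ^ k) = 1 - f ^ Suc ?n"
      by (subst one_diff_power_eq) (simp add: lessThan_Suc_atMost)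
    also have "coeff (1 - f ^ Suc ?n) F = coeff 1 F"
      using pow0[of F "Suc ?n"] by (simp add: minus_mset_series.rep_eq)
    finally show "coeff ((1 - f) * g) F = coeff 1 F" .
  qed
  then show ?thesis ..
qed

lemma series_inverse_eqI:
  assumes "f * g = 1"
  shows "series_inverse f = g"
  unfolding series_inverse_def
proof (rule the_equality)
  show "f * g = 1" by fact
  fix h assume h: "f * h = 1"
  have "h = (f * g) * h" by (simp add: assms)
  also have "\<dots> = (f * h) * g" by (simp only: ac_simps)
  finally show "h = g" by (simp add: h)
qed

lemma series_inverse:
  "coeff f {#} = 0 \<Longrightarrow> (1 - f) * series_inverse (1 - f) = 1"
  by (drule inverse_exists) (auto dest: series_inverse_eqI)

lemma agree_inverse:
  assumes w: "\<And>A B. w (A + B) = w A + w B" and "agree w n f g"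
    "coeff f {#} = 0" "coeff g {#} = 0"
  shows "agree w n (series_inverse (1 - f)) (series_inverse (1 - g))"
proof -
  let ?f = "series_inverse (1 - f)" and ?g = "series_inverse (1 - g)"
  have "agree w n (1 - g) (1 - f)"
    using assms(2) by (simp add: agree_def minus_mset_series.rep_eq)
  then have "agree w n ((1 - g) * ?g) ((1 - f) * ?g)"
    by (intro agree_mult w agree_refl)
  then have "agree w n (?f * ((1 - g) * ?g)) (?f * ((1 - f) * ?g))"
    by (rule agree_mult [where f = ?f and g = ?f, OF w agree_refl])
  also have "?f * ((1 - f) * ?g) = ((1 - f) * ?f) * ?g" by (simp only: ac_simps)
  finally show ?thesis using assms by (simp add: series_inverse)
qed

lemma coeff_graft: "coeff (series_graft d f) {#Node d' A#} = (if d = d' then coeff f A else 0)"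
  by (auto simp: series_graft_def Series_inverse)

lemma coeff_graft_eq_0: "\<nexists>A. F = {#Node d A#} \<Longrightarrow> coeff (series_graft d f) F = 0"
  by (auto simp: series_graft_def Series_inverse)

lemma agree_graft:
  assumes "agree forest_size n f g"
  shows "agree forest_size (Suc n) (series_graft d f) (series_graft d g)"
  unfolding agree_def
proof (intro allI impI)
  fix F :: "'a forest" assume "forest_size F < Suc n"
  then show "coeff (series_graft d f) F = coeff (series_graft d g) F"
    using assms by (cases "\<exists>A. F = {#Node d A#}")
     (auto simp: agree_def coeff_graft coeff_graft_eq_0 forest_size_graft)
qed

text \<open>Restriction of a series to the forests decorated by \<open>D\<close> is a ring morphism.\<close>

definition restrict_series :: "'d set \<Rightarrow> ('d dtree, 'k::comm_ring_1) mset_series \<Rightarrow> ('d dtree, 'k) mset_series" where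
  "restrict_series D f = Series (\<lambda>F. if F \<in> forests D then coeff f F else 0)"

lemma coeff_restrict_series: "coeff (restrict_series D f) F = (if F \<in> forests D then coeff f F else 0)"
  by (simp add: restrict_series_def Series_inverse)

lemma forests_add: "A + B \<in> forests D \<longleftrightarrow> A \<in> forests D \<and> B \<in> forests D"
  by (auto simp: forests_def)

lemma forests_empty [simp]: "{#} \<in> forests D"
  by (simp add: forests_def)

lemma restrict_series_mult: "restrict_series D (f * g) = restrict_series D f * restrict_series D g"
proof (rule mset_series_eqI)
  fix F
  have "coeff (restrict_series D f * restrict_series D g) F =
      (\<Sum>p\<in>splits F. if F \<in> forests D then coeff f (fst p) * coeff g (snd p) else 0)"
    unfolding times_mset_series.rep_eq case_prod_unfold
    by (rule sum.cong) (auto simp: coeff_restrict_series forests_add)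
  then show "coeff (restrict_series D (f * g)) F = coeff (restrict_series D f * restrict_series D g) F"
    by (simp add: coeff_restrict_series times_mset_series.rep_eq case_prod_unfold)
qed

lemma restrict_series_1: "restrict_series D 1 = 1"
  by (rule mset_series_eqI) (auto simp: coeff_restrict_series one_mset_series.rep_eq)
lemma restrict_series_add: "restrict_series D (f + g) = restrict_series D f + restrict_series D g"
  by (rule mset_series_eqI) (auto simp: coeff_restrict_series plus_mset_series.rep_eq)
lemma restrict_series_diff: "restrict_series D (f - g) = restrict_series D f - restrict_series D g"
  by (rule mset_series_eqI) (auto simp: coeff_restrict_series minus_mset_series.rep_eq)
lemma restrict_series_power: "restrict_series D (f ^ n) = restrict_series D f ^ n"
  by (induction n) (auto simp: restrict_series_1 restrict_series_mult)
lemma restrict_series_prod: "finite J \<Longrightarrow> restrict_series D (\<Prod>j\<in>J. f j) = (\<Prod>j\<in>J. restrict_series D (f j))"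
  by (induction J rule: finite_induct) (auto simp: restrict_series_1 restrict_series_mult)
lemma restrict_series_inverse:
  assumes "coeff f {#} = 0"
  shows "restrict_series D (series_inverse (1 - f)) = series_inverse (1 - restrict_series D f)"
proof (rule series_inverse_eqI [symmetric])
  have "(1 - restrict_series D f) * restrict_series D (series_inverse (1 - f)) =
      restrict_series D ((1 - f) * series_inverse (1 - f))"
    by (simp only: restrict_series_1 restrict_series_diff restrict_series_mult)
  then show "(1 - restrict_series D f) * restrict_series D (series_inverse (1 - f)) = 1"
    by (simp only: series_inverse [OF assms] restrict_series_1)
qed

lemma restrict_series_graft:
  assumes "d \<in> D"
  shows "restrict_series D (series_graft d f) = series_graft d (restrict_series D f)"
proof (rule mset_series_eqI)
  fix F
  show "coeff (restrict_series D (series_graft d f)) F = coeff (series_graft d (restrict_series D f)) F"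
  proof (cases "\<exists>A. F = {#Node d A#}")
    case True
    then obtain A where F: "F = {#Node d A#}" ..
    have "F \<in> forests D \<longleftrightarrow> A \<in> forests D"
      using assms by (auto simp: F forests_def)
    then show ?thesis by (simp add: F coeff_restrict_series coeff_graft)
  qed (simp add: coeff_restrict_series coeff_graft_eq_0)
qed

lemma restrict_series_id: "restrict_series D f = f \<longleftrightarrow> f \<in> series_over D"
proof
  assume f: "restrict_series D f = f"
  have "coeff f F = 0" if "F \<notin> forests D" for F
    using coeff_restrict_series [of D f F] that by (simp add: f)
  then show "f \<in> series_over D"
    by (auto simp: series_over_def)
next
  assume "f \<in> series_over D"
  then show "restrict_series D f = f"
    by (intro mset_series_eqI) (auto simp: coeff_restrict_series series_over_def)
qed

definition sdse_map :: "(ext_type \<Rightarrow> (graph_class dtree, 'k::field_char_0) mset_series) \<Rightarrow>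
    ext_type \<Rightarrow> (graph_class dtree, 'k) mset_series" where
  "sdse_map Y i = Series (\<lambda>F.
     \<Sum>c | c \<in> prim_graphs TYPE('k) i \<and> coeff (sdse_term Y c) F \<noteq> 0. coeff (sdse_term Y c) F)"

lemma coeff_sdse_term_eq_0: "\<nexists>A. F = {#Node c A#} \<Longrightarrow> coeff (sdse_term Y c) F = 0"
  by (simp add: sdse_term_def coeff_graft_eq_0)

lemma coeff_sdse_map_Node:
  fixes Y :: "ext_type \<Rightarrow> (graph_class dtree, 'k::field_char_0) mset_series"
  shows "coeff (sdse_map Y i) {#Node c A#} =
    (if c \<in> prim_graphs TYPE('k) i then coeff (sdse_term Y c) {#Node c A#} else 0)"
proof -
  let ?x = "\<lambda>c'. coeff (sdse_term Y c') {#Node c A#}"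
  let ?S = "{c'. c' \<in> prim_graphs TYPE('k) i \<and> ?x c' \<noteq> 0}"
  have "?x c' = 0" if "c' \<noteq> c" for c'
    by (rule coeff_sdse_term_eq_0) (use that in simp)
  then have sub: "?S \<subseteq> {c}" by blast
  have "sum ?x ?S = (if c \<in> prim_graphs TYPE('k) i then ?x c else 0)"
  proof (cases "c \<in> ?S")
    case True
    with sub have "?S = {c}" by blast
    then have "sum ?x ?S = ?x c" by simp
    with True show ?thesis by simp
  next
    case False
    with sub have "?S = {}" by blast
    then have "sum ?x ?S = 0" by (simp only: sum.empty)
    with False show ?thesis by auto
  qed
  then show ?thesis
    by (simp only: sdse_map_def Series_inverse [OF UNIV_I])
qed

lemma coeff_sdse_map_eq_0: "\<nexists>c A. F = {#Node c A#} \<Longrightarrow> coeff (sdse_map Y i) F = 0"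
  using coeff_sdse_term_eq_0[of F _ Y] by (auto simp: sdse_map_def Series_inverse)

lemma coeff_sdse_map_empty [simp]: "coeff (sdse_map Y i) {#} = 0"
  by (rule coeff_sdse_map_eq_0) simp

lemma sdse_map_eqI:
  fixes Y :: "ext_type \<Rightarrow> (graph_class dtree, 'k::field_char_0) mset_series"
  assumes "\<And>c. c \<in> prim_graphs TYPE('k) i \<Longrightarrow> agree w n (sdse_term Y c) (sdse_term Z c)"
  shows "agree w n (sdse_map Y i) (sdse_map Z i)"
  unfolding agree_def
proof (intro allI impI)
  fix F assume "w F < n"
  then show "coeff (sdse_map Y i) F = coeff (sdse_map Z i) F"
    using assms by (cases "\<exists>c A. F = {#Node c A#}")
     (auto simp: coeff_sdse_map_eq_0 coeff_sdse_map_Node agree_def)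
qed

lemma agree_sdse_map:
  assumes "\<And>i. agree forest_size n (Y i) (Z i)" "\<And>i. coeff (Y i) {#} = 0" "\<And>i. coeff (Z i) {#} = 0"
  shows "agree forest_size (Suc n) (sdse_map Y i) (sdse_map Z i)"
proof (rule sdse_map_eqI)
  fix c
  note w = forest_size_add
  let ?n = "num_vertices (class_rep c)" and ?m = "num_edges (class_rep c)"
  have "agree forest_size n ((1 + Y (Inl j)) ^ ?n j) ((1 + Z (Inl j)) ^ ?n j)" for j
    by (intro agree_power w agree_add agree_refl assms(1))
  then have 1: "agree forest_size n (\<Prod>j\<in>UNIV. (1 + Y (Inl j)) ^ ?n j) (\<Prod>j\<in>UNIV. (1 + Z (Inl j)) ^ ?n j)"
    by (intro agree_prod w finite)
  have "agree forest_size n (series_inverse (1 - Y (Inr j)) ^ ?m j) (series_inverse (1 - Z (Inr j)) ^ ?m j)" for j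
    by (intro agree_power w agree_inverse assms)
  then have 2: "agree forest_size n (\<Prod>j\<in>UNIV. series_inverse (1 - Y (Inr j)) ^ ?m j)
      (\<Prod>j\<in>UNIV. series_inverse (1 - Z (Inr j)) ^ ?m j)"
    by (intro agree_prod w finite)
  show "agree forest_size (Suc n) (sdse_term Y c) (sdse_term Z c)"
    unfolding sdse_term_def by (intro agree_graft agree_mult w 1 2)
qed

lemma solves_sdse_iff:
  fixes Y :: "ext_type \<Rightarrow> (graph_class dtree, 'k::field_char_0) mset_series"
  shows "solves_sdse Y \<longleftrightarrow> (\<forall>i. Y i \<in> series_over (\<Union>j. prim_graphs TYPE('k) j) \<and> Y i = sdse_map Y i)"
proof -
  have "Y i = Z \<longleftrightarrow> (\<forall>F. coeff (Y i) F = coeff Z F)" for i Z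
    by (auto intro: mset_series_eqI)
  then show ?thesis
    by (simp add: solves_sdse_def sdse_map_def Series_inverse)
qed

lemma fixpoint_unique:
  assumes "\<And>i. Y i = sdse_map Y i" "\<And>i. Z i = sdse_map Z i"
  shows "Y = Z"
proof -
  have "agree forest_size n (Y i) (Z i)" for n i
  proof (induction n arbitrary: i)
    case 0
    show ?case by (simp add: agree_def)
  next
    case (Suc n)
    have "agree forest_size (Suc n) (sdse_map Y i) (sdse_map Z i)"
      by (intro agree_sdse_map Suc) (metis assms coeff_sdse_map_empty)+
    then show ?case using assms by metis
  qed
  then show ?thesis unfolding agree_def by (intro ext mset_series_eqI) blast
qed

lemma restrict_sdse_map:
  fixes Y :: "ext_type \<Rightarrow> (graph_class dtree, 'k::field_char_0) mset_series"
  defines "D \<equiv> \<Union>j. prim_graphs TYPE('k) j"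
  assumes "\<And>i. coeff (Y i) {#} = 0"
  shows "restrict_series D (sdse_map Y i) = sdse_map (\<lambda>j. restrict_series D (Y j)) i"
proof -
  have *: "restrict_series D (sdse_term Y c) = sdse_term (\<lambda>j. restrict_series D (Y j)) c"
    if "c \<in> prim_graphs TYPE('k) i" for c
  proof -
    have "c \<in> D" using that by (auto simp: D_def)
    then show ?thesis
      by (simp add: sdse_term_def restrict_series_graft restrict_series_mult
          restrict_series_prod restrict_series_power restrict_series_add restrict_series_1
          restrict_series_inverse assms(2))
  qed
  show ?thesis
  proof (rule mset_series_eqI)
    fix F
    show "coeff (restrict_series D (sdse_map Y i)) F =
        coeff (sdse_map (\<lambda>j. restrict_series D (Y j)) i) F"
      by (cases "\<exists>c A. F = {#Node c A#}")
        (auto simp: coeff_restrict_series coeff_sdse_map_eq_0 coeff_sdse_map_Node *[symmetric])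
  qed
qed

lemma ex1_solves_sdse:
  "\<exists>!Y :: ext_type \<Rightarrow> (graph_class dtree, 'k::field_char_0) mset_series. solves_sdse Y"
proof -
  define Z :: "nat \<Rightarrow> ext_type \<Rightarrow> (graph_class dtree, 'k) mset_series" where
    "Z n = (sdse_map ^^ n) (\<lambda>_. 0)" for n
  have Z0: "coeff (Z n i) {#} = 0" for n i
    by (cases n) (auto simp: Z_def zero_mset_series.rep_eq)
  have step: "agree forest_size n (Z n i) (Z (Suc n) i)" for n i
  proof (induction n arbitrary: i)
    case 0
    show ?case by (simp add: agree_def)
  next
    case (Suc n)
    then have "agree forest_size (Suc n) (sdse_map (Z n) i) (sdse_map (Z (Suc n)) i)"
      by (intro agree_sdse_map Z0)
    then show ?case by (simp add: Z_def)
  qed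
  have le: "agree forest_size n (Z n i) (Z (n + m) i)" for n m i
  proof (induction m)
    case (Suc m)
    have "agree forest_size n (Z (n + m) i) (Z (n + Suc m) i)"
      using step[of "n + m" i] by (simp add: agree_def)
    with Suc show ?case by (rule agree_trans)
  qed (simp add: agree_refl)
  define Y where "Y i = Series (\<lambda>F. coeff (Z (Suc (forest_size F)) i) F)" for i
  have YZ: "agree forest_size n (Y i) (Z n i)" for n i
    unfolding agree_def Y_def
  proof (intro allI impI)
    fix F :: "graph_class forest" assume "forest_size F < n"
    then obtain m where "n = Suc (forest_size F) + m" using less_imp_Suc_add by auto
    then have "agree forest_size (Suc (forest_size F)) (Z (Suc (forest_size F)) i) (Z n i)"
      using le [of "Suc (forest_size F)" i m] by (simp only:)
    then show "coeff (Series (\<lambda>F. coeff (Z (Suc (forest_size F)) i) F)) F = coeff (Z n i) F"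
      by (simp add: Series_inverse agree_def)
  qed
  have Y0: "coeff (Y i) {#} = 0" for i
    by (simp add: Y_def Series_inverse Z0)
  have fixY: "Y i = sdse_map Y i" for i
  proof (rule mset_series_eqI)
    fix F :: "graph_class forest"
    let ?n = "forest_size F"
    have "agree forest_size (Suc ?n) (sdse_map Y i) (sdse_map (Z ?n) i)"
      by (intro agree_sdse_map YZ Z0 Y0)
    moreover have "sdse_map (Z ?n) = Z (Suc ?n)" by (simp add: Z_def)
    ultimately show "coeff (Y i) F = coeff (sdse_map Y i) F"
      using YZ[of "Suc ?n" i] by (simp add: agree_def)
  qed
  let ?D = "\<Union>j. prim_graphs TYPE('k) j"
  have "restrict_series ?D (Y i) = sdse_map (\<lambda>j. restrict_series ?D (Y j)) i" for i
    using restrict_sdse_map[of Y i] Y0 fixY by metis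
  then have "(\<lambda>j. restrict_series ?D (Y j)) = Y"
    by (intro fixpoint_unique fixY)
  then have "Y i \<in> series_over ?D" for i
    by (metis restrict_series_id)
  then have "solves_sdse Y"
    using fixY by (simp add: solves_sdse_iff)
  moreover have "Y' = Y" if "solves_sdse Y'" for Y'
    using that fixpoint_unique[of Y' Y] fixY by (simp add: solves_sdse_iff)
  ultimately show ?thesis by blast
qed

end

theory Submission
  imports Defs
begin

text \<open>
  Put \<open>X\<^sub>i = 1 + Y\<^sub>i\<close> for vertex types and \<open>X\<^sub>i = 1 - Y\<^sub>i\<close> for edge types, and for a primitive graph \<open>c\<close> of
  type \<open>i\<close> write the argument of \<open>B\<^sub>c\<close> as \<open>X\<^sub>i M\<^sub>c\<close>, with \<open>M\<^sub>c\<close> a Laurent monomial in the \<open>X\<^sub>j\<close>. Whatever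
  the graduation, \<open>\<Delta>(X\<^sub>i) = \<Sum> X\<^sub>i M\<^sub>B \<otimes> x\<^sub>B B\<close>, where \<open>B\<close> runs over the forests, \<open>x\<^sub>B\<close> is the coefficient of
  \<open>B\<close> in \<open>X\<^sub>i\<close> and \<open>M\<^sub>B\<close> is the product of \<open>M\<^sub>c\<close> over the decorations \<open>c\<close> of \<open>B\<close>. So the system is Hopf
  as soon as \<open>M\<^sub>B\<close> depends only on the degree of \<open>B\<close>, and conversely, if it is Hopf, then the linear part
  of \<open>X\<^sub>i M\<^sub>B\<close> depends only on this degree.

  The exponents of \<open>M\<^sub>c\<close> are an injective linear function of \<open>u\<^sub>c = V\<^sub>c - e\<^sub>i\<close> (with \<open>e\<^sub>i = 0\<close> for edge types),
  by counting half-edges, and the degree of \<open>c\<close> is \<open>C u\<^sub>c\<close>. If \<open>C\<close> has rank 4, the degree of \<open>B\<close> determines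
  the sum of the \<open>u\<^sub>c\<close> and hence \<open>M\<^sub>B\<close>. Otherwise take \<open>w \<noteq> 0\<close> with \<open>C w = 0\<close>. The trees with the gluon tadpole
  at the root and arbitrary numbers of quark loops, ghost loops, gluon loops and tadpoles as leaves
  all occur in \<open>Y\<^sub>7\<close>, and the vectors of these leaves form a basis of \<open>\<rat>\<^sup>4\<close>, so two such trees have total
  vectors that differ by a nonzero multiple of \<open>w\<close>: they have the same degree, but different linear parts.
\<close>

text \<open>Dividing the argument of \<open>B_c\<close> by \<open>X_i\<close> is what makes the
  exponents linear rather than affine: the external legs, which disturb the half-edge count, are
  compensated by the missing factor. Only for this reason does the sum of the \<open>u_c\<close>
  over a forest determine \<open>M_B\<close>. The Hopf condition reduces to the coproducts of the
  generators, because the antipode is a geometric series in convolution powers and so preserves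
  every sub-bialgebra. For necessity, trees must be known to occur with nonzero coefficient. The
  tadpole has argument \<open>(1 + Y_4) / (1 - Y_7)\<close>, so it accepts any number of children of
  type 7, and the resulting coefficients are positive integers, nonzero in characteristic zero. As
  the root has type 7, such a tree occurs in no other series. Linear parts suffice as a test: the
  coefficient of \<open>X_i M_B\<close> at a one-vertex tree of type \<open>j\<close>, with
  \<open>j\<close> different from \<open>i\<close>, is up to sign the exponent of
  \<open>X_j\<close>. All explicit graphs have one loop, which leaves no room for a smaller 1PI
  subgraph and makes primitivity accessible.\<close>

abbreviation lookup where "lookup \<equiv> Poly_Mapping.lookup"
abbreviation keys where "keys \<equiv> Poly_Mapping.keys"
abbreviation single where "single \<equiv> Poly_Mapping.single"

text \<open>Injectivity is left invertibility, which means that the rows span the whole space; the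
  rank is the dimension of this span.\<close>

lemma full_rank_iff_inj:
  fixes A :: "'a::field^'n^'m"
  shows "rank A = CARD('n) \<longleftrightarrow> inj ((*v) A)"
  by (simp add: matrix_left_invertible_injective [symmetric] matrix_left_invertible_span_rows_gen row_rank_def_gen
      vec.dim_eq_full [symmetric] card_cart_basis vec.dimension_def)

section \<open>Linear extension of maps given on a basis\<close>

lemma lookup_scale: "lookup (scale c x) a = c * lookup x a"
  by (simp add: scale_def Poly_Mapping.map.rep_eq when_def)

lemma lookup_linear_ext: "lookup (linear_ext f x) b = (\<Sum>a\<in>keys x. lookup x a * lookup (f a) b)"
  by (simp add: linear_ext_def lookup_sum lookup_scale)

text \<open>Supports change under addition and scaling; a common finite index set makes the sums
  comparable.\<close>

lemma lookup_linear_ext_superset: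
  assumes "finite S" "keys x \<subseteq> S"
  shows "lookup (linear_ext f x) b = (\<Sum>a\<in>S. lookup x a * lookup (f a) b)"
  unfolding lookup_linear_ext
  by (rule sum.mono_neutral_left) (use assms in \<open>auto simp: in_keys_iff\<close>)

lemma linear_ext_add: "linear_ext f (x + y) = linear_ext f x + linear_ext f y"
proof (rule poly_mapping_eqI)
  fix b
  let ?S = "keys x \<union> keys y"
  have "lookup (linear_ext f z) b = (\<Sum>a\<in>?S. lookup z a * lookup (f a) b)" if "z \<in> {x, y, x + y}" for z
    by (rule lookup_linear_ext_superset) (use that keys_add[of x y] in auto)
  then show "lookup (linear_ext f (x + y)) b = lookup (linear_ext f x + linear_ext f y) b"
    by (simp add: lookup_add distrib_right sum.distrib)
qed

lemma linear_ext_0 [simp]: "linear_ext f 0 = 0"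
  by (simp add: linear_ext_def)

lemma linear_ext_scale: "linear_ext f (scale c x) = scale c (linear_ext f x)"
proof (rule poly_mapping_eqI)
  fix b
  have "keys (scale c x) \<subseteq> keys x" by (auto simp: in_keys_iff lookup_scale)
  then show "lookup (linear_ext f (scale c x)) b = lookup (scale c (linear_ext f x)) b"
    by (simp add: lookup_linear_ext_superset[of "keys x"] lookup_scale sum_distrib_left mult.assoc)
qed

lemma scale_add: "scale c (x + y) = scale c x + scale c y"
  by (rule poly_mapping_eqI) (simp add: lookup_scale lookup_add distrib_left)

lemma scale_0 [simp]: "scale c 0 = 0"
  by (rule poly_mapping_eqI) (simp add: lookup_scale)

lemma scale_1 [simp]: "scale 1 x = x"
  by (rule poly_mapping_eqI) (simp add: lookup_scale)

lemma scale_0_left [simp]: "scale 0 x = 0"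
  by (rule poly_mapping_eqI) (simp add: lookup_scale)

lemma scale_scale: "scale c (scale d x) = scale (c * d) x"
  by (rule poly_mapping_eqI) (simp add: lookup_scale mult.assoc)

lemma scale_single: "scale c (single a d) = single a (c * d)"
  by (rule poly_mapping_eqI) (simp add: lookup_scale lookup_single when_def)

lemma scale_conv_mult: "scale c x = single 0 c * (x :: 'a::monoid_add \<Rightarrow>\<^sub>0 'k::comm_ring_1)"
  by (simp add: scale_def mult_map_scale_conv_mult)

lemma scale_mult:
  fixes x y :: "'a::comm_monoid_add \<Rightarrow>\<^sub>0 'k::comm_ring_1"
  shows "scale c x * scale d y = scale (c * d) (x * y)"
proof -
  have "scale c x * scale d y = single 0 c * single 0 d * (x * y)"
    by (simp only: scale_conv_mult ac_simps)
  then show ?thesis by (simp add: scale_conv_mult mult_single)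
qed

lemma linear_ext_single [simp]: "linear_ext f (single a c) = scale c (f a)"
  by (cases "c = 0") (auto simp: linear_ext_def)

lemma linear_ext_1 [simp]: "linear_ext f (1 :: 'a::monoid_add \<Rightarrow>\<^sub>0 'k::comm_ring_1) = f 0"
  by (simp flip: single_one)

text \<open>Reduces additive identities to basis elements; most linear identities below are obtained
  from it.\<close>

lemma poly_mapping_induct [case_names zero single add]:
  fixes x :: "'a \<Rightarrow>\<^sub>0 'k::comm_monoid_add"
  assumes "P 0" "\<And>a c. P (single a c)" "\<And>x y. P x \<Longrightarrow> P y \<Longrightarrow> P (x + y)"
  shows "P x"
proof -
  have "x = (\<Sum>a\<in>keys x. single a (lookup x a))"
    by (rule poly_mapping_eqI) (auto simp: lookup_sum lookup_single when_def in_keys_iff)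
  moreover have "P (\<Sum>a\<in>A. single a (lookup x a))" for A
    by (induction A rule: infinite_finite_induct) (auto intro: assms)
  ultimately show ?thesis by metis
qed

lemma linear_ext_linear_ext: "linear_ext f (linear_ext g x) = linear_ext (\<lambda>a. linear_ext f (g a)) x"
  by (induction x rule: poly_mapping_induct) (auto simp: linear_ext_add linear_ext_scale)

lemma linear_ext_fun_add: "linear_ext (\<lambda>a. f a + g a) x = linear_ext f x + linear_ext g x"
  by (induction x rule: poly_mapping_induct) (auto simp: linear_ext_add scale_add)

lemma linear_ext_fun_scale: "linear_ext (\<lambda>a. scale c (f a)) x = scale c (linear_ext f x)"
  by (induction x rule: poly_mapping_induct) (auto simp: linear_ext_add scale_add scale_scale mult.commute)

lemma linear_ext_fun_0 [simp]: "linear_ext (\<lambda>a. 0) x = 0"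
  by (induction x rule: poly_mapping_induct) (auto simp: linear_ext_add)

lemma linear_ext_fun_sum: "linear_ext (\<lambda>a. \<Sum>i\<in>I. f i a) x = (\<Sum>i\<in>I. linear_ext (f i) x)"
  by (induction I rule: infinite_finite_induct) (auto simp: linear_ext_fun_add)

lemma linear_ext_id [simp]: "linear_ext (\<lambda>a. single a 1) x = x"
  by (induction x rule: poly_mapping_induct) (auto simp: linear_ext_add scale_single)

lemma linear_ext_cong: "(\<And>a. a \<in> keys x \<Longrightarrow> f a = g a) \<Longrightarrow> linear_ext f x = linear_ext g x"
  by (simp add: linear_ext_def)

text \<open>The universal property of a monoid algebra. It is the source of multiplicativity for all
  variants of the coproduct.\<close>

lemma linear_ext_mult:
  fixes x y :: "'a::comm_monoid_add \<Rightarrow>\<^sub>0 'k::comm_ring_1" and f :: "'a \<Rightarrow> 'b::comm_monoid_add \<Rightarrow>\<^sub>0 'k"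
  assumes f: "\<And>a b. f (a + b) = f a * f b"
  shows "linear_ext f (x * y) = linear_ext f x * linear_ext f y"
proof (induction x rule: poly_mapping_induct)
  case (single a c)
  show ?case
    by (induction y rule: poly_mapping_induct)
      (auto simp: mult_single linear_ext_add distrib_left f scale_mult)
qed (auto simp: linear_ext_add distrib_right)

lemma linear_ext_mult_left:
  fixes y :: "'b::comm_monoid_add \<Rightarrow>\<^sub>0 'k::comm_ring_1"
  shows "linear_ext f x * y = linear_ext (\<lambda>a. f a * y) x"
  by (induction x rule: poly_mapping_induct)
    (auto simp: linear_ext_add distrib_right scale_conv_mult mult.assoc)

lemma linear_ext_mult_right:
  fixes y :: "'b::comm_monoid_add \<Rightarrow>\<^sub>0 'k::comm_ring_1"
  shows "y * linear_ext f x = linear_ext (\<lambda>a. y * f a) x"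
  using linear_ext_mult_left[of f x y] by (simp add: mult.commute)

section \<open>Tensor products of finitely supported functions\<close>

lemma tensor_add_left: "tensor (x + x') y = tensor x y + tensor x' y"
  by (simp add: tensor_def linear_ext_add)

lemma tensor_add_right: "tensor x (y + y') = tensor x y + tensor x y'"
  by (simp add: tensor_def linear_ext_add linear_ext_fun_add)

lemma tensor_scale_left: "tensor (scale c x) y = scale c (tensor x y)"
  by (simp add: tensor_def linear_ext_scale)

lemma tensor_0_left [simp]: "tensor 0 y = 0"
  and tensor_0_right [simp]: "tensor x 0 = 0"
  by (simp_all add: tensor_def)

lemma tensor_single: "tensor (single a c) (single b d) = single (a, b) (c * d)"
  by (simp add: tensor_def scale_single)

lemma tensor_single_one:
  "tensor (single a c) (1 :: 'b::monoid_add \<Rightarrow>\<^sub>0 'k::comm_ring_1) = single (a, 0) c"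
  using tensor_single[of a c 0 "1 :: 'k"] by simp

lemma tensor_1: "tensor (1 :: 'a::monoid_add \<Rightarrow>\<^sub>0 'k::comm_ring_1) (1 :: 'b::monoid_add \<Rightarrow>\<^sub>0 'k) = single (0, 0) 1"
  using tensor_single_one[of "0 :: 'a" "1 :: 'k"] by simp

lemma lookup_tensor: "lookup (tensor x y) (a, b) = lookup x a * lookup y b"
proof (induction x rule: poly_mapping_induct)
  case (single a' c)
  show ?case
    by (induction y rule: poly_mapping_induct)
      (auto simp: tensor_single lookup_single when_def tensor_add_right lookup_add distrib_left)
qed (auto simp: tensor_add_left lookup_add distrib_right)

lemma tensor_mult:
  fixes x x' :: "'a::comm_monoid_add \<Rightarrow>\<^sub>0 'k::comm_ring_1" and y y' :: "'b::comm_monoid_add \<Rightarrow>\<^sub>0 'k"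
  shows "tensor x y * tensor x' y' = tensor (x * x') (y * y')"
proof (induction x rule: poly_mapping_induct)
  case (single a c)
  show ?case
  proof (induction x' rule: poly_mapping_induct)
    case (single a' c')
    show ?case
    proof (induction y rule: poly_mapping_induct)
      case (single b d)
      show ?case
        by (induction y' rule: poly_mapping_induct)
          (auto simp: tensor_single mult_single tensor_add_right distrib_left distrib_right mult.assoc mult.left_commute)
    qed (auto simp: tensor_add_right distrib_right)
  qed (auto simp: tensor_add_left distrib_left)
qed (auto simp: tensor_add_left distrib_right)

lemma linear_ext_tensor:
  "linear_ext (\<lambda>(a, b). h a b) (tensor x y) = linear_ext (\<lambda>a. linear_ext (h a) y) x"
  by (simp add: tensor_def linear_ext_linear_ext)

section \<open>The coproduct of forests\<close>

text \<open>The three cases match the three properties that determine the coproduct: unit, cocycle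
  identity for grafting, multiplicativity.\<close>

lemma forest_induct [case_names empty graft add]:
  assumes "P {#}" "\<And>d F. P F \<Longrightarrow> P {#Node d F#}" "\<And>A B. P A \<Longrightarrow> P B \<Longrightarrow> P (A + B)"
  shows "P F"
proof -
  have multi: "P F" if "\<And>t. t \<in># F \<Longrightarrow> P {#t#}" for F
    using that
  proof (induction F)
    case (add t F)
    then have "P ({#t#} + F)" by (intro assms(3)) auto
    then show ?case by simp
  qed (rule assms(1))
  have "P {#t#}" for t
    by (induction t) (auto intro: assms(2) multi)
  then show ?thesis by (rule multi)
qed

primrec tree_decor :: "'d dtree \<Rightarrow> 'd multiset" where
  "tree_decor (Node d F) = add_mset d (\<Sum>\<^sub># (image_mset tree_decor F))"

text \<open>Size, degree and membership in \<open>forests D\<close> all depend on this multiset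
  alone, so a single invariant of the coproduct controls all of them.\<close>

definition decor :: "'d forest \<Rightarrow> 'd multiset" where
  "decor F = \<Sum>\<^sub># (image_mset tree_decor F)"

lemma decor_empty [simp]: "decor {#} = {#}"
  and decor_add [simp]: "decor (A + B) = decor A + decor B"
  and decor_graft [simp]: "decor {#Node d F#} = add_mset d (decor F)"
  by (simp_all add: decor_def)

lemma forest_size_decor: "forest_size F = size (decor F)"
  by (induction F rule: forest_induct) (auto simp: forest_size_add forest_size_graft)

lemma forest_degree_decor: "forest_degree \<delta> F = sum_mset (image_mset \<delta> (decor F))"
  by (induction F rule: forest_induct) (auto simp: forest_degree_def)

lemma forests_decor: "F \<in> forests D \<longleftrightarrow> set_mset (decor F) \<subseteq> D"
  by (induction F rule: forest_induct) (auto simp: forests_def)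

lemma decor_eq_empty_iff: "decor F = {#} \<longleftrightarrow> F = {#}"
proof
  assume "decor F = {#}"
  then show "F = {#}"
  proof (cases F)
    case (add t F')
    then show ?thesis using \<open>decor F = {#}\<close> by (cases t) (simp add: decor_def)
  qed simp
qed simp

text \<open>Induction on the size: a forest of size at most \<open>Suc n\<close> is a multiset of at
  most \<open>Suc n\<close> trees, and each tree is a root in \<open>D\<close> above a forest of
  size at most \<open>n\<close>.\<close>

lemma finite_forests:
  assumes "finite D"
  shows "finite {F \<in> forests D. forest_size F \<le> n}"
proof (induction n)
  case 0
  have "{F \<in> forests D. forest_size F \<le> 0} \<subseteq> {{#}}"
    by (auto simp: forest_size_decor decor_eq_empty_iff)
  then show ?case by (rule finite_subset) simp
next
  case (Suc n)
  define T where "T = case_prod Node ` (D \<times> {F \<in> forests D. forest_size F \<le> n})"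
  have "finite T" using assms Suc by (simp add: T_def)
  have "{F \<in> forests D. forest_size F \<le> Suc n} \<subseteq> mset ` {xs. set xs \<subseteq> T \<and> length xs \<le> Suc n}"
  proof (clarify)
    fix F assume F: "F \<in> forests D" "forest_size F \<le> Suc n"
    obtain xs where xs: "mset xs = F" using ex_mset by blast
    have "t \<in> T" if tF: "t \<in># F" for t
    proof -
      obtain F' where F': "F = add_mset t F'" using tF by (meson multi_member_split)
      obtain d A where t: "t = Node d A" by (cases t)
      have "F = {#Node d A#} + F'" by (simp add: F' t)
      then have "d \<in> D" "A \<in> forests D" "forest_size A \<le> n"
        using F by (auto simp del: union_mset_add_mset_left union_mset_add_mset_right add_mset_add_single
          simp: forests_decor forest_size_decor)
      then show ?thesis by (auto simp: T_def t forest_size_decor)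
    qed
    moreover have "size F \<le> forest_size F"
      unfolding forest_size_def
    proof (induction F)
      case (add t F)
      then show ?case by (cases t) simp
    qed simp
    ultimately show "F \<in> mset ` {xs. set xs \<subseteq> T \<and> length xs \<le> Suc n}"
      using F(2) by (intro image_eqI[of _ _ xs]) (auto simp: xs[symmetric] simp flip: size_mset)
  qed
  then show ?case
    by (rule finite_subset) (simp add: finite_lists_length_le \<open>finite T\<close>)
qed

text \<open>Makes the coefficientwise coproduct of a formal series a finite sum.\<close>

lemma finite_decor: "finite {F. decor F = M}"
proof (rule finite_subset)
  show "{F. decor F = M} \<subseteq> {F \<in> forests (set_mset M). forest_size F \<le> size M}"
    by (auto simp: forests_decor forest_size_decor)
qed (simp add: finite_forests)

definition forest_coproduct :: "'d forest \<Rightarrow> ('d forest \<times> 'd forest) \<Rightarrow>\<^sub>0 'k::comm_ring_1" where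
  "forest_coproduct F = (\<Prod>t\<in>#F. tree_coproduct t)"

text \<open>The map \<open>Id\<close> tensor \<open>B_d\<close>, with an arbitrary basis in the left
  factor.\<close>

definition graft_right :: "'d \<Rightarrow> (('a \<times> 'd forest) \<Rightarrow>\<^sub>0 'k) \<Rightarrow> ('a \<times> 'd forest) \<Rightarrow>\<^sub>0 'k::comm_ring_1" where
  "graft_right d = linear_ext (\<lambda>(A, B). single (A, {#Node d B#}) 1)"

lemma ck_coproduct_eq: "ck_coproduct = linear_ext forest_coproduct"
  by (rule ext) (simp add: ck_coproduct_def forest_coproduct_def[abs_def])

lemma forest_coproduct_empty [simp]: "forest_coproduct {#} = 1"
  by (simp add: forest_coproduct_def)

lemma forest_coproduct_add: "forest_coproduct (A + B) = forest_coproduct A * forest_coproduct B"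
  by (simp add: forest_coproduct_def)

lemma forest_coproduct_graft:
  "forest_coproduct {#Node d F#} = single ({#Node d F#}, {#}) 1 + graft_right d (forest_coproduct F)"
  by (simp add: forest_coproduct_def graft_right_def)

lemma ck_coproduct_mult: "ck_coproduct (x * y) = ck_coproduct x * ck_coproduct y"
  unfolding ck_coproduct_eq by (rule linear_ext_mult) (rule forest_coproduct_add)

lemma ck_coproduct_add: "ck_coproduct (x + y) = ck_coproduct x + ck_coproduct y"
  by (simp add: ck_coproduct_eq linear_ext_add)

lemma ck_coproduct_scale: "ck_coproduct (scale c x) = scale c (ck_coproduct x)"
  by (simp add: ck_coproduct_eq linear_ext_scale)

lemma ck_coproduct_1: "ck_coproduct 1 = 1"
  by (simp add: ck_coproduct_eq)

lemma graft_right_single: "graft_right d (single (A, B) c) = single (A, {#Node d B#}) c"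
  by (simp add: graft_right_def scale_single)

lemma lookup_graft_right_Node: "lookup (graft_right d x) (A, {#Node d' B#}) = (if d = d' then lookup x (A, B) else 0)"
proof (induction x rule: poly_mapping_induct)
  case (single p c)
  then show ?case by (cases p) (auto simp: graft_right_def lookup_scale lookup_single when_def)
qed (auto simp: graft_right_def linear_ext_add lookup_add)

lemma lookup_graft_right_eq_0: "(\<nexists>B'. B = {#Node d B'#}) \<Longrightarrow> lookup (graft_right d x) (A, B) = 0"
proof (induction x rule: poly_mapping_induct)
  case (single p c)
  then show ?case by (cases p) (auto simp: graft_right_def lookup_scale lookup_single when_def)
qed (auto simp: graft_right_def linear_ext_add lookup_add)

text \<open>A cut distributes the vertices over the two factors and keeps their decorations.
  Homogeneity for every degree follows from this.\<close>

lemma decor_forest_coproduct: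
  assumes "lookup (forest_coproduct F :: _ \<Rightarrow>\<^sub>0 'k::comm_ring_1) (A, B) \<noteq> 0"
  shows "decor A + decor B = decor F"
  using assms
proof (induction F arbitrary: A B rule: forest_induct)
  case empty
  then show ?case by (auto simp: lookup_one when_def zero_prod_def split: if_splits)
next
  case (graft d F)
  show ?case
  proof (cases "lookup (graft_right d (forest_coproduct F) :: _ \<Rightarrow>\<^sub>0 'k) (A, B) = 0")
    case True
    then show ?thesis using graft.prems
      by (auto simp: forest_coproduct_graft lookup_add lookup_single when_def split: if_splits)
  next
    case False
    then obtain B' where B: "B = {#Node d B'#}"
      using lookup_graft_right_eq_0[of B d "forest_coproduct F" A] by metis
    then show ?thesis using False graft.IH[of A B'] by (auto simp: lookup_graft_right_Node)
  qed
next
  case (add F G)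
  have "(A, B) \<in> keys (forest_coproduct F * forest_coproduct G :: _ \<Rightarrow>\<^sub>0 'k)"
    using add.prems unfolding forest_coproduct_add in_keys_iff .
  then have "(A, B) \<in> {p + q |p q. p \<in> keys (forest_coproduct F :: _ \<Rightarrow>\<^sub>0 'k) \<and>
      q \<in> keys (forest_coproduct G :: _ \<Rightarrow>\<^sub>0 'k)}"
    using keys_mult by (rule set_mp[rotated])
  then obtain A1 B1 A2 B2 where 1: "(A1, B1) \<in> keys (forest_coproduct F :: _ \<Rightarrow>\<^sub>0 'k)"
    and 2: "(A2, B2) \<in> keys (forest_coproduct G :: _ \<Rightarrow>\<^sub>0 'k)" and *: "(A, B) = (A1, B1) + (A2, B2)"
    by (force simp del: add_Pair)
  from 1 have "decor A1 + decor B1 = decor F"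
    by (intro add.IH(1)) (simp add: in_keys_iff)
  moreover from 2 have "decor A2 + decor B2 = decor G"
    by (intro add.IH(2)) (simp add: in_keys_iff)
  moreover have "decor A + decor B = (decor A1 + decor B1) + (decor A2 + decor B2)"
    using * by simp
  ultimately show ?case by (simp only: decor_add)
qed

subsection \<open>Coassociativity\<close>

text \<open>The map \<open>Delta\<close> tensor \<open>Id\<close>. Triples are nested to the right,
  so that its values can be compared with those of \<open>Id\<close> tensor
  \<open>Delta\<close>.\<close>

definition coproduct_left :: "(('d forest \<times> 'd forest) \<Rightarrow>\<^sub>0 'k::comm_ring_1) \<Rightarrow>
    ('d forest \<times> 'd forest \<times> 'd forest) \<Rightarrow>\<^sub>0 'k" where
  "coproduct_left = linear_ext (\<lambda>(A, B). linear_ext (\<lambda>(A', A''). single (A', A'', B) 1) (forest_coproduct A))"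

definition coproduct_right :: "(('d forest \<times> 'd forest) \<Rightarrow>\<^sub>0 'k::comm_ring_1) \<Rightarrow>
    ('d forest \<times> 'd forest \<times> 'd forest) \<Rightarrow>\<^sub>0 'k" where
  "coproduct_right = linear_ext (\<lambda>(A, B). tensor (single A 1) (forest_coproduct B))"

lemma coproduct_left_mult:
  fixes x y :: "('d forest \<times> 'd forest) \<Rightarrow>\<^sub>0 'k::comm_ring_1"
  shows "coproduct_left (x * y) = coproduct_left x * coproduct_left y"
  unfolding coproduct_left_def
proof (rule linear_ext_mult)
  have *: "linear_ext (\<lambda>(A', A''). single (A', A'', B) 1) x * linear_ext (\<lambda>(A', A''). single (A', A'', C) 1) y
    = linear_ext (\<lambda>(A', A''). single (A', A'', B + C) 1) (x * y)"
    for B C :: "'d forest" and x y :: "('d forest \<times> 'd forest) \<Rightarrow>\<^sub>0 'k"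
  proof (induction x rule: poly_mapping_induct)
    case (single p c)
    show ?case
    proof (induction y rule: poly_mapping_induct)
      case (single q d)
      then show ?case by (cases p; cases q) (simp add: mult_single scale_single)
    qed (auto simp: distrib_left linear_ext_add)
  qed (auto simp: distrib_right linear_ext_add)
  let ?f = "\<lambda>(A, B). linear_ext (\<lambda>(A', A''). single (A', A'', B) 1) (forest_coproduct A) :: _ \<Rightarrow>\<^sub>0 'k"
  show "?f (p + q) = ?f p * ?f q" for p q :: "'d forest \<times> 'd forest"
    by (cases p; cases q) (simp add: * forest_coproduct_add)
qed

lemma coproduct_right_mult:
  fixes x y :: "('d forest \<times> 'd forest) \<Rightarrow>\<^sub>0 'k::comm_ring_1"
  shows "coproduct_right (x * y) = coproduct_right x * coproduct_right y"
  unfolding coproduct_right_def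
proof (rule linear_ext_mult)
  let ?f = "\<lambda>(A, B). tensor (single A 1) (forest_coproduct B) :: _ \<Rightarrow>\<^sub>0 'k"
  show "?f (p + q) = ?f p * ?f q" for p q :: "'d forest \<times> 'd forest"
    by (cases p; cases q) (simp add: tensor_mult mult_single forest_coproduct_add)
qed

lemma coproduct_left_add: "coproduct_left (x + y) = coproduct_left x + coproduct_left y"
  and coproduct_right_add: "coproduct_right (x + y) = coproduct_right x + coproduct_right y"
  by (simp_all add: coproduct_left_def coproduct_right_def linear_ext_add)

text \<open>For a grafted tree both sides consist of the term \<open>B_d(F)\<close> in the first
  factor, the terms grafted in the middle factor, and the recursive terms grafted in the last one.
  The middle terms come from the coproduct of the root term on the left, and from cutting a grafted
  tree at its root on the right.\<close>

lemma coassociativity: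
  fixes F :: "'a forest"
  shows "coproduct_left (forest_coproduct F) = (coproduct_right (forest_coproduct F) :: _ \<Rightarrow>\<^sub>0 'k::comm_ring_1)"
proof (induction F rule: forest_induct)
  case empty
  show ?case
    by (simp add: coproduct_left_def coproduct_right_def zero_prod_def tensor_1)
next
  case (add A B)
  then show ?case by (simp add: forest_coproduct_add coproduct_left_mult coproduct_right_mult)
next
  case (graft d F)
  \<comment> \<open>Grafting on the last of three factors, through which both iterated coproducts
    commute with \<open>graft_right\<close>.\<close>
  define gr where "gr = (linear_ext (\<lambda>(A, B, C). single (A, B, {#Node d C#}) 1) ::
     (('a forest \<times> 'a forest \<times> 'a forest) \<Rightarrow>\<^sub>0 'k) \<Rightarrow> _)"
  have l: "coproduct_left (graft_right d x) = gr (coproduct_left x)" for x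
  proof (induction x rule: poly_mapping_induct)
    case (single p c)
    then show ?case
      by (cases p) (simp add: coproduct_left_def graft_right_def gr_def linear_ext_scale linear_ext_linear_ext
        split_def)
  qed (auto simp: coproduct_left_def graft_right_def gr_def linear_ext_add)
  have t: "tensor (single A 1) (graft_right d y) = gr (tensor (single A 1) y)" for A y
  proof (induction y rule: poly_mapping_induct)
    case (single p c)
    then show ?case by (cases p) (simp add: tensor_single graft_right_def gr_def scale_single)
  qed (auto simp: graft_right_def gr_def linear_ext_add tensor_add_right)
  have r: "coproduct_right (graft_right d x) =
      linear_ext (\<lambda>(A, B). single (A, {#Node d B#}, {#}) 1) x + gr (coproduct_right x)" for x
  proof (induction x rule: poly_mapping_induct)
    case (single p c)
    have *: "gr (scale c y) = scale c (gr y)" for y by (simp add: gr_def linear_ext_scale)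
    show ?case
      by (cases p) (simp add: coproduct_right_def graft_right_single
        forest_coproduct_graft tensor_add_right tensor_single scale_add t *)
  qed (auto simp: coproduct_right_def graft_right_def gr_def linear_ext_add)
  have "linear_ext (\<lambda>(A, B). single (A, B, {#}) 1) (graft_right d x) = linear_ext (\<lambda>(A, B). single (A, {#Node d B#}, {#}) 1) x"
    for x :: "('a forest \<times> 'a forest) \<Rightarrow>\<^sub>0 'k"
    by (simp add: graft_right_def linear_ext_linear_ext split_def)
  then have "coproduct_left (single ({#Node d F#}, {#}) 1) = single ({#Node d F#}, {#}, {#}) 1 +
      linear_ext (\<lambda>(A, B). single (A, {#Node d B#}, {#}) 1) (forest_coproduct F :: _ \<Rightarrow>\<^sub>0 'k)"
    by (simp add: coproduct_left_def forest_coproduct_graft linear_ext_add)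
  moreover have "coproduct_right (single ({#Node d F#}, {#}) 1) = (single ({#Node d F#}, {#}, {#}) 1 :: _ \<Rightarrow>\<^sub>0 'k)"
    by (simp add: coproduct_right_def tensor_single_one zero_prod_def)
  ultimately show ?case
    by (simp add: forest_coproduct_graft coproduct_left_add coproduct_right_add l r graft add.assoc)
qed

subsection \<open>The antipode\<close>

lemma linear_ext_counit_left:
  "linear_ext (\<lambda>(A, B). if A = {#} then single B 1 else 0) (forest_coproduct F) = (single F 1 :: _ \<Rightarrow>\<^sub>0 'k::comm_ring_1)"
proof (induction F rule: forest_induct)
  case (graft d F)
  have "linear_ext (\<lambda>(A, B). if A = {#} then single B 1 else 0) (graft_right d x) =
      linear_ext (\<lambda>B. single {#Node d B#} 1) (linear_ext (\<lambda>(A, B). if A = {#} then single B 1 else 0) x)"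
    for x :: "('a forest \<times> 'a forest) \<Rightarrow>\<^sub>0 'k"
    by (auto simp: graft_right_def linear_ext_linear_ext split_def if_distrib intro!: linear_ext_cong)
  then show ?case by (simp add: forest_coproduct_graft linear_ext_add graft)
next
  case (add A B)
  then show ?case
    by (subst forest_coproduct_add, subst linear_ext_mult) (auto simp: mult_single)
qed (simp add: zero_prod_def)

lemma linear_ext_counit_right:
  "linear_ext (\<lambda>(A, B). if B = {#} then single A 1 else 0) (forest_coproduct F) = (single F 1 :: _ \<Rightarrow>\<^sub>0 'k::comm_ring_1)"
proof (induction F rule: forest_induct)
  case (graft d F)
  have "linear_ext (\<lambda>(A, B). if B = {#} then single A 1 else 0) (graft_right d x) = 0"
    for x :: "('a forest \<times> 'a forest) \<Rightarrow>\<^sub>0 'k"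
    by (simp add: graft_right_def linear_ext_linear_ext split_def)
  then show ?case by (simp add: forest_coproduct_graft linear_ext_add)
next
  case (add A B)
  then show ?case
    by (subst forest_coproduct_add, subst linear_ext_mult) (auto simp: mult_single)
qed (simp add: zero_prod_def)

lemma lookup_forest_coproduct_empty_right:
  "lookup (forest_coproduct F :: _ \<Rightarrow>\<^sub>0 'k::comm_ring_1) (A, {#}) = (if A = F then 1 else 0)"
proof -
  have "lookup (linear_ext (\<lambda>(A, B). if B = {#} then single A 1 else 0) x) A = lookup x (A, {#})"
    for x :: "('a forest \<times> 'a forest) \<Rightarrow>\<^sub>0 'k"
    by (induction x rule: poly_mapping_induct)
      (auto simp: linear_ext_add lookup_add lookup_scale lookup_single when_def split: if_splits)
  from this[of "forest_coproduct F"] show ?thesis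
    by (auto simp: linear_ext_counit_right lookup_single when_def split: if_splits)
qed

text \<open>The convolution product of linear maps, each represented by its values on
  forests.\<close>

definition conv :: "('d forest \<Rightarrow> 'd forest \<Rightarrow>\<^sub>0 'k::comm_ring_1) \<Rightarrow> ('d forest \<Rightarrow> 'd forest \<Rightarrow>\<^sub>0 'k) \<Rightarrow>
    'd forest \<Rightarrow> 'd forest \<Rightarrow>\<^sub>0 'k" where
  "conv f g F = linear_ext (\<lambda>(A, B). f A * g B) (forest_coproduct F)"

lemma conv_assoc: "conv (conv f g) h = conv f (conv g h)"
proof
  fix F
  let ?T = "linear_ext (\<lambda>(A, B, C). f A * (g B * h C))"
  have l: "?T (coproduct_left x) = linear_ext (\<lambda>(A, B). conv f g A * h B) x" for x
  proof (induction x rule: poly_mapping_induct)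
    case (single p c)
    show ?case
      by (cases p) (auto simp: coproduct_left_def conv_def linear_ext_scale linear_ext_linear_ext
        linear_ext_mult_left mult.assoc intro!: arg_cong[of _ _ "scale c"] linear_ext_cong)
  qed (auto simp: coproduct_left_def linear_ext_add)
  have r: "?T (coproduct_right x) = linear_ext (\<lambda>(A, B). f A * conv g h B) x" for x
  proof (induction x rule: poly_mapping_induct)
    case (single p c)
    show ?case
      by (cases p) (auto simp: coproduct_right_def conv_def linear_ext_scale linear_ext_linear_ext
        linear_ext_mult_right tensor_def intro!: arg_cong[of _ _ "scale c"] linear_ext_cong)
  qed (auto simp: coproduct_right_def linear_ext_add)
  show "conv (conv f g) h F = conv f (conv g h) F"
    using l[of "forest_coproduct F"] r[of "forest_coproduct F"]
    by (simp add: coassociativity conv_def[of _ h] conv_def[of f "conv g h"])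
qed

definition conv_unit :: "'d forest \<Rightarrow> 'd forest \<Rightarrow>\<^sub>0 'k::comm_ring_1" where
  "conv_unit F = (if F = {#} then 1 else 0)"

lemma conv_unit_left [simp]: "conv conv_unit f = f"
proof
  fix F
  have "conv conv_unit f F = linear_ext f (linear_ext (\<lambda>(A, B). if A = {#} then single B 1 else 0) (forest_coproduct F))"
    unfolding conv_def linear_ext_linear_ext by (rule linear_ext_cong) (auto simp: conv_unit_def)
  then show "conv conv_unit f F = f F" by (simp add: linear_ext_counit_left)
qed

lemma conv_unit_right [simp]: "conv f conv_unit = f"
proof
  fix F
  have "conv f conv_unit F = linear_ext f (linear_ext (\<lambda>(A, B). if B = {#} then single A 1 else 0) (forest_coproduct F))"
    unfolding conv_def linear_ext_linear_ext by (rule linear_ext_cong) (auto simp: conv_unit_def)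
  then show "conv f conv_unit F = f F" by (simp add: linear_ext_counit_right)
qed

lemma conv_add_left: "conv (\<lambda>F. f F + g F) h F = conv f h F + conv g h F"
  by (simp add: conv_def distrib_right split_def linear_ext_fun_add)

lemma conv_add_right: "conv h (\<lambda>F. f F + g F) F = conv h f F + conv h g F"
  by (simp add: conv_def distrib_left split_def linear_ext_fun_add)

text \<open>Only pairs that share out the vertices of \<open>F\<close> have a nonzero coefficient;
  this is what permits inductions on the size.\<close>

lemma conv_cong:
  assumes "\<And>A B. decor A + decor B = decor F \<Longrightarrow> f A * g B = f' A * g' B"
  shows "conv f g F = conv f' g' F"
  unfolding conv_def
  by (rule linear_ext_cong) (auto simp: in_keys_iff intro!: assms decor_forest_coproduct)

text \<open>The projection onto the augmentation ideal, that is the identity minus the convolution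
  unit.\<close>

definition augmentation :: "'d forest \<Rightarrow> 'd forest \<Rightarrow>\<^sub>0 'k::comm_ring_1" where
  "augmentation F = (if F = {#} then 0 else single F 1)"

lemma augmentation_add_unit: "augmentation F + conv_unit F = single F 1"
  by (simp add: augmentation_def conv_unit_def)

primrec conv_pow :: "nat \<Rightarrow> 'd forest \<Rightarrow> 'd forest \<Rightarrow>\<^sub>0 'k::comm_ring_1" where
  "conv_pow 0 = conv_unit"
| "conv_pow (Suc n) = conv augmentation (conv_pow n)"

lemma conv_pow_Suc_right:
  "conv_pow (Suc n) = (conv (conv_pow n) augmentation :: 'd forest \<Rightarrow> 'd forest \<Rightarrow>\<^sub>0 'k::comm_ring_1)"
proof (induction n)
  case (Suc n)
  have "(conv_pow (Suc (Suc n)) :: 'd forest \<Rightarrow> 'd forest \<Rightarrow>\<^sub>0 'k) = conv augmentation (conv_pow (Suc n))" by simp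
  also have "\<dots> = conv augmentation (conv (conv_pow n) augmentation)" by (simp only: Suc)
  finally show ?case by (simp add: conv_assoc)
qed simp

text \<open>Every factor of the convolution power uses up at least one vertex of
  \<open>F\<close>.\<close>

lemma conv_pow_eq_0:
  "forest_size F < n \<Longrightarrow> conv_pow n F = (0 :: 'd forest \<Rightarrow>\<^sub>0 'k::comm_ring_1)"
proof (induction n arbitrary: F)
  case (Suc n)
  have "(conv_pow (Suc n) F :: 'd forest \<Rightarrow>\<^sub>0 'k) = conv (\<lambda>_. 0) (\<lambda>_. 0) F"
    unfolding conv_pow.simps
  proof (rule conv_cong)
    fix A B assume *: "decor A + decor B = decor F"
    show "augmentation A * conv_pow n B = (0 * 0 :: 'd forest \<Rightarrow>\<^sub>0 'k)"
    proof (cases "A = {#}")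
      case False
      then have "size (decor A) \<noteq> 0" by (simp add: decor_eq_empty_iff)
      then have "forest_size B < n"
        using Suc.prems arg_cong[OF *, of size] unfolding forest_size_decor size_union by linarith
      then show ?thesis by (simp add: Suc.IH)
    qed (simp add: augmentation_def)
  qed
  also have "\<dots> = 0" by (simp add: conv_def split_def)
  finally show ?case .
qed simp

text \<open>The geometric series of the augmentation projection. As it only uses the coproduct and
  the product, it preserves every sub-bialgebra.\<close>

definition antipode_forest :: "'d forest \<Rightarrow> 'd forest \<Rightarrow>\<^sub>0 'k::comm_ring_1" where
  "antipode_forest F = (\<Sum>k\<le>forest_size F. scale ((- 1) ^ k) (conv_pow k F))"

lemma antipode_forest_eq:
  assumes "forest_size F \<le> n"
  shows "antipode_forest F = (\<Sum>k\<le>n. scale ((- 1) ^ k) (conv_pow k F))"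
  unfolding antipode_forest_def
  by (rule sum.mono_neutral_left) (use assms in \<open>auto simp: conv_pow_eq_0\<close>)

text \<open>The finite geometric series, multiplied by the identity, in the convolution algebra. The
  remainder vanishes once \<open>n\<close> reaches the size of \<open>F\<close>.\<close>

lemma conv_pow_telescope:
  "(\<Sum>k\<le>n. scale ((- 1) ^ k) (conv_pow (Suc k) F)) + (\<Sum>k\<le>n. scale ((- 1) ^ k) (conv_pow k F)) =
    conv_unit F + (scale ((- 1) ^ n) (conv_pow (Suc n) F) :: 'd forest \<Rightarrow>\<^sub>0 'k::comm_ring_1)"
proof (induction n)
  case (Suc n)
  have *: "(a + r) + (b + q) = e + r" if 1: "a + b = e + p" and 2: "p + q = 0" for a b e p q r :: "'d forest \<Rightarrow>\<^sub>0 'k"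
  proof -
    have "(a + r) + (b + q) = (a + b) + (r + q)" by (simp only: ac_simps)
    also have "\<dots> = e + r + (p + q)" by (simp only: 1 ac_simps)
    finally show ?thesis by (simp add: 2)
  qed
  have "scale ((- 1) ^ n) x + scale ((- 1) ^ Suc n) x = 0" for x :: "'d forest \<Rightarrow>\<^sub>0 'k"
    by (rule poly_mapping_eqI) (simp add: lookup_add lookup_scale)
  then show ?case
    unfolding sum.atMost_Suc by (intro *[OF Suc])
qed (simp add: add.commute)

lemma antipode_forest_left: "conv antipode_forest (\<lambda>F. single F 1) F = conv_unit F"
  and antipode_forest_right: "conv (\<lambda>F. single F 1) antipode_forest F = conv_unit F"
proof -
  let ?n = "forest_size F"
  \<comment> \<open>Neither part of a cut is larger than \<open>F\<close>, so one truncation of the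
    series serves for all parts.\<close>
  have le: "forest_size A \<le> ?n" "forest_size B \<le> ?n" if "decor A + decor B = decor F" for A B
    using arg_cong[OF that, of size] by (auto simp: forest_size_decor)
  have "conv antipode_forest augmentation F = conv (\<lambda>A. \<Sum>k\<le>?n. scale ((- 1) ^ k) (conv_pow k A)) augmentation F"
    by (rule conv_cong) (simp add: antipode_forest_eq[OF le(1)])
  also have "\<dots> = (\<Sum>k\<le>?n. scale ((- 1) ^ k) (conv (conv_pow k) augmentation F))"
    by (simp add: conv_def sum_distrib_right scale_conv_mult mult.assoc split_def linear_ext_fun_sum
        linear_ext_mult_right)
  finally have l: "conv antipode_forest augmentation F = (\<Sum>k\<le>?n. scale ((- 1) ^ k) (conv_pow (Suc k) F))"
    by (simp only: conv_pow_Suc_right)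
  have "conv augmentation antipode_forest F = conv augmentation (\<lambda>A. \<Sum>k\<le>?n. scale ((- 1) ^ k) (conv_pow k A)) F"
    by (rule conv_cong) (simp add: antipode_forest_eq[OF le(2)])
  also have "\<dots> = (\<Sum>k\<le>?n. scale ((- 1) ^ k) (conv augmentation (conv_pow k) F))"
    by (simp add: conv_def sum_distrib_left scale_conv_mult mult.left_commute split_def linear_ext_fun_sum
        linear_ext_mult_right)
  finally have r: "conv augmentation antipode_forest F = (\<Sum>k\<le>?n. scale ((- 1) ^ k) (conv_pow (Suc k) F))"
    by (simp only: conv_pow.simps)
  have t: "(\<Sum>k\<le>?n. scale ((- 1) ^ k) (conv_pow (Suc k) F)) + antipode_forest F = conv_unit F"
    by (simp add: antipode_forest_def conv_pow_telescope conv_pow_eq_0 del: conv_pow.simps)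
  have "conv antipode_forest (\<lambda>F. single F 1) F = conv antipode_forest augmentation F + antipode_forest F"
    unfolding augmentation_add_unit[symmetric] by (simp add: conv_add_right)
  then show "conv antipode_forest (\<lambda>F. single F 1) F = conv_unit F" by (simp only: l t)
  have "conv (\<lambda>F. single F 1) antipode_forest F = conv augmentation antipode_forest F + antipode_forest F"
    unfolding augmentation_add_unit[symmetric] by (simp add: conv_add_left)
  then show "conv (\<lambda>F. single F 1) antipode_forest F = conv_unit F" by (simp only: r t)
qed

section \<open>Subalgebras, tensor squares and the Hopf criterion on generators\<close>

lemma subalgebraI:
  assumes "1 \<in> A" "\<And>x y. x \<in> A \<Longrightarrow> y \<in> A \<Longrightarrow> x + y \<in> A" "\<And>x y. x \<in> A \<Longrightarrow> y \<in> A \<Longrightarrow> x * y \<in> A"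
    "\<And>c x. x \<in> A \<Longrightarrow> scale c x \<in> A"
  shows "subalgebra A"
  using assms by (simp add: subalgebra_def)

lemma subalgebraD:
  assumes "subalgebra A"
  shows "1 \<in> A" "x \<in> A \<Longrightarrow> y \<in> A \<Longrightarrow> x + y \<in> A" "x \<in> A \<Longrightarrow> y \<in> A \<Longrightarrow> x * y \<in> A"
    "x \<in> A \<Longrightarrow> scale c x \<in> A" "0 \<in> A"
proof -
  show "1 \<in> A" "x \<in> A \<Longrightarrow> y \<in> A \<Longrightarrow> x + y \<in> A" "x \<in> A \<Longrightarrow> y \<in> A \<Longrightarrow> x * y \<in> A"
    "x \<in> A \<Longrightarrow> scale c x \<in> A" using assms by (simp_all add: subalgebra_def)
  have "scale 0 1 \<in> A" using assms unfolding subalgebra_def by blast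
  then show "0 \<in> A" by simp
qed

lemma subalgebra_sum:
  assumes "subalgebra A" "\<And>i. i \<in> I \<Longrightarrow> f i \<in> A"
  shows "sum f I \<in> A"
  using assms(2) by (induction I rule: infinite_finite_induct) (auto intro: subalgebraD[OF assms(1)])

lemma linear_ext_conv: "linear_ext (conv f g) x = linear_ext (\<lambda>(A, B). f A * g B) (ck_coproduct x)"
  by (simp add: ck_coproduct_eq linear_ext_linear_ext conv_def[abs_def])

lemma linear_ext_conv_unit: "linear_ext conv_unit x = scale (lookup x {#}) 1"
proof (induction x rule: poly_mapping_induct)
  case (add x y)
  then show ?case by (auto intro!: poly_mapping_eqI simp: linear_ext_add lookup_add lookup_scale distrib_right)
qed (auto simp: conv_unit_def lookup_single when_def)

text \<open>With the coproduct of \<open>x\<close> written as a sum of tensors of elements of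
  \<open>A\<close>, the convolution is a sum of products of values of \<open>f\<close> and
  \<open>g\<close> on \<open>A\<close>.\<close>

lemma linear_ext_conv_closed:
  assumes A: "subalgebra A" "ck_coproduct x \<in> tensor_square A"
    and f: "\<And>x. x \<in> A \<Longrightarrow> linear_ext f x \<in> A" and g: "\<And>x. x \<in> A \<Longrightarrow> linear_ext g x \<in> A"
  shows "linear_ext (conv f g) x \<in> A"
proof -
  obtain xys where xys: "ck_coproduct x = (\<Sum>(x, y)\<leftarrow>xys. tensor x y)" "set xys \<subseteq> A \<times> A"
    using A(2) by (auto simp: tensor_square_def)
  have *: "linear_ext (\<lambda>(A, B). f A * g B) (tensor y z) = linear_ext f y * linear_ext g z" for y z
    unfolding linear_ext_tensor linear_ext_mult_left by (simp add: linear_ext_mult_right)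
  have "linear_ext (\<lambda>(A, B). f A * g B) (\<Sum>(x, y)\<leftarrow>xys. tensor x y) \<in> A"
    using xys(2)
  proof (induction xys)
    case (Cons p xys)
    then show ?case
      by (auto simp: linear_ext_add * intro!: subalgebraD[OF A(1)] f g)
  qed (simp add: subalgebraD[OF A(1)])
  then show ?thesis by (simp add: linear_ext_conv xys(1))
qed

lemma antipode_closed:
  assumes A: "subalgebra A" "ck_coproduct ` A \<subseteq> tensor_square A" and "x \<in> A"
  shows "linear_ext antipode_forest x \<in> A"
proof -
  have aug: "linear_ext augmentation y \<in> A" if "y \<in> A" for y
  proof -
    have "linear_ext augmentation y + linear_ext conv_unit y = y"
      unfolding linear_ext_fun_add[symmetric] augmentation_add_unit by simp
    then have "linear_ext augmentation y = y + scale (- lookup y {#}) 1"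
      by (simp add: linear_ext_conv_unit poly_mapping_eq_iff lookup_add lookup_scale fun_eq_iff)
        (metis add_diff_cancel_right' diff_conv_add_uminus)
    then show ?thesis using that by (auto intro: subalgebraD[OF A(1)])
  qed
  have pow: "linear_ext (conv_pow n) y \<in> A" if "y \<in> A" for n y
    using that
  proof (induction n arbitrary: y)
    case 0
    then show ?case by (simp add: linear_ext_conv_unit subalgebraD[OF A(1)])
  next
    case (Suc n)
    then show ?case unfolding conv_pow.simps
      by (intro linear_ext_conv_closed[OF A(1)] aug) (use A(2) in auto)
  qed
  \<comment> \<open>The largest size in the support of \<open>x\<close>, so that one finite sum of
    convolution powers represents the antipode on the whole of \<open>x\<close>.\<close>
  define n where "n = Max (insert 0 (forest_size ` keys x))"
  have "forest_size F \<le> n" if "F \<in> keys x" for F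
    unfolding n_def using that by (intro Max_ge) auto
  then have "linear_ext antipode_forest x = linear_ext (\<lambda>F. \<Sum>k\<le>n. scale ((- 1) ^ k) (conv_pow k F)) x"
    by (intro linear_ext_cong) (simp add: antipode_forest_eq)
  also have "\<dots> = (\<Sum>k\<le>n. scale ((- 1) ^ k) (linear_ext (conv_pow k) x))"
    by (simp add: linear_ext_fun_sum linear_ext_fun_scale)
  also have "\<dots> \<in> A"
    by (intro subalgebra_sum subalgebraD[OF A(1)] A(1) pow \<open>x \<in> A\<close>)
  finally show ?thesis .
qed

lemma in_ck_algebra_iff: "x \<in> ck_algebra D \<longleftrightarrow> (\<forall>F. lookup x F \<noteq> 0 \<longrightarrow> F \<in> forests D)"
  by (auto simp: ck_algebra_def in_keys_iff)

lemma subalgebra_ck_algebra: "subalgebra (ck_algebra D :: ('d forest \<Rightarrow>\<^sub>0 'k::field_char_0) set)"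
proof -
  have "x * y \<in> ck_algebra D" if "x \<in> ck_algebra D" "y \<in> ck_algebra D" for x y :: "'d forest \<Rightarrow>\<^sub>0 'k"
    using that keys_mult[of x y] by (fastforce simp: ck_algebra_def forests_add)
  moreover have "x + y \<in> ck_algebra D" if "x \<in> ck_algebra D" "y \<in> ck_algebra D" for x y :: "'d forest \<Rightarrow>\<^sub>0 'k"
    using that keys_add[of x y] by (auto simp: ck_algebra_def)
  moreover have "scale c x \<in> ck_algebra D" if "x \<in> ck_algebra D" for c and x :: "'d forest \<Rightarrow>\<^sub>0 'k"
    using that by (simp add: in_ck_algebra_iff lookup_scale)
  moreover have "(1 :: 'd forest \<Rightarrow>\<^sub>0 'k) \<in> ck_algebra D"
    by (simp add: in_ck_algebra_iff lookup_one when_def)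
  ultimately show ?thesis
    unfolding subalgebra_def by blast
qed

lemma tensor_square_add: "x \<in> tensor_square A \<Longrightarrow> y \<in> tensor_square A \<Longrightarrow> x + y \<in> tensor_square A"
proof -
  assume "x \<in> tensor_square A" "y \<in> tensor_square A"
  then obtain xs ys where "x = (\<Sum>(x, y)\<leftarrow>xs. tensor x y)" "set xs \<subseteq> A \<times> A"
    "y = (\<Sum>(x, y)\<leftarrow>ys. tensor x y)" "set ys \<subseteq> A \<times> A" by (auto simp: tensor_square_def)
  then show "x + y \<in> tensor_square A"
    unfolding tensor_square_def by (intro CollectI exI[of _ "xs @ ys"]) auto
qed

lemma tensor_square_tensor: "x \<in> A \<Longrightarrow> y \<in> A \<Longrightarrow> tensor x y \<in> tensor_square A"
  unfolding tensor_square_def by (intro CollectI exI[of _ "[(x, y)]"]) auto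

lemma tensor_square_0: "0 \<in> tensor_square A"
  unfolding tensor_square_def by (intro CollectI exI[of _ "[]"]) auto

lemma tensor_square_sum: "(\<And>i. i \<in> I \<Longrightarrow> f i \<in> tensor_square A) \<Longrightarrow> sum f I \<in> tensor_square A"
  by (induction I rule: infinite_finite_induct) (auto intro: tensor_square_add tensor_square_0)

lemma tensor_square_induct [consumes 1, case_names zero add]:
  assumes "x \<in> tensor_square A" "P 0"
    "\<And>y z x. y \<in> A \<Longrightarrow> z \<in> A \<Longrightarrow> x \<in> tensor_square A \<Longrightarrow> P x \<Longrightarrow> P (tensor y z + x)"
  shows "P x"
proof -
  obtain xs where x: "x = (\<Sum>(x, y)\<leftarrow>xs. tensor x y)" and xs: "set xs \<subseteq> A \<times> A"
    using assms(1) by (auto simp: tensor_square_def)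
  have "(\<Sum>(x, y)\<leftarrow>xs. tensor x y) \<in> tensor_square A \<and> P (\<Sum>(x, y)\<leftarrow>xs. tensor x y)"
    using xs by (induction xs) (auto intro: assms(2,3) tensor_square_0 tensor_square_add tensor_square_tensor)
  then show ?thesis by (simp add: x)
qed

lemma tensor_square_scale:
  assumes "subalgebra A" "x \<in> tensor_square A"
  shows "scale c x \<in> tensor_square A"
  using assms(2)
  by (induction rule: tensor_square_induct)
    (auto simp: scale_add intro!: tensor_square_0 tensor_square_add tensor_square_tensor subalgebraD[OF assms(1)]
      simp flip: tensor_scale_left)

lemma tensor_square_mult:
  assumes A: "subalgebra A" and x: "x \<in> tensor_square A" and y: "y \<in> tensor_square A"
  shows "x * y \<in> tensor_square A"
  using x
proof (induction rule: tensor_square_induct)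
  case (add a b x)
  have "tensor a b * y \<in> tensor_square A"
    using y by (induction rule: tensor_square_induct)
      (auto simp: distrib_left tensor_mult intro!: tensor_square_0 tensor_square_add
        tensor_square_tensor subalgebraD[OF A] add)
  then show ?case using add by (simp add: distrib_right tensor_square_add)
qed (simp add: tensor_square_0)

text \<open>Makes \<open>ck_algebra D\<close> a sub-bialgebra itself, so that
  \<open>antipode_closed\<close> also shows that the antipode preserves it.\<close>

lemma ck_coproduct_ck_algebra:
  "ck_coproduct ` ck_algebra D \<subseteq> (tensor_square (ck_algebra D) :: (_ \<Rightarrow>\<^sub>0 'k::field_char_0) set)"
proof (clarify)
  fix x :: "'a forest \<Rightarrow>\<^sub>0 'k" assume x: "x \<in> ck_algebra D"
  have "forest_coproduct F \<in> (tensor_square (ck_algebra D) :: (_ \<Rightarrow>\<^sub>0 'k) set)" if F: "F \<in> forests D" for F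
  proof -
    have "(forest_coproduct F :: _ \<Rightarrow>\<^sub>0 'k) =
        (\<Sum>(A, B)\<in>keys (forest_coproduct F :: _ \<Rightarrow>\<^sub>0 'k). tensor (single A (lookup (forest_coproduct F) (A, B))) (single B 1))"
      by (rule poly_mapping_eqI) (auto simp: lookup_sum tensor_single lookup_single when_def split_def in_keys_iff)
    also have "\<dots> \<in> tensor_square (ck_algebra D)"
    proof (intro tensor_square_sum, clarify)
      fix A B assume "(A, B) \<in> keys (forest_coproduct F :: _ \<Rightarrow>\<^sub>0 'k)"
      then have "decor A + decor B = decor F" by (intro decor_forest_coproduct) (auto simp: in_keys_iff)
      then have "A \<in> forests D" "B \<in> forests D" using F by (auto simp: forests_decor simp flip: \<open>_ = decor F\<close>)
      then show "tensor (single A (lookup (forest_coproduct F) (A, B))) (single B 1) \<in> (tensor_square (ck_algebra D) :: (_ \<Rightarrow>\<^sub>0 'k) set)"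
        by (intro tensor_square_tensor) (auto simp: in_ck_algebra_iff lookup_single when_def)
    qed
    finally show ?thesis .
  qed
  then show "ck_coproduct x \<in> tensor_square (ck_algebra D)"
    unfolding ck_coproduct_eq linear_ext_def using x
    by (intro tensor_square_sum tensor_square_scale subalgebra_ck_algebra) (auto simp: ck_algebra_def)
qed

lemma is_antipode_antipode_forest: "is_antipode D (linear_ext antipode_forest :: _ \<Rightarrow> _ \<Rightarrow>\<^sub>0 'k::field_char_0)"
proof -
  have l: "linear_ext (\<lambda>(A, B). linear_ext antipode_forest (single A 1) * single B 1) (ck_coproduct x) =
      scale (ck_counit x) (1 :: _ \<Rightarrow>\<^sub>0 'k)" for x :: "'a forest \<Rightarrow>\<^sub>0 'k"
    using linear_ext_conv[of antipode_forest "\<lambda>F. single F 1" x]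
    by (simp add: antipode_forest_left[abs_def] linear_ext_conv_unit ck_counit_def flip: fun_eq_iff)
  have r: "linear_ext (\<lambda>(A, B). single A 1 * linear_ext antipode_forest (single B 1)) (ck_coproduct x) =
      scale (ck_counit x) (1 :: _ \<Rightarrow>\<^sub>0 'k)" for x :: "'a forest \<Rightarrow>\<^sub>0 'k"
    using linear_ext_conv[of "\<lambda>F. single F 1" antipode_forest x]
    by (simp add: antipode_forest_right[abs_def] linear_ext_conv_unit ck_counit_def)
  have "linear_ext antipode_forest ` ck_algebra D \<subseteq> (ck_algebra D :: ('a forest \<Rightarrow>\<^sub>0 'k) set)"
    using antipode_closed[OF subalgebra_ck_algebra ck_coproduct_ck_algebra] by blast
  then show ?thesis
    unfolding is_antipode_def using l r by (auto simp: linear_ext_add linear_ext_scale)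
qed

text \<open>The elements whose coproduct lies in the tensor square form a subalgebra, so the
  generators decide; the antipode then comes for free.\<close>

theorem hopf_subalgebra_hull_iff:
  fixes G :: "('d forest \<Rightarrow>\<^sub>0 'k::field_char_0) set"
  assumes "G \<subseteq> ck_algebra D"
  shows "hopf_subalgebra D (subalgebra hull G) \<longleftrightarrow> ck_coproduct ` G \<subseteq> tensor_square (subalgebra hull G)"
proof -
  let ?A = "subalgebra hull G"
  have A: "subalgebra ?A"
    by (rule hull_in) (auto simp: subalgebra_def)
  have sub: "?A \<subseteq> ck_algebra D"
    using assms subalgebra_ck_algebra by (rule hull_minimal)
  have one: "1 \<in> tensor_square ?A"
    using tensor_square_tensor[OF subalgebraD(1)[OF A] subalgebraD(1)[OF A]]
    by (simp add: tensor_1 flip: zero_prod_def)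
  show ?thesis
  proof
    assume "hopf_subalgebra D ?A"
    then show "ck_coproduct ` G \<subseteq> tensor_square ?A"
      unfolding hopf_subalgebra_def using hull_subset[of G subalgebra] by blast
  next
    assume G: "ck_coproduct ` G \<subseteq> tensor_square ?A"
    have "?A \<subseteq> {x. ck_coproduct x \<in> tensor_square ?A}"
    proof (rule hull_minimal)
      show "subalgebra {x. ck_coproduct x \<in> tensor_square ?A}"
        by (rule subalgebraI)
          (auto simp: ck_coproduct_1 ck_coproduct_add ck_coproduct_mult ck_coproduct_scale one
            intro: tensor_square_add tensor_square_mult[OF A] tensor_square_scale[OF A])
    qed (use G in auto)
    then have cop: "ck_coproduct ` ?A \<subseteq> tensor_square ?A" by blast
    show "hopf_subalgebra D ?A"
      unfolding hopf_subalgebra_def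
      using A sub cop is_antipode_antipode_forest antipode_closed[OF A cop] by blast
  qed
qed

section \<open>The coproduct of formal series\<close>

lemmas coeff_simps = zero_mset_series.rep_eq one_mset_series.rep_eq plus_mset_series.rep_eq
  minus_mset_series.rep_eq

lemma coeff_mult: "coeff (f * g) F = (\<Sum>p\<in>splits F. coeff f (fst p) * coeff g (snd p))"
  by (simp add: times_mset_series.rep_eq case_prod_unfold)

lemma coeff_sum: "coeff (\<Sum>i\<in>I. f i) F = (\<Sum>i\<in>I. coeff (f i) F)"
  by (induction I rule: infinite_finite_induct) (auto simp: coeff_simps)

lemma coeff_mult_empty [simp]: "coeff (f * g) {#} = coeff f {#} * coeff g {#}"
proof -
  have *: "splits {#} = {({#}, {#})}" by (auto intro: prod_eqI)
  show ?thesis unfolding coeff_mult * by simp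
qed

text \<open>When the coefficients are themselves series, \<open>const_series f\<close> is
  \<open>f\<close> tensor \<open>1\<close> in the completed tensor square.\<close>

definition const_series :: "'k \<Rightarrow> ('a, 'k::comm_ring_1) mset_series" where
  "const_series c = Series (\<lambda>F. if F = {#} then c else 0)"

lemma coeff_const_series: "coeff (const_series c) F = (if F = {#} then c else 0)"
  by (simp add: const_series_def Series_inverse)

lemma coeff_const_mult:
  fixes F :: "'a multiset"
  shows "coeff (const_series c * f) F = c * coeff f F"
proof -
  have "coeff (const_series c * f) F = (\<Sum>p\<in>{({#} :: 'a multiset, F)}. coeff (const_series c) (fst p) * coeff f (snd p))"
    unfolding coeff_mult by (rule sum.mono_neutral_right) (auto simp: coeff_const_series)
  then show ?thesis by (simp add: coeff_const_series)
qed

lemma const_series_mult: "const_series (c * d) = const_series c * const_series d"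
  by (rule mset_series_eqI) (simp add: coeff_const_mult coeff_const_series)

lemma const_series_1 [simp]: "const_series 1 = 1"
  by (rule mset_series_eqI) (simp add: coeff_const_series coeff_simps)

lemma const_series_0 [simp]: "const_series 0 = 0"
  by (rule mset_series_eqI) (simp add: coeff_const_series coeff_simps)

lemma const_series_sum: "const_series (\<Sum>i\<in>I. c i) = (\<Sum>i\<in>I. const_series (c i))"
  by (rule mset_series_eqI) (simp add: coeff_const_series coeff_sum)

text \<open>The completed tensor square is encoded as the series in the right factor whose coefficients
  are series in the left factor.\<close>

definition series_coproduct :: "('d dtree, 'k::comm_ring_1) mset_series \<Rightarrow>
    ('d dtree, ('d dtree, 'k) mset_series) mset_series" where
  "series_coproduct f = Series (\<lambda>B. Series (\<lambda>A.
     \<Sum>F | decor F = decor A + decor B. coeff f F * lookup (forest_coproduct F) (A, B)))"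

lemma coeff_series_coproduct: "coeff (coeff (series_coproduct f) B) A =
    (\<Sum>F | decor F = decor A + decor B. coeff f F * lookup (forest_coproduct F) (A, B))"
  by (simp add: series_coproduct_def Series_inverse)

lemma lookup_forest_coproduct_eq_0:
  assumes "decor F \<noteq> decor A + decor B"
  shows "lookup (forest_coproduct F) (A, B) = (0 :: 'k::comm_ring_1)"
proof (rule ccontr)
  assume "lookup (forest_coproduct F) (A, B) \<noteq> (0 :: 'k)"
  from decor_forest_coproduct[OF this] assms show False by simp
qed

lemma coeff_series_coproduct_superset:
  assumes "finite S" "{F. decor F = decor A + decor B} \<subseteq> S"
  shows "coeff (coeff (series_coproduct f) B) A = (\<Sum>F\<in>S. coeff f F * lookup (forest_coproduct F) (A, B))"
  unfolding coeff_series_coproduct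
proof (rule sum.mono_neutral_left)
  show "\<forall>F\<in>S - {F. decor F = decor A + decor B}. coeff f F * lookup (forest_coproduct F) (A, B) = 0"
  proof
    fix F assume "F \<in> S - {F. decor F = decor A + decor B}"
    then have "lookup (forest_coproduct F) (A, B) = (0 :: 'b)"
      by (intro lookup_forest_coproduct_eq_0) simp
    then show "coeff f F * lookup (forest_coproduct F) (A, B) = 0" by simp
  qed
qed (use assms in auto)

lemma series_coproduct_add: "series_coproduct (f + g) = series_coproduct f + series_coproduct g"
  by (intro mset_series_eqI) (simp add: coeff_series_coproduct coeff_simps distrib_right sum.distrib)

lemma series_coproduct_const_mult:
  "series_coproduct (const_series c * f) = const_series (const_series c) * series_coproduct f"
  by (intro mset_series_eqI) (simp add: coeff_series_coproduct coeff_const_mult sum_distrib_left mult.assoc)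

lemma coeff_series_coproduct_empty: "coeff (series_coproduct f) {#} = f"
proof (rule mset_series_eqI)
  fix A
  have "coeff (coeff (series_coproduct f) {#}) A = (\<Sum>F | decor F = decor A. if A = F then coeff f F else 0)"
    by (simp add: coeff_series_coproduct lookup_forest_coproduct_empty_right if_distrib cong: if_cong)
  also have "\<dots> = coeff f A" by (simp add: finite_decor)
  finally show "coeff (coeff (series_coproduct f) {#}) A = coeff f A" .
qed

lemma series_coproduct_1: "series_coproduct 1 = 1"
proof (intro mset_series_eqI)
  fix B A :: "'a forest"
  have "coeff (coeff (series_coproduct 1) B) A = (\<Sum>F | decor F = decor A + decor B. if F = {#} then lookup 1 (A, B) else (0 :: 'b))"
    unfolding coeff_series_coproduct by (rule sum.cong) (auto simp: coeff_simps)
  also have "\<dots> = (if A = {#} \<and> B = {#} then 1 else 0)"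
    by (auto simp: lookup_one when_def zero_prod_def finite_decor)
  finally show "coeff (coeff (series_coproduct 1) B) A = (coeff (coeff 1 B) A :: 'b)"
    by (simp add: coeff_simps)
qed

lemma lookup_mult_multiset_pair:
  fixes x y :: "('a multiset \<times> 'b multiset) \<Rightarrow>\<^sub>0 'k::comm_ring_1"
  shows "lookup (x * y) (A, B) =
    (\<Sum>p\<in>splits B. \<Sum>q\<in>splits A. lookup x (fst q, fst p) * lookup y (snd q, snd p))"
proof (induction x rule: poly_mapping_induct)
  case (single r c)
  show ?case
  proof (induction y rule: poly_mapping_induct)
    case (single s d)
    obtain a b a' b' where rs: "r = (a, b)" "s = (a', b')" by (cases r; cases s)
    have "(\<Sum>p\<in>splits B. \<Sum>q\<in>splits A. lookup (single r c) (fst q, fst p) * lookup (single s d) (snd q, snd p)) =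
        (\<Sum>p\<in>splits B. \<Sum>q\<in>splits A. if p = (b, b') then if q = (a, a') then c * d else 0 else 0)"
      by (intro sum.cong refl) (auto simp: rs lookup_single when_def prod_eq_iff)
    also have "\<dots> = (\<Sum>p\<in>splits B. if p = (b, b') then \<Sum>q\<in>splits A. if q = (a, a') then c * d else 0 else 0)"
      by (intro sum.cong refl) simp
    also have "\<dots> = (if a + a' = A \<and> b + b' = B then c * d else 0)"
      by simp
    finally show ?case by (simp add: rs mult_single lookup_single when_def)
  qed (auto simp: distrib_left lookup_add sum.distrib)
qed (auto simp: distrib_right lookup_add sum.distrib)

lemma series_coproduct_mult: "series_coproduct (f * g) = series_coproduct f * series_coproduct g"
proof (intro mset_series_eqI)
  fix B A :: "'a forest"
  let ?M = "decor A + decor B"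
  let ?L = "\<lambda>F. lookup (forest_coproduct F) :: _ \<Rightarrow> 'b"
  \<comment> \<open>A finite set of all forests that can occur as a factor. It does not depend on
    the splitting, so the sums over it can be interchanged with the others.\<close>
  define U where "U = {F :: 'a forest. decor F \<subseteq># ?M}"
  have "U = (\<Union>N\<in>{N. N \<subseteq># ?M}. {F. decor F = N})" by (auto simp: U_def)
  then have U: "finite U" by (simp add: finite_decor finite_subseteq_mset)
  have "coeff (coeff (series_coproduct (f * g)) B) A =
      (\<Sum>F | decor F = ?M. \<Sum>s\<in>splits F. coeff f (fst s) * coeff g (snd s) * ?L (fst s + snd s) (A, B))"
    unfolding coeff_series_coproduct coeff_mult sum_distrib_right by (intro sum.cong refl) auto
  also have "\<dots> = (\<Sum>(F, s)\<in>Sigma {F. decor F = ?M} splits. coeff f (fst s) * coeff g (snd s) * ?L (fst s + snd s) (A, B))"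
    by (rule sum.Sigma) (auto simp: finite_decor)
  also have "\<dots> = (\<Sum>s | decor (fst s + snd s) = ?M. coeff f (fst s) * coeff g (snd s) * ?L (fst s + snd s) (A, B))"
    by (rule sum.reindex_bij_witness[where i = "\<lambda>s. (fst s + snd s, s)" and j = snd]) auto
  also have "\<dots> = (\<Sum>s\<in>U \<times> U. coeff f (fst s) * coeff g (snd s) * ?L (fst s + snd s) (A, B))"
  proof (rule sum.mono_neutral_left)
    show "{s. decor (fst s + snd s) = ?M} \<subseteq> U \<times> U"
    proof (intro subsetI, unfold mem_Collect_eq)
      fix s :: "'a forest \<times> 'a forest" assume s: "decor (fst s + snd s) = ?M"
      have "decor (fst s) \<subseteq># decor (fst s) + decor (snd s)" "decor (snd s) \<subseteq># decor (fst s) + decor (snd s)"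
        by simp_all
      with s show "s \<in> U \<times> U" by (auto simp: U_def mem_Times_iff)
    qed
    show "\<forall>s\<in>U \<times> U - {s. decor (fst s + snd s) = ?M}. coeff f (fst s) * coeff g (snd s) * ?L (fst s + snd s) (A, B) = 0"
    proof
      fix s assume "s \<in> U \<times> U - {s. decor (fst s + snd s) = ?M}"
      then have "?L (fst s + snd s) (A, B) = 0"
        by (intro lookup_forest_coproduct_eq_0) auto
      then show "coeff f (fst s) * coeff g (snd s) * ?L (fst s + snd s) (A, B) = 0" by simp
    qed
  qed (use U in auto)
  also have "\<dots> = (\<Sum>F\<in>U. \<Sum>G\<in>U. coeff f F * coeff g G * (\<Sum>p\<in>splits B. \<Sum>q\<in>splits A. ?L F (fst q, fst p) * ?L G (snd q, snd p)))"
    by (simp add: forest_coproduct_add lookup_mult_multiset_pair sum.cartesian_product')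
  also have "\<dots> = (\<Sum>F\<in>U. \<Sum>G\<in>U. \<Sum>p\<in>splits B. \<Sum>q\<in>splits A. (coeff f F * ?L F (fst q, fst p)) * (coeff g G * ?L G (snd q, snd p)))"
    by (simp add: sum_distrib_left mult_ac)
  also have "\<dots> = (\<Sum>F\<in>U. \<Sum>p\<in>splits B. \<Sum>G\<in>U. \<Sum>q\<in>splits A. (coeff f F * ?L F (fst q, fst p)) * (coeff g G * ?L G (snd q, snd p)))"
    by (intro sum.cong refl sum.swap)
  also have "\<dots> = (\<Sum>p\<in>splits B. \<Sum>F\<in>U. \<Sum>G\<in>U. \<Sum>q\<in>splits A. (coeff f F * ?L F (fst q, fst p)) * (coeff g G * ?L G (snd q, snd p)))"
    by (rule sum.swap)
  also have "\<dots> = (\<Sum>p\<in>splits B. \<Sum>F\<in>U. \<Sum>q\<in>splits A. \<Sum>G\<in>U. (coeff f F * ?L F (fst q, fst p)) * (coeff g G * ?L G (snd q, snd p)))"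
    by (intro sum.cong refl sum.swap)
  also have "\<dots> = (\<Sum>p\<in>splits B. \<Sum>q\<in>splits A. \<Sum>F\<in>U. \<Sum>G\<in>U. (coeff f F * ?L F (fst q, fst p)) * (coeff g G * ?L G (snd q, snd p)))"
    by (intro sum.cong refl sum.swap)
  also have "\<dots> = (\<Sum>p\<in>splits B. \<Sum>q\<in>splits A.
      coeff (coeff (series_coproduct f) (fst p)) (fst q) * coeff (coeff (series_coproduct g) (snd p)) (snd q))"
  proof (intro sum.cong refl)
    fix p q assume "p \<in> splits B" "q \<in> splits A"
    then have M: "?M = (decor (fst q) + decor (fst p)) + (decor (snd q) + decor (snd p))"
      by (auto simp: ac_simps)
    have "{F. decor F = decor (fst q) + decor (fst p)} \<subseteq> U" "{F. decor F = decor (snd q) + decor (snd p)} \<subseteq> U"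
      unfolding U_def M by auto
    note 1 = this[THEN coeff_series_coproduct_superset[OF U]]
    show "(\<Sum>F\<in>U. \<Sum>G\<in>U. (coeff f F * ?L F (fst q, fst p)) * (coeff g G * ?L G (snd q, snd p))) =
      coeff (coeff (series_coproduct f) (fst p)) (fst q) * coeff (coeff (series_coproduct g) (snd p)) (snd q)"
      unfolding 1 by (simp add: sum_product)
  qed
  also have "\<dots> = coeff (coeff (series_coproduct f * series_coproduct g) B) A"
    by (simp add: coeff_mult coeff_sum)
  finally show "coeff (coeff (series_coproduct (f * g)) B) A = coeff (coeff (series_coproduct f * series_coproduct g) B) A" .
qed

definition tree_series :: "('d dtree, 'k::zero) mset_series \<Rightarrow> bool" where
  "tree_series f \<longleftrightarrow> (\<forall>F. coeff f F \<noteq> 0 \<longrightarrow> (\<exists>d A. F = {#Node d A#}))"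

text \<open>In the cocycle identity only the grafted terms have a nonempty right factor, and its
  root is the root of the tree; trees with another root drop out.\<close>

lemma coeff_series_coproduct_Node:
  assumes f: "tree_series f" and g: "\<And>A. coeff f {#Node d A#} = coeff g A"
  shows "coeff (series_coproduct f) {#Node d B#} = coeff (series_coproduct g) B"
proof (rule mset_series_eqI)
  fix A
  let ?N = "\<lambda>F. {#Node d F#}"
  have inj: "inj_on ?N S" for S by (simp add: inj_on_def)
  have "coeff (coeff (series_coproduct f) {#Node d B#}) A =
    (\<Sum>F\<in>?N ` {F. decor F = decor A + decor B}. coeff f F * lookup (forest_coproduct F) (A, {#Node d B#}))"
    unfolding coeff_series_coproduct
  proof (rule sum.mono_neutral_right)
    show "\<forall>F\<in>{F. decor F = decor A + decor {#Node d B#}} - ?N ` {F. decor F = decor A + decor B}.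
      coeff f F * lookup (forest_coproduct F) (A, {#Node d B#}) = 0"
    proof
      fix F assume F: "F \<in> {F. decor F = decor A + decor {#Node d B#}} - ?N ` {F. decor F = decor A + decor B}"
      show "coeff f F * lookup (forest_coproduct F) (A, {#Node d B#}) = 0"
      proof (cases "\<exists>d' F'. F = {#Node d' F'#}")
        case True
        then obtain d' F' where F': "F = {#Node d' F'#}" by blast
        with F have "d' \<noteq> d" by auto
        then show ?thesis
          by (simp add: F' forest_coproduct_graft lookup_add lookup_single when_def lookup_graft_right_Node)
      next
        case False
        with f have "coeff f F = 0" by (auto simp: tree_series_def)
        then show ?thesis by simp
      qed
    qed
  qed (auto simp: finite_decor)
  also have "\<dots> = coeff (coeff (series_coproduct g) B) A"
    by (simp add: sum.reindex[OF inj] coeff_series_coproduct forest_coproduct_graft lookup_add lookup_single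
      when_def lookup_graft_right_Node g)
  finally show "coeff (coeff (series_coproduct f) {#Node d B#}) A = coeff (coeff (series_coproduct g) B) A" .
qed

text \<open>The right factor of a cut of a tree contains the root unless it is empty, hence is then
  a single tree.\<close>

lemma coeff_series_coproduct_no_tree:
  fixes f :: "('d dtree, 'k::comm_ring_1) mset_series"
  assumes f: "tree_series f" and B: "B \<noteq> {#}" "\<nexists>d B'. B = {#Node d B'#}"
  shows "coeff (series_coproduct f) B = 0"
proof (rule mset_series_eqI)
  fix A
  have "coeff f F * lookup (forest_coproduct F) (A, B) = 0" for F
  proof (cases "\<exists>d' F'. F = {#Node d' F'#}")
    case True
    then obtain d' F' where F': "F = {#Node d' F'#}" by blast
    show ?thesis
      using B lookup_graft_right_eq_0[of B d' "forest_coproduct F' :: _ \<Rightarrow>\<^sub>0 'k" A]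
      by (auto simp: F' forest_coproduct_graft lookup_add lookup_single when_def)
  next
    case False
    with f have "coeff f F = 0" by (auto simp: tree_series_def)
    then show ?thesis by simp
  qed
  then show "coeff (coeff (series_coproduct f) B) A = coeff 0 A"
    by (simp add: coeff_series_coproduct coeff_simps)
qed

text \<open>The map \<open>f \<mapsto> \<Sum>B. M\<^sub>B \<otimes> f(B) B\<close>, where \<open>M\<^sub>B\<close> is the product of \<open>M c\<close> over the decorations of \<open>B\<close>;
  it is a ring morphism because \<open>M\<^sub>B\<close> is multiplicative in \<open>B\<close>.\<close>

definition twist :: "('d \<Rightarrow> ('d dtree, 'k::comm_ring_1) mset_series) \<Rightarrow> ('d dtree, 'k) mset_series \<Rightarrow>
    ('d dtree, ('d dtree, 'k) mset_series) mset_series" where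
  "twist M f = Series (\<lambda>B. (\<Prod>c\<in>#decor B. M c) * const_series (coeff f B))"

lemma coeff_twist: "coeff (twist M f) B = (\<Prod>c\<in>#decor B. M c) * const_series (coeff f B)"
  by (simp add: twist_def Series_inverse)

lemma twist_mult: "twist M (f * g) = twist M f * twist M g"
proof (rule mset_series_eqI)
  fix B
  have "coeff (twist M (f * g)) B = (\<Sum>p\<in>splits B. (\<Prod>c\<in>#decor B. M c) * const_series (coeff f (fst p) * coeff g (snd p)))"
    by (simp add: coeff_twist coeff_mult const_series_sum sum_distrib_left)
  also have "\<dots> = (\<Sum>p\<in>splits B. coeff (twist M f) (fst p) * coeff (twist M g) (snd p))"
    by (intro sum.cong refl) (auto simp: coeff_twist const_series_mult ac_simps)
  finally show "coeff (twist M (f * g)) B = coeff (twist M f * twist M g) B"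
    by (simp add: coeff_mult)
qed

lemma twist_1: "twist M 1 = 1"
  by (rule mset_series_eqI) (auto simp: coeff_twist coeff_simps coeff_const_series intro!: mset_series_eqI)

text \<open>Inverses enter through an equation, so that every property stable under products and
  inverses can be proved by one induction, in any commutative ring.\<close>

inductive_set unit_group :: "('i \<Rightarrow> 'a::comm_ring_1) \<Rightarrow> 'a set" for X where
  gen: "X i \<in> unit_group X"
| mult: "f \<in> unit_group X \<Longrightarrow> g \<in> unit_group X \<Longrightarrow> f * g \<in> unit_group X"
| inv: "f \<in> unit_group X \<Longrightarrow> f * g = 1 \<Longrightarrow> g \<in> unit_group X"

text \<open>Multiplying \<open>g * g'\<close> by \<open>f'\<close> gives \<open>g\<close>, and
  multiplying it by \<open>f\<close> gives \<open>g'\<close>.\<close>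

lemma agree_inverse_unique:
  assumes w: "\<And>A B. w (A + B) = w A + w B" and "agree w n f f'" "f * g = 1" "f' * g' = 1"
  shows "agree w n g g'"
proof -
  have "agree w n ((f' * g) * g') ((f * g) * g')"
    by (rule agree_mult[OF w agree_mult[OF w agree_sym[OF assms(2)] agree_refl] agree_refl])
  moreover have "(f' * g) * g' = (f' * g') * g" by (simp only: ac_simps)
  ultimately show ?thesis by (simp add: assms(3,4))
qed

text \<open>Both sides are compatible with products and inverses, hence agreement of the \<open>X i\<close> up to
  size \<open>n\<close> implies agreement of all \<open>X i * M c\<close>; the cocycle property of grafting then gives
  agreement up to size \<open>n + 1\<close>.\<close>

theorem series_coproduct_eq_twist:
  fixes X :: "'i \<Rightarrow> ('d dtree, 'k::comm_ring_1) mset_series"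
  assumes X: "\<And>i. tree_series (X i - 1)" "\<And>i. coeff (X i) {#} = 1"
    and M: "\<And>c. M c \<in> unit_group X"
    and XM: "\<And>i c. \<exists>\<epsilon>. \<forall>A. coeff (X i) {#Node c A#} = \<epsilon> * coeff (X i * M c) A"
  shows "series_coproduct (X i) = const_series (X i) * twist M (X i)"
proof -
  note w = forest_size_add
  have main: "agree forest_size n (series_coproduct (X i)) (const_series (X i) * twist M (X i))" for n i
  proof (induction n arbitrary: i)
    case 0
    then show ?case by (simp add: agree_def)
  next
    case (Suc n)
    have unit: "agree forest_size n (series_coproduct f) (const_series f * twist M f)" if "f \<in> unit_group X" for f
      using that
    proof induction
      case (mult f g)
      have "agree forest_size n (series_coproduct f * series_coproduct g) ((const_series f * twist M f) * (const_series g * twist M g))"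
        by (intro agree_mult w mult.IH)
      then show ?case by (simp add: series_coproduct_mult const_series_mult twist_mult ac_simps)
    next
      case (inv f g)
      have 1: "series_coproduct f * series_coproduct g = 1"
        by (simp add: inv(2) series_coproduct_1 flip: series_coproduct_mult)
      have "(const_series f * twist M f) * (const_series g * twist M g) = const_series (f * g) * twist M (f * g)"
        by (simp only: const_series_mult twist_mult ac_simps)
      then have 2: "(const_series f * twist M f) * (const_series g * twist M g) = 1"
        by (simp add: inv(2) twist_1)
      show ?case by (rule agree_inverse_unique[OF w inv.IH 1 2])
    qed (rule Suc)
    show ?case
      unfolding agree_def
    proof (intro allI impI)
      fix B :: "'d forest" assume B: "forest_size B < Suc n"
      have X': "series_coproduct (X i) = 1 + series_coproduct (X i - 1)"
        using series_coproduct_add[of 1 "X i - 1"] by (simp add: series_coproduct_1)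
      consider "B = {#}" | c B' where "B = {#Node c B'#}" | "B \<noteq> {#}" "\<nexists>c B'. B = {#Node c B'#}" by blast
      then show "coeff (series_coproduct (X i)) B = coeff (const_series (X i) * twist M (X i)) B"
      proof cases
        case 1
        then show ?thesis
          by (simp add: coeff_series_coproduct_empty coeff_const_mult coeff_twist X del: coeff_mult_empty)
      next
        case 2
        obtain \<epsilon> where \<epsilon>: "\<And>A. coeff (X i) {#Node c A#} = \<epsilon> * coeff (X i * M c) A" using XM by blast
        have "coeff (X i - 1) {#Node c A#} = coeff (const_series \<epsilon> * (X i * M c)) A" for A
          unfolding coeff_const_mult by (simp add: coeff_simps \<epsilon>)
        then have "coeff (series_coproduct (X i - 1)) {#Node c B'#} = coeff (series_coproduct (const_series \<epsilon> * (X i * M c))) B'"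
          by (intro coeff_series_coproduct_Node X)
        then have "coeff (series_coproduct (X i)) B = coeff (series_coproduct (const_series \<epsilon> * (X i * M c))) B'"
          by (simp add: X' 2 coeff_simps)
        also have "\<dots> = const_series \<epsilon> * coeff (series_coproduct (X i * M c)) B'"
          by (simp add: series_coproduct_const_mult coeff_const_mult)
        \<comment> \<open>\<open>B'\<close> has one vertex less than \<open>B\<close>, so the
          agreement up to size \<open>n\<close> applies to \<open>X i * M c\<close>.\<close>
        also have "coeff (series_coproduct (X i * M c)) B' = coeff (const_series (X i * M c) * twist M (X i * M c)) B'"
          using unit[OF unit_group.mult[OF unit_group.gen M]] B 2 by (auto simp: agree_def forest_size_graft)
        also have "\<dots> = X i * M c * ((\<Prod>c\<in>#decor B'. M c) * const_series (coeff (X i * M c) B'))"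
          by (simp add: coeff_const_mult coeff_twist)
        also have "const_series \<epsilon> * \<dots> = X i * ((\<Prod>c\<in>#decor B. M c) * const_series (\<epsilon> * coeff (X i * M c) B'))"
          by (simp add: 2 const_series_mult ac_simps)
        also have "\<dots> = coeff (const_series (X i) * twist M (X i)) B"
          by (simp add: coeff_const_mult coeff_twist 2 \<epsilon>)
        finally show ?thesis .
      next
        case 3
        then have "coeff (X i - 1) B = 0" using X(1)[of i] by (auto simp: tree_series_def)
        with 3 have "coeff (X i) B = 0" by (simp add: coeff_simps)
        with 3 show ?thesis
          by (simp add: X' coeff_simps coeff_const_mult coeff_twist coeff_series_coproduct_no_tree[OF X(1)])
      qed
    qed
  qed
  show ?thesis
  proof (rule mset_series_eqI)
    fix B :: "'d forest"
    show "coeff (series_coproduct (X i)) B = coeff (const_series (X i) * twist M (X i)) B"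
      using main[of "Suc (forest_size B)" i] by (simp add: agree_def)
  qed
qed

section \<open>Hopf subalgebras generated by graded systems\<close>

lemma lookup_mult_multiset:
  fixes x y :: "'a multiset \<Rightarrow>\<^sub>0 'k::comm_ring_1"
  shows "lookup (x * y) F = (\<Sum>p\<in>splits F. lookup x (fst p) * lookup y (snd p))"
proof (induction x rule: poly_mapping_induct)
  case (single a c)
  show ?case
  proof (induction y rule: poly_mapping_induct)
    case (single b d)
    have "(\<Sum>p\<in>splits F. lookup (single a c) (fst p) * lookup (single b d) (snd p)) =
        (\<Sum>p\<in>splits F. if p = (a, b) then c * d else 0)"
      by (intro sum.cong refl) (auto simp: lookup_single when_def prod_eq_iff)
    then show ?case by (simp add: mult_single lookup_single when_def)
  qed (auto simp: distrib_left lookup_add sum.distrib)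
qed (auto simp: distrib_right lookup_add sum.distrib)

definition vec_total :: "nat ^ 'n \<Rightarrow> nat" where
  "vec_total v = (\<Sum>k\<in>UNIV. v $ k)"

lemma vec_total_add: "vec_total (v + w) = vec_total v + vec_total w"
  by (simp add: vec_total_def sum.distrib)

lemma vec_total_eq_0_iff: "vec_total v = 0 \<longleftrightarrow> v = 0"
  by (simp add: vec_total_def vec_eq_iff)

lemma vec_nth_le_total: "v $ k \<le> vec_total v"
  unfolding vec_total_def by (rule member_le_sum) auto

lemma finite_vec_total_le: "finite {v :: nat ^ 'n. vec_total v \<le> m}"
proof (rule finite_subset)
  show "{v :: nat ^ 'n. vec_total v \<le> m} \<subseteq> vec_lambda ` (UNIV \<rightarrow>\<^sub>E {..m})"
  proof
    fix v :: "nat ^ 'n" assume "v \<in> {v. vec_total v \<le> m}"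
    then have "vec_nth v \<in> UNIV \<rightarrow>\<^sub>E {..m}" using vec_nth_le_total[of v] by (auto intro: le_trans)
    then have "vec_lambda (vec_nth v) \<in> vec_lambda ` (UNIV \<rightarrow>\<^sub>E {..m})" by (rule imageI)
    then show "v \<in> vec_lambda ` (UNIV \<rightarrow>\<^sub>E {..m})" by simp
  qed
qed (intro finite_imageI finite_PiE, simp_all)

lemma finite_vec_sums: "finite {p :: (nat ^ 'n) \<times> (nat ^ 'n). fst p + snd p = d}"
proof (rule finite_subset)
  show "{p. fst p + snd p = d} \<subseteq> {v. vec_total v \<le> vec_total d} \<times> {v. vec_total v \<le> vec_total d}"
    by (auto simp: vec_total_add)
qed (simp add: finite_vec_total_le)

definition of_nat_vec :: "nat ^ 'n \<Rightarrow> rat ^ 'n" where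
  "of_nat_vec v = (\<chi> k. of_nat (v $ k))"

lemma of_nat_vec_add: "of_nat_vec (v + w) = of_nat_vec v + of_nat_vec w"
  by (simp add: of_nat_vec_def vec_eq_iff)

lemma of_nat_vec_0 [simp]: "of_nat_vec 0 = 0"
  by (simp add: of_nat_vec_def vec_eq_iff)

lemma of_nat_vec_eq_iff [simp]: "of_nat_vec v = of_nat_vec w \<longleftrightarrow> v = w"
  by (simp add: of_nat_vec_def vec_eq_iff)

lemma coeff_series_over_eq_0: "f \<in> series_over D \<Longrightarrow> F \<notin> forests D \<Longrightarrow> coeff f F = 0"
  by (auto simp: series_over_def)

lemma series_over_closed:
  fixes f g :: "('d dtree, 'k::field) mset_series"
  assumes "f \<in> series_over D"
  shows "g \<in> series_over D \<Longrightarrow> f * g \<in> series_over D" "g \<in> series_over D \<Longrightarrow> f + g \<in> series_over D"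
    and "f * g = 1 \<Longrightarrow> g \<in> series_over D"
proof -
  show "g \<in> series_over D \<Longrightarrow> f * g \<in> series_over D" "g \<in> series_over D \<Longrightarrow> f + g \<in> series_over D"
    using assms by (simp_all add: restrict_series_mult restrict_series_add flip: restrict_series_id)
  assume 1: "f * g = 1"
  \<comment> \<open>Restriction to \<open>D\<close> is a ring morphism that fixes \<open>f\<close>,
    so it sends the inverse of \<open>f\<close> to another inverse of \<open>f\<close>.\<close>
  then have 2: "f * restrict_series D g = 1"
    using assms by (metis restrict_series_1 restrict_series_id restrict_series_mult)
  have "restrict_series D g = (f * g) * restrict_series D g" by (simp add: 1)
  also have "\<dots> = (f * restrict_series D g) * g" by (simp only: ac_simps)
  finally have "restrict_series D g = g" by (simp add: 2)
  then show "g \<in> series_over D" by (simp add: restrict_series_id)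
qed

lemma series_over_1: "1 \<in> series_over D"
  by (simp add: restrict_series_1 flip: restrict_series_id)

lemma series_over_const_mult: "f \<in> series_over D \<Longrightarrow> const_series c * f \<in> series_over D"
  by (auto simp: series_over_def coeff_const_mult)

text \<open>Collects all that the Hopf criterion uses about the system, without graphs:
  \<open>\<nu>\<close> is the degree \<open>\<delta>\<close> read in natural numbers,
  \<open>s i\<close> is the sign of \<open>Y i\<close> in \<open>X i\<close>, and the coproduct
  formula is an assumption.\<close>

locale graded_sdse =
  fixes D :: "'d set" and \<delta> :: "'d \<Rightarrow> rat ^ 'n" and \<nu> :: "'d \<Rightarrow> nat ^ 'n"
    and Y X :: "'i \<Rightarrow> ('d dtree, 'k::field_char_0) mset_series" and s :: "'i \<Rightarrow> 'k"
    and M :: "'d \<Rightarrow> ('d dtree, 'k) mset_series"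
  assumes degree: "c \<in> D \<Longrightarrow> \<delta> c = of_nat_vec (\<nu> c)"
    and degree_nonzero: "c \<in> D \<Longrightarrow> \<nu> c \<noteq> 0"
    and degree_finite: "finite {c \<in> D. \<nu> c = d}"
    and Y_over: "Y i \<in> series_over D"
    and Y_tree: "tree_series (Y i)"
    and X_def: "X i = 1 + const_series (s i) * Y i"
    and s_nonzero: "s i \<noteq> 0"
    and M_unit: "M c \<in> unit_group X"
    and X_coproduct: "series_coproduct (X i) = const_series (X i) * twist M (X i)"
begin

definition deg :: "'d forest \<Rightarrow> nat ^ 'n" where
  "deg F = sum_mset (image_mset \<nu> (decor F))"

definition MM :: "'d forest \<Rightarrow> ('d dtree, 'k) mset_series" where
  "MM B = (\<Prod>c\<in>#decor B. M c)"

lemma deg_add: "deg (A + B) = deg A + deg B"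
  by (simp add: deg_def)

lemma deg_decor: "decor F = decor A + decor B \<Longrightarrow> deg F = deg A + deg B"
  by (simp add: deg_def)

lemma Y_empty [simp]: "coeff (Y i) {#} = 0"
  using Y_tree[of i] by (auto simp: tree_series_def)

lemma forest_degree_eq: "F \<in> forests D \<Longrightarrow> forest_degree \<delta> F = of_nat_vec (deg F)"
proof -
  have "sum_mset (image_mset \<delta> N) = of_nat_vec (sum_mset (image_mset \<nu> N))" if "set_mset N \<subseteq> D" for N
    using that by (induction N) (auto simp: degree of_nat_vec_add)
  then show "F \<in> forests D \<Longrightarrow> forest_degree \<delta> F = of_nat_vec (deg F)"
    by (simp add: forests_decor forest_degree_decor deg_def)
qed

text \<open>Every decoration contributes at least 1 to the total of the degree.\<close>

lemma size_le_degree: "set_mset N \<subseteq> D \<Longrightarrow> size N \<le> vec_total (sum_mset (image_mset \<nu> N))"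
proof (induction N)
  case (add c N)
  then have "vec_total (\<nu> c) \<noteq> 0" by (simp add: vec_total_eq_0_iff degree_nonzero)
  with add show ?case by (auto simp: vec_total_add)
qed simp

lemma deg_eq_0: "F \<in> forests D \<Longrightarrow> deg F = 0 \<Longrightarrow> F = {#}"
  using size_le_degree[of "decor F"]
  by (auto simp: forests_decor deg_def vec_total_eq_0_iff decor_eq_empty_iff vec_total_def)

lemma deg_empty [simp]: "deg {#} = 0"
  by (simp add: deg_def)

text \<open>The degree bounds the number of vertices, and it also confines the decorations to a
  finite set, because finitely many vectors have bounded total.\<close>

lemma finite_degree: "finite {F \<in> forests D. deg F = d}"
proof -
  define m where "m = vec_total d"
  define E where "E = (\<Union>v\<in>{v. vec_total v \<le> m}. {c \<in> D. \<nu> c = v})"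
  have "finite E" unfolding E_def by (intro finite_UN_I finite_vec_total_le degree_finite)
  have "{F \<in> forests D. deg F = d} \<subseteq> {F \<in> forests E. forest_size F \<le> m}"
  proof clarify
    fix F assume F: "F \<in> forests D" "d = deg F"
    have "vec_total (\<nu> c) \<le> m" if c: "c \<in># decor F" for c
    proof -
      obtain N where "decor F = add_mset c N" using c by (meson multi_member_split)
      then show ?thesis by (simp add: m_def F(2) deg_def vec_total_add)
    qed
    then have "F \<in> forests E" using F(1) by (auto simp: forests_decor E_def)
    moreover have "forest_size F \<le> m"
      using size_le_degree[of "decor F"] F by (simp add: forests_decor forest_size_decor m_def deg_def)
    ultimately show "F \<in> forests E \<and> forest_size F \<le> m" by simp
  qed
  then show ?thesis by (rule finite_subset) (rule finite_forests[OF \<open>finite E\<close>])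
qed

text \<open>The support is finite by \<open>finite_degree\<close>, which gives
  \<open>Abs_poly_mapping\<close> its intended value.\<close>

lemma lookup_hom_component:
  assumes f: "f \<in> series_over D"
  shows "lookup (hom_component \<delta> f d) F = (if deg F = d then coeff f F else 0)"
proof -
  have *: "(if forest_degree \<delta> F = (\<chi> k. of_nat (d $ k)) then coeff f F else 0) = (if deg F = d then coeff f F else 0)" for F
    using coeff_series_over_eq_0[OF f, of F] forest_degree_eq[of F]
    by (cases "F \<in> forests D") (auto simp flip: of_nat_vec_def)
  have "finite {F. (if deg F = d then coeff f F else 0) \<noteq> 0}"
    by (rule finite_subset[OF _ finite_degree[of d]])
      (use coeff_series_over_eq_0[OF f] in \<open>auto split: if_splits\<close>)
  then show ?thesis
    by (simp add: hom_component_def * lookup_Abs_poly_mapping)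
qed

lemma hom_component_mult:
  assumes "f \<in> series_over D" "g \<in> series_over D"
  shows "hom_component \<delta> (f * g) d = (\<Sum>p | fst p + snd p = d. hom_component \<delta> f (fst p) * hom_component \<delta> g (snd p))"
proof (rule poly_mapping_eqI)
  fix F
  have "lookup (\<Sum>p | fst p + snd p = d. hom_component \<delta> f (fst p) * hom_component \<delta> g (snd p)) F =
      (\<Sum>p | fst p + snd p = d. \<Sum>q\<in>splits F. if p = (deg (fst q), deg (snd q)) then coeff f (fst q) * coeff g (snd q) else 0)"
    by (simp add: lookup_sum lookup_mult_multiset) (intro sum.cong refl, auto simp: lookup_hom_component assms)
  also have "\<dots> = (\<Sum>q\<in>splits F. \<Sum>p | fst p + snd p = d. if p = (deg (fst q), deg (snd q)) then coeff f (fst q) * coeff g (snd q) else 0)"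
    by (rule sum.swap)
  also have "\<dots> = (\<Sum>q\<in>splits F. if deg F = d then coeff f (fst q) * coeff g (snd q) else 0)"
    by (intro sum.cong refl) (auto simp: finite_vec_sums deg_add)
  also have "\<dots> = lookup (hom_component \<delta> (f * g) d) F"
    by (simp add: lookup_hom_component series_over_closed assms coeff_mult)
  finally show "lookup (hom_component \<delta> (f * g) d) F =
    lookup (\<Sum>p | fst p + snd p = d. hom_component \<delta> f (fst p) * hom_component \<delta> g (snd p)) F" ..
qed

lemma hom_component_1: "hom_component \<delta> 1 d = (if d = 0 then 1 else (0 :: _ \<Rightarrow>\<^sub>0 'k))"
  by (rule poly_mapping_eqI) (auto simp: lookup_hom_component series_over_1 coeff_simps lookup_one when_def)

section \<open>The algebra generated by the homogeneous components\<close>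

definition gens :: "('d forest \<Rightarrow>\<^sub>0 'k) set" where
  "gens = {hom_component \<delta> (Y i) d | i d. True}"

definition alg :: "('d forest \<Rightarrow>\<^sub>0 'k) set" where
  "alg = subalgebra hull gens"

lemma subalgebra_alg: "subalgebra alg"
  unfolding alg_def by (rule hull_in) (auto simp: subalgebra_def)

lemma gens_subset_alg: "gens \<subseteq> alg"
  unfolding alg_def by (rule hull_subset)

lemma gens_subset_ck_algebra: "gens \<subseteq> ck_algebra D"
  using Y_over by (auto simp: gens_def in_ck_algebra_iff lookup_hom_component series_over_def)

text \<open>Plays the role of the completion of \<open>alg\<close>, in which the monomials in the
  \<open>X i\<close> and their inverses live.\<close>

definition graded_closure :: "('d dtree, 'k) mset_series set" where
  "graded_closure = {f \<in> series_over D. \<forall>d. hom_component \<delta> f d \<in> alg}"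

lemma graded_closure_mult: "f \<in> graded_closure \<Longrightarrow> g \<in> graded_closure \<Longrightarrow> f * g \<in> graded_closure"
  by (auto simp: graded_closure_def series_over_closed hom_component_mult
      intro!: subalgebra_sum subalgebra_alg subalgebraD[OF subalgebra_alg])

lemma graded_closure_1: "1 \<in> graded_closure"
  by (auto simp: graded_closure_def series_over_1 hom_component_1 intro: subalgebraD[OF subalgebra_alg])

text \<open>The component of degree \<open>d\<close> of \<open>f * g = 1\<close> expresses that of
  \<open>g\<close>, multiplied by the nonzero constant term of \<open>f\<close>, through components
  of \<open>g\<close> of smaller total degree.\<close>

lemma graded_closure_inverse:
  assumes f: "f \<in> graded_closure" and fg: "f * g = 1"
  shows "g \<in> graded_closure"
proof -
  have fD: "f \<in> series_over D" and gD: "g \<in> series_over D"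
    using f fg series_over_closed(3) by (auto simp: graded_closure_def)
  define a where "a = coeff f {#}"
  have "coeff (f * g) {#} = 1" by (simp only: fg) (simp add: coeff_simps)
  then have a: "a \<noteq> 0" by (auto simp: a_def)
  have "hom_component \<delta> g d \<in> alg" for d
  proof (induction "vec_total d" arbitrary: d rule: less_induct)
    case less
    have f0: "hom_component \<delta> f 0 = scale a 1"
    proof (rule poly_mapping_eqI)
      fix F
      show "lookup (hom_component \<delta> f 0) F = lookup (scale a 1) F"
        using deg_eq_0[of F] coeff_series_over_eq_0[OF fD, of F]
        by (cases "F \<in> forests D") (auto simp: lookup_hom_component fD lookup_scale lookup_one when_def a_def)
    qed
    let ?S = "{p. fst p + snd p = d} - {(0, d)}"
    have "hom_component \<delta> 1 d = hom_component \<delta> f 0 * hom_component \<delta> g d +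
        (\<Sum>p\<in>?S. hom_component \<delta> f (fst p) * hom_component \<delta> g (snd p))"
      unfolding fg[symmetric] hom_component_mult[OF fD gD]
      by (subst sum.remove[of _ "(0, d)"]) (auto simp: finite_vec_sums)
    then have "scale a (hom_component \<delta> g d) = hom_component \<delta> 1 d +
        scale (- 1) (\<Sum>p\<in>?S. hom_component \<delta> f (fst p) * hom_component \<delta> g (snd p))"
      unfolding f0 using scale_mult[of a 1 1 "hom_component \<delta> g d"]
      by (simp add: poly_mapping_eq_iff fun_eq_iff lookup_add lookup_scale)
    also have "\<dots> \<in> alg"
    proof -
      have "hom_component \<delta> f (fst p) * hom_component \<delta> g (snd p) \<in> alg" if p: "p \<in> ?S" for p
      proof -
        have "fst p \<noteq> 0" using p by (cases p) auto
        then have "vec_total (fst p) \<noteq> 0" by (simp add: vec_total_eq_0_iff)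
        moreover have "vec_total d = vec_total (fst p) + vec_total (snd p)" using p by (auto simp: vec_total_add)
        ultimately have "hom_component \<delta> g (snd p) \<in> alg" by (intro less) simp
        then show ?thesis using f by (auto simp: graded_closure_def intro: subalgebraD[OF subalgebra_alg])
      qed
      moreover have "hom_component \<delta> 1 d \<in> alg" using graded_closure_1 by (simp add: graded_closure_def)
      ultimately show ?thesis
        by (intro subalgebraD(2,4)[OF subalgebra_alg] subalgebra_sum subalgebra_alg)
    qed
    finally have "scale (1 / a) (scale a (hom_component \<delta> g d)) \<in> alg"
      by (rule subalgebraD[OF subalgebra_alg])
    then show ?case using a by (simp add: scale_scale)
  qed
  then show ?thesis by (simp add: graded_closure_def gD)
qed

lemma X_over: "X i \<in> series_over D"
  unfolding X_def by (rule series_over_closed(2)[OF series_over_1 series_over_const_mult[OF Y_over]])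

lemma X_in_graded_closure: "X i \<in> graded_closure"
proof -
  have "hom_component \<delta> (X i) d = hom_component \<delta> 1 d + scale (s i) (hom_component \<delta> (Y i) d)" for d
    by (rule poly_mapping_eqI)
      (simp add: lookup_hom_component X_over series_over_1 Y_over lookup_add lookup_scale,
        simp add: X_def coeff_simps coeff_const_mult)
  moreover have "hom_component \<delta> 1 d \<in> alg" "hom_component \<delta> (Y i) d \<in> alg" for d
    using graded_closure_1 gens_subset_alg by (auto simp: graded_closure_def gens_def)
  ultimately show ?thesis
    by (auto simp: graded_closure_def X_over intro!: subalgebraD[OF subalgebra_alg])
qed

lemma unit_group_subset: "f \<in> unit_group X \<Longrightarrow> f \<in> graded_closure"
  by (induction rule: unit_group.induct)
    (auto intro: X_in_graded_closure graded_closure_mult graded_closure_inverse)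

lemma MM_in_graded_closure: "MM B \<in> graded_closure"
proof -
  have "(\<Prod>c\<in>#N. M c) \<in> graded_closure" for N
    by (induction N) (auto intro: graded_closure_1 graded_closure_mult unit_group_subset M_unit)
  then show ?thesis by (simp add: MM_def)
qed

text \<open>The formula for \<open>X i\<close> with the summand 1 removed and the nonzero factor
  \<open>s i\<close> cancelled. The removal affects only the empty right factor.\<close>

lemma Y_coproduct:
  "coeff (coeff (series_coproduct (Y i)) B) A = (if B = {#} then coeff (Y i) A else coeff (X i * MM B) A * coeff (Y i) B)"
proof (cases "B = {#}")
  case True
  then show ?thesis by (simp add: coeff_series_coproduct_empty)
next
  case False
  have "series_coproduct (X i) = 1 + const_series (const_series (s i)) * series_coproduct (Y i)"
    by (simp add: X_def series_coproduct_add series_coproduct_1 series_coproduct_const_mult)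
  then have "coeff (coeff (series_coproduct (X i)) B) A = s i * coeff (coeff (series_coproduct (Y i)) B) A"
    using False by (simp add: coeff_simps coeff_const_mult)
  moreover have "coeff (coeff (series_coproduct (X i)) B) A = s i * (coeff (X i * MM B) A * coeff (Y i) B)"
  proof -
    have "coeff (coeff (series_coproduct (X i)) B) A = coeff (const_series (coeff (X i) B) * (X i * MM B)) A"
      by (simp add: X_coproduct coeff_const_mult coeff_twist MM_def ac_simps)
    also have "\<dots> = coeff (X i) B * coeff (X i * MM B) A" by (rule coeff_const_mult)
    also have "coeff (X i) B = s i * coeff (Y i) B" using False by (simp add: X_def coeff_simps coeff_const_mult)
    finally show ?thesis by simp
  qed
  ultimately show ?thesis using False s_nonzero[of i] by simp
qed

lemma lookup_ck_coproduct_hom_component: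
  "lookup (ck_coproduct (hom_component \<delta> (Y i) d)) (A, B) =
    (if deg A + deg B = d then coeff (coeff (series_coproduct (Y i)) B) A else 0)"
proof -
  let ?x = "hom_component \<delta> (Y i) d" and ?S = "{F. decor F = decor A + decor B}"
  have "lookup (ck_coproduct ?x) (A, B) = (\<Sum>F\<in>keys ?x \<union> ?S. lookup ?x F * lookup (forest_coproduct F) (A, B))"
    unfolding ck_coproduct_eq by (rule lookup_linear_ext_superset) (auto simp: finite_decor)
  also have "\<dots> = (\<Sum>F\<in>?S. lookup ?x F * lookup (forest_coproduct F) (A, B))"
    by (rule sum.mono_neutral_right) (auto simp: finite_decor lookup_forest_coproduct_eq_0)
  also have "\<dots> = (\<Sum>F\<in>?S. if deg A + deg B = d then coeff (Y i) F * lookup (forest_coproduct F) (A, B) else 0)"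
    by (intro sum.cong refl) (auto simp: lookup_hom_component Y_over dest: deg_decor)
  also have "\<dots> = (if deg A + deg B = d then coeff (coeff (series_coproduct (Y i)) B) A else 0)"
    by (simp add: coeff_series_coproduct)
  finally show ?thesis .
qed

text \<open>As the left factor depends only on the degree of the right one, the right factors of
  equal degree add up to a homogeneous component of \<open>Y i\<close>.\<close>

theorem hopf_subalgebraI:
  assumes *: "\<And>i B B'. coeff (Y i) B \<noteq> 0 \<Longrightarrow> coeff (Y i) B' \<noteq> 0 \<Longrightarrow> deg B = deg B' \<Longrightarrow> MM B = MM B'"
  shows "hopf_subalgebra D alg"
  unfolding alg_def hopf_subalgebra_hull_iff[OF gens_subset_ck_algebra]
proof (clarify, unfold alg_def[symmetric])
  fix x assume "x \<in> gens"
  then obtain i d where x: "x = hom_component \<delta> (Y i) d" by (auto simp: gens_def)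
  \<comment> \<open>The common value of \<open>MM\<close> on the forests of degree \<open>e\<close>
    in \<open>Y i\<close>. Where there are none the component of degree \<open>e\<close> is zero,
    and 1 is a default that stays in \<open>graded_closure\<close>.\<close>
  define N where "N e = (if \<exists>B. coeff (Y i) B \<noteq> 0 \<and> deg B = e then MM (SOME B. coeff (Y i) B \<noteq> 0 \<and> deg B = e) else 1)" for e
  have N: "N (deg B) = MM B" if B: "coeff (Y i) B \<noteq> 0" for B
  proof -
    let ?P = "\<lambda>B'. coeff (Y i) B' \<noteq> 0 \<and> deg B' = deg B"
    have "?P (SOME B'. ?P B')" by (rule someI[of ?P B]) (use B in auto)
    then have "MM (SOME B'. ?P B') = MM B" using B by (intro *[of i]) auto
    then show ?thesis using B by (auto simp: N_def)
  qed
  have NX: "X i * N e \<in> graded_closure" for e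
    by (auto simp: N_def intro: graded_closure_mult X_in_graded_closure MM_in_graded_closure)
  have NXD: "X i * N e \<in> series_over D" for e using NX[of e] by (simp add: graded_closure_def)
  \<comment> \<open>\<open>tensor x 1\<close> accounts for the empty right factor, where the sum
    contributes nothing because \<open>Y i\<close> has no constant term.\<close>
  have "ck_coproduct x = tensor x 1 + (\<Sum>p | fst p + snd p = d. tensor (hom_component \<delta> (X i * N (snd p)) (fst p)) (hom_component \<delta> (Y i) (snd p)))"
    (is "?l = ?r")
  proof (rule poly_mapping_eqI)
    fix q :: "'d forest \<times> 'd forest"
    obtain A B where q: "q = (A, B)" by (cases q)
    have "lookup (\<Sum>p | fst p + snd p = d. tensor (hom_component \<delta> (X i * N (snd p)) (fst p)) (hom_component \<delta> (Y i) (snd p))) (A, B) =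
      (\<Sum>p | fst p + snd p = d. if p = (deg A, deg B) then coeff (X i * N (deg B)) A * coeff (Y i) B else 0)"
      unfolding lookup_sum by (intro sum.cong refl) (auto simp: lookup_tensor lookup_hom_component NXD Y_over)
    also have "\<dots> = (if deg A + deg B = d then coeff (X i * N (deg B)) A * coeff (Y i) B else 0)"
      by (simp add: finite_vec_sums)
    finally have "lookup ?r (A, B) = lookup x A * lookup 1 B + (if deg A + deg B = d then coeff (X i * N (deg B)) A * coeff (Y i) B else 0)"
      by (simp add: lookup_add lookup_tensor)
    also have "\<dots> = lookup ?l (A, B)"
      using N[of B] by (cases "coeff (Y i) B = 0")
        (auto simp: x lookup_ck_coproduct_hom_component Y_coproduct lookup_one when_def lookup_hom_component Y_over)
    finally show "lookup ?l q = lookup ?r q" by (simp add: q)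
  qed
  also have "\<dots> \<in> tensor_square alg"
  proof (intro tensor_square_add tensor_square_sum tensor_square_tensor)
    show "x \<in> alg" using \<open>x \<in> gens\<close> gens_subset_alg by blast
    show "hom_component \<delta> (Y i) (snd p) \<in> alg" for p using gens_subset_alg by (auto simp: gens_def)
    show "hom_component \<delta> (X i * N (snd p)) (fst p) \<in> alg" for p using NX by (simp add: graded_closure_def)
  qed (rule subalgebraD[OF subalgebra_alg])
  finally show "ck_coproduct x \<in> tensor_square alg" .
qed

text \<open>The equation defining \<open>W\<close> in the proof holds for the generators, and the linear part is a derivation
  at the augmentation, so \<open>W\<close> contains the whole algebra; it is then tested on the contraction of
  a coproduct with the coefficient of \<open>{#u#}\<close> in the left factor.\<close>

theorem hopf_subalgebraD:
  assumes hopf: "hopf_subalgebra D alg"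
    and t: "coeff (Y i) {#t#} \<noteq> 0" "coeff (Y i) {#t'#} \<noteq> 0" "deg {#t#} = deg {#t'#}"
    and other: "\<And>j. j \<noteq> i \<Longrightarrow> coeff (Y j) {#t#} = 0 \<and> coeff (Y j) {#t'#} = 0"
  shows "coeff (X i * MM {#t#}) {#u#} = coeff (X i * MM {#t'#}) {#u#}"
proof -
  let ?c = "coeff (Y i) {#t#}" and ?c' = "coeff (Y i) {#t'#}"
  define W where "W = {x :: 'd forest \<Rightarrow>\<^sub>0 'k. lookup x {#t#} * ?c' = lookup x {#t'#} * ?c}"
  have single_splits: "splits {#v#} = {({#}, {#v#}), ({#v#}, {#})}" for v :: "'d dtree"
    by (auto simp: union_is_single)
  have "alg \<subseteq> W"
    unfolding alg_def
  proof (rule hull_minimal)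
    show "gens \<subseteq> W"
    proof
      fix x assume "x \<in> gens"
      then obtain j d where "x = hom_component \<delta> (Y j) d" by (auto simp: gens_def)
      \<comment> \<open>The two trees have equal degree, so a component of \<open>Y i\<close> sees
        both or neither; the components of the other series vanish at both.\<close>
      then show "x \<in> W" using t(3) other[of j] by (cases "j = i") (auto simp: W_def lookup_hom_component Y_over)
    qed
    show "subalgebra W"
    proof (rule subalgebraI)
      fix x y assume "x \<in> W" "y \<in> W"
      then have x: "lookup x {#t#} * ?c' = lookup x {#t'#} * ?c" and y: "lookup y {#t#} * ?c' = lookup y {#t'#} * ?c"
        by (simp_all add: W_def)
      show "x + y \<in> W" using x y by (simp add: W_def lookup_add distrib_right)
      have mult: "lookup (x * y) {#v#} = lookup x {#} * lookup y {#v#} + lookup x {#v#} * lookup y {#}" for v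
        unfolding lookup_mult_multiset single_splits by simp
      have "(x0 * yt + xt * y0) * c' = x0 * (yt * c') + y0 * (xt * c')" for x0 yt xt y0 c' :: 'k
        by (simp add: algebra_simps)
      then show "x * y \<in> W" unfolding W_def mem_Collect_eq mult by (simp only: x y)
    qed (auto simp: W_def lookup_one lookup_scale when_def mult.assoc)
  qed
  define \<phi> where "\<phi> = linear_ext (\<lambda>(A, B). if A = {#u#} then single B 1 else (0 :: 'd forest \<Rightarrow>\<^sub>0 'k))"
  have lookup_\<phi>: "lookup (\<phi> z) B = lookup z ({#u#}, B)" for z B
    unfolding \<phi>_def by (induction z rule: poly_mapping_induct)
      (auto simp: linear_ext_add lookup_add lookup_scale lookup_single when_def split: if_splits)
  have \<phi>_alg: "\<phi> z \<in> alg" if "z \<in> tensor_square alg" for z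
    using that
  proof (induction rule: tensor_square_induct)
    case zero
    then show ?case by (simp add: \<phi>_def subalgebraD[OF subalgebra_alg])
  next
    case (add x y z)
    have "\<phi> (tensor x y) = scale (lookup x {#u#}) y"
      by (rule poly_mapping_eqI) (simp add: lookup_\<phi> lookup_tensor lookup_scale)
    then show ?case using add by (simp add: \<phi>_def linear_ext_add subalgebraD[OF subalgebra_alg])
  qed
  \<comment> \<open>The degree is chosen so that the coproduct sees both pairs, \<open>{#u#}\<close>
    with \<open>{#t#}\<close> and \<open>{#u#}\<close> with \<open>{#t'#}\<close>.\<close>
  define x where "x = hom_component \<delta> (Y i) (deg {#u#} + deg {#t#})"
  have "x \<in> alg" using gens_subset_alg by (auto simp: gens_def x_def)
  then have "ck_coproduct x \<in> tensor_square alg" using hopf by (auto simp: hopf_subalgebra_def)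
  then have "\<phi> (ck_coproduct x) \<in> W" using \<phi>_alg \<open>alg \<subseteq> W\<close> by blast
  moreover have "lookup (\<phi> (ck_coproduct x)) {#t#} = coeff (X i * MM {#t#}) {#u#} * ?c"
    "lookup (\<phi> (ck_coproduct x)) {#t'#} = coeff (X i * MM {#t'#}) {#u#} * ?c'"
    using t(3) by (simp_all add: lookup_\<phi> x_def lookup_ck_coproduct_hom_component Y_coproduct)
  ultimately show ?thesis using t(1,2) by (simp add: W_def)
qed

end

section \<open>Graph isomorphism and numbers of edges\<close>

lemma pregraphD:
  assumes "pregraph G"
  shows "finite (half_edges G)" "finite (verts G)" "he_type G \<in> extensional (half_edges G)"
    "flip G \<in> half_edges G \<rightarrow>\<^sub>E half_edges G" "src G \<in> half_edges G \<rightarrow>\<^sub>E verts G"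
    "e \<in> half_edges G \<Longrightarrow> flip G e \<in> half_edges G" "e \<in> half_edges G \<Longrightarrow> src G e \<in> verts G"
    "e \<in> half_edges G \<Longrightarrow> flip G (flip G e) = e"
  using assms by (auto simp: pregraph_def)

lemma int_edges_pair:
  assumes "pregraph G" "{a, b} \<in> int_edges G"
  shows "a \<in> half_edges G" "b \<in> half_edges G" "b = flip G a" "a \<noteq> b"
proof -
  obtain e where e: "e \<in> half_edges G" "flip G e \<noteq> e" "{a, b} = {e, flip G e}"
    using assms(2) by (auto simp: int_edges_def)
  then have "(a = e \<and> b = flip G e) \<or> (a = flip G e \<and> b = e)" by (simp add: doubleton_eq_iff)
  then show "a \<in> half_edges G" "b \<in> half_edges G" "b = flip G a" "a \<noteq> b"
    using e pregraphD[OF assms(1)] by auto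
qed

lemma reachable_refl: "reachable G E v v"
  by (simp add: reachable_def)

lemma reachable_verts:
  assumes G: "pregraph G" and "E \<subseteq> int_edges G" "reachable G E u v" "u \<in> verts G"
  shows "v \<in> verts G"
  using assms(3,4) unfolding reachable_def
proof (induction rule: rtrancl_induct)
  case (step v w)
  then obtain a b where "{a, b} \<in> E" "v = src G a" "w = src G b" by auto
  then show ?case using int_edges_pair[OF G, of a b] pregraphD(7)[OF G] assms(2) by blast
qed

lemma induced_verts:
  assumes G: "pregraph G"
  shows "induced G (verts G) = G"
proof -
  have H: "{e \<in> half_edges G. src G e \<in> verts G} = half_edges G" using pregraphD(7)[OF G] by auto
  have "restrict (he_type G) (half_edges G) = he_type G" "restrict (flip G) (half_edges G) = flip G"
    "restrict (src G) (half_edges G) = src G"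
    using pregraphD[OF G] by (auto simp: PiE_def intro!: extensional_restrict)
  then show ?thesis by (simp add: induced_def H Let_def)
qed

lemma components_connected:
  assumes G: "pregraph G" "verts G \<noteq> {}" "connected_graph G (int_edges G)"
  shows "components G = {G}"
proof -
  have "{u. reachable G (int_edges G) v u} = verts G" if "v \<in> verts G" for v
  proof (intro equalityI subsetI)
    show "u \<in> verts G" if "u \<in> {u. reachable G (int_edges G) v u}" for u
      using that \<open>v \<in> verts G\<close> by (intro reachable_verts[OF G(1) order.refl, of v u]) simp_all
    show "u \<in> {u. reachable G (int_edges G) v u}" if "u \<in> verts G" for u
      using that \<open>v \<in> verts G\<close> G(3) by (simp add: connected_graph_def)
  qed
  then have "components G = (\<lambda>v. induced G (verts G)) ` verts G"
    by (simp add: components_def)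
  then show ?thesis using G(2) by (auto simp: induced_verts[OF G(1)])
qed

lemma components_one_PI: "one_PI G \<Longrightarrow> components G = {G}"
  by (rule components_connected) (auto simp: one_PI_def)

lemma feynman_one_PI: "one_PI G \<Longrightarrow> feynman G"
  by (simp add: feynman_def components_one_PI) (simp add: one_PI_def)

lemma feynman_pregraph: "feynman G \<Longrightarrow> pregraph G"
  by (simp add: feynman_def)

text \<open>The numbers of quarks, ghosts and gluons already separate the seven types.\<close>

lemma inj_ext_type_mset: "ext_type_mset i = ext_type_mset j \<longleftrightarrow> i = j"
proof
  assume "ext_type_mset i = ext_type_mset j"
  then have c: "count (ext_type_mset i) \<tau> = count (ext_type_mset j) \<tau>" for \<tau> by simp
  note c = c[of Quark] c[of Ghost] c[of Gluon]
  show "i = j"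
  proof (cases i; cases j)
    fix a b assume "i = Inl a" "j = Inl b" then show ?thesis using c by (cases a; cases b) (auto simp: ext_type_mset_def)
  next
    fix a b assume "i = Inl a" "j = Inr b" then show ?thesis using c by (cases a; cases b) (auto simp: ext_type_mset_def)
  next
    fix a b assume "i = Inr a" "j = Inl b" then show ?thesis using c by (cases a; cases b) (auto simp: ext_type_mset_def)
  next
    fix a b assume "i = Inr a" "j = Inr b" then show ?thesis using c by (cases a; cases b) (auto simp: ext_type_mset_def)
  qed
qed simp

lemma inj_vertex_mset: "vertex_mset i = vertex_mset j \<longleftrightarrow> i = j"
  using inj_ext_type_mset[of "Inl i" "Inl j"] by (simp add: ext_type_mset_def)

lemma graph_iso_refl: "graph_iso G G"
  unfolding graph_iso_def by (intro exI[of _ id]) auto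

text \<open>The system reads its exponents and degrees off a chosen representative of each class, so
  the data used must be transported along isomorphisms.\<close>

locale graph_isomorphism =
  fixes G H :: fgraph and f g :: "nat \<Rightarrow> nat"
  assumes G: "pregraph G" and H: "pregraph H"
    and bij_f: "bij_betw f (half_edges G) (half_edges H)" and bij_g: "bij_betw g (verts G) (verts H)"
    and iso: "\<And>e. e \<in> half_edges G \<Longrightarrow> he_type H (f e) = he_type G e"
      "\<And>e. e \<in> half_edges G \<Longrightarrow> flip H (f e) = f (flip G e)"
      "\<And>e. e \<in> half_edges G \<Longrightarrow> src H (f e) = g (src G e)"
begin

lemma inj: "e \<in> half_edges G \<Longrightarrow> e' \<in> half_edges G \<Longrightarrow> f e = f e' \<longleftrightarrow> e = e'"
  "v \<in> verts G \<Longrightarrow> v' \<in> verts G \<Longrightarrow> g v = g v' \<longleftrightarrow> v = v'"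
  using bij_f bij_g by (auto simp: bij_betw_def inj_on_def)

lemma image: "half_edges H = f ` half_edges G" "verts H = g ` verts G"
  using bij_f bij_g by (auto simp: bij_betw_def)

lemma type_mset_image:
  assumes "A \<subseteq> half_edges G"
  shows "type_mset H (f ` A) = type_mset G A"
proof -
  have "inj_on f A" using bij_f assms by (auto simp: bij_betw_def intro: inj_on_subset)
  then have "type_mset H (f ` A) = image_mset (\<lambda>e. he_type H (f e)) (mset_set A)"
    by (simp add: type_mset_def image_mset_mset_set[symmetric] multiset.map_comp comp_def)
  also have "\<dots> = image_mset (he_type G) (mset_set A)"
  proof (rule image_mset_cong)
    fix e assume "e \<in># mset_set A"
    then have "e \<in> A" by (cases "finite A") auto
    then show "he_type H (f e) = he_type G e" using assms iso(1) by blast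
  qed
  finally show ?thesis by (simp add: type_mset_def)
qed

lemma vertex_type_mset: "v \<in> verts G \<Longrightarrow> vertex_type_mset H (g v) = vertex_type_mset G v"
proof -
  assume v: "v \<in> verts G"
  have "{e \<in> half_edges H. src H e = g v} = f ` {e \<in> half_edges G. src G e = v}"
    using v pregraphD(7)[OF G] by (auto simp: image iso inj)
  then show ?thesis by (simp add: vertex_type_mset_def type_mset_image)
qed

lemma num_vertices: "num_vertices H j = num_vertices G j"
proof -
  have "{v \<in> verts H. vertex_type_mset H v = vertex_mset j} = g ` {v \<in> verts G. vertex_type_mset G v = vertex_mset j}"
    by (auto simp: image vertex_type_mset)
  moreover have "inj_on g {v \<in> verts G. vertex_type_mset G v = vertex_mset j}"
    by (auto simp: inj_on_def inj)
  ultimately show ?thesis by (simp add: num_vertices_def card_image)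
qed

lemma type_mset_ext: "type_mset H (ext_half_edges H) = type_mset G (ext_half_edges G)"
proof -
  have "ext_half_edges H = f ` ext_half_edges G"
    using pregraphD(6)[OF G] by (auto simp: ext_half_edges_def image iso inj)
  then show ?thesis by (simp add: type_mset_image ext_half_edges_def)
qed

lemma reachable:
  assumes "reachable G (int_edges G) u v"
  shows "reachable H (int_edges H) (g u) (g v)"
  using assms unfolding reachable_def
proof (induction rule: rtrancl_induct)
  case (step v w)
  then obtain a b where ab: "{a, b} \<in> int_edges G" "v = src G a" "w = src G b" by auto
  note a = int_edges_pair[OF G ab(1)]
  have "f a \<in> half_edges H" "flip H (f a) \<noteq> f a" using a by (auto simp: image iso inj)
  moreover have "flip H (f a) = f b" using a iso(2) by simp
  ultimately have "{f a, f b} \<in> int_edges H"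
    unfolding int_edges_def by (intro CollectI exI[of _ "f a"]) simp
  moreover have "(g v, g w) = (src H (f a), src H (f b))" using a ab iso(3) by simp
  ultimately have "(g v, g w) \<in> {(src H a, src H b) |a b. {a, b} \<in> int_edges H}"
    by (intro CollectI exI conjI)
  with step.IH show ?case by (rule rtrancl_into_rtrancl)
qed simp

text \<open>Since \<open>H\<close> is a Feynman graph, only connectedness has to be transported:
  \<open>H\<close> is then its own unique component.\<close>

lemma one_PI_iso:
  assumes "one_PI G" "feynman H"
  shows "one_PI H"
proof -
  have "connected_graph H (int_edges H)"
    using assms(1) reachable by (auto simp: one_PI_def connected_graph_def image)
  moreover have "verts H \<noteq> {}" using assms(1) by (auto simp: one_PI_def image)
  ultimately have "components H = {H}" by (intro components_connected H)
  then show ?thesis using assms(2) by (simp add: feynman_def)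
qed

end

lemma class_rep_iso:
  assumes "feynman G"
  shows "feynman (class_rep (iso_class G))" "\<exists>f g. graph_isomorphism G (class_rep (iso_class G)) f g"
proof -
  have "class_rep (iso_class G) \<in> iso_class G"
    unfolding class_rep_def by (rule someI[of _ G]) (simp add: iso_class_def assms graph_iso_refl)
  then have 1: "feynman (class_rep (iso_class G))" "graph_iso G (class_rep (iso_class G))"
    by (simp_all add: iso_class_def)
  then show "feynman (class_rep (iso_class G))" "\<exists>f g. graph_isomorphism G (class_rep (iso_class G)) f g"
    using feynman_pregraph[OF assms] feynman_pregraph[OF 1(1)]
    by (auto simp: graph_iso_def graph_isomorphism_def)
qed

lemma class_rep_prim_graphs:
  assumes "one_PI G" "type_mset G (ext_half_edges G) = ext_type_mset i"
  shows "one_PI (class_rep (iso_class G))"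
    and "type_mset (class_rep (iso_class G)) (ext_half_edges (class_rep (iso_class G))) = ext_type_mset i"
    and "num_vertices (class_rep (iso_class G)) j = num_vertices G j"
proof -
  obtain f g where "graph_isomorphism G (class_rep (iso_class G)) f g"
    using class_rep_iso[OF feynman_one_PI[OF assms(1)]] by blast
  then interpret graph_isomorphism G "class_rep (iso_class G)" f g .
  show "one_PI (class_rep (iso_class G))"
    using assms(1) class_rep_iso(1)[OF feynman_one_PI[OF assms(1)]] by (rule one_PI_iso)
  show "type_mset (class_rep (iso_class G)) (ext_half_edges (class_rep (iso_class G))) = ext_type_mset i"
    by (simp add: type_mset_ext assms)
  show "num_vertices (class_rep (iso_class G)) j = num_vertices G j" by (rule num_vertices)
qed

subsection \<open>Counting half-edges\<close>

lemma count_type_mset: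
  assumes "finite A"
  shows "count (type_mset G A) \<tau> = card {e \<in> A. he_type G e = \<tau>}"
  using assms
proof (induction A rule: finite_induct)
  case (insert e A)
  have "{e' \<in> insert e A. he_type G e' = \<tau>} = (if he_type G e = \<tau> then insert e {e' \<in> A. he_type G e' = \<tau>} else {e' \<in> A. he_type G e' = \<tau>})"
    by auto
  then show ?case using insert by (simp add: type_mset_def)
qed (simp add: type_mset_def)

lemma UNIV_vertex_type: "(UNIV :: vertex_type set) = {T1, T2, T3, T4}"
  by (auto intro: vertex_type.exhaust)

lemma UNIV_edge_type: "(UNIV :: edge_type set) = {T5, T6, T7}"
  by (auto intro: edge_type.exhaust)

lemma card_vertex_type: "CARD(vertex_type) = 4"
  by (simp add: UNIV_vertex_type)

text \<open>Counts each half-edge at its source, which is unique; vertices of the same type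
  contribute equally.\<close>

lemma half_edges_by_vertices:
  assumes G: "pregraph G" and v: "\<And>v. v \<in> verts G \<Longrightarrow> \<exists>j. vertex_type_mset G v = vertex_mset j"
  shows "card {e \<in> half_edges G. he_type G e = \<tau>} = (\<Sum>j\<in>UNIV. num_vertices G j * count (vertex_mset j) \<tau>)"
proof -
  note fin = pregraphD(1,2)[OF G]
  have "{e \<in> half_edges G. he_type G e = \<tau>} = (\<Union>v\<in>verts G. {e \<in> {e \<in> half_edges G. src G e = v}. he_type G e = \<tau>})"
    using pregraphD(7)[OF G] by auto
  also have "card \<dots> = (\<Sum>v\<in>verts G. card {e \<in> {e \<in> half_edges G. src G e = v}. he_type G e = \<tau>})"
    by (rule card_UN_disjoint) (use fin in auto)
  also have "\<dots> = (\<Sum>v\<in>verts G. count (vertex_type_mset G v) \<tau>)"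
    using fin by (simp add: vertex_type_mset_def count_type_mset)
  also have "\<dots> = (\<Sum>v\<in>verts G. \<Sum>j\<in>UNIV. if vertex_type_mset G v = vertex_mset j then count (vertex_mset j) \<tau> else 0)"
  proof (rule sum.cong)
    fix v assume "v \<in> verts G"
    then obtain j where j: "vertex_type_mset G v = vertex_mset j" using v by blast
    show "count (vertex_type_mset G v) \<tau> = (\<Sum>j\<in>UNIV. if vertex_type_mset G v = vertex_mset j then count (vertex_mset j) \<tau> else 0)"
      by (simp add: j inj_vertex_mset)
  qed simp
  also have "\<dots> = (\<Sum>j\<in>UNIV. \<Sum>v\<in>verts G. if vertex_type_mset G v = vertex_mset j then count (vertex_mset j) \<tau> else 0)"
    by (rule sum.swap)
  also have "\<dots> = (\<Sum>j\<in>UNIV. num_vertices G j * count (vertex_mset j) \<tau>)"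
    by (intro sum.cong refl) (simp add: num_vertices_def sum.If_cases fin Int_def)
  finally show ?thesis .
qed

lemma half_edges_split:
  assumes G: "pregraph G"
  shows "card {e \<in> half_edges G. he_type G e = \<tau>} =
    count (type_mset G (ext_half_edges G)) \<tau> + card {e \<in> half_edges G. flip G e \<noteq> e \<and> he_type G e = \<tau>}"
proof -
  note fin = pregraphD(1)[OF G]
  have "{e \<in> half_edges G. he_type G e = \<tau>} = {e \<in> ext_half_edges G. he_type G e = \<tau>} \<union>
      {e \<in> half_edges G. flip G e \<noteq> e \<and> he_type G e = \<tau>}" by (auto simp: ext_half_edges_def)
  also have "card \<dots> = card {e \<in> ext_half_edges G. he_type G e = \<tau>} + card {e \<in> half_edges G. flip G e \<noteq> e \<and> he_type G e = \<tau>}"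
    by (rule card_Un_disjoint) (use fin in \<open>auto simp: ext_half_edges_def\<close>)
  finally show ?thesis using fin by (simp add: count_type_mset ext_half_edges_def)
qed

context
  fixes G
  assumes G: "pregraph G"
    and conj: "\<And>e. e \<in> half_edges G \<Longrightarrow> flip G e \<noteq> e \<Longrightarrow> conj_type (he_type G e) = he_type G (flip G e)"
begin

lemma type_mset_int_edge: "e \<in> half_edges G \<Longrightarrow> flip G e \<noteq> e \<Longrightarrow>
    type_mset G {e, flip G e} = {#he_type G e, conj_type (he_type G e)#}"
  by (simp add: type_mset_def conj)

text \<open>The two ends of an oriented edge have different types, so exactly one of them has type
  \<open>\<tau>\<close>.\<close>

lemma num_edges_oriented:
  assumes "edge_mset j = {#\<tau>, conj_type \<tau>#}" "conj_type \<tau> \<noteq> \<tau>"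
  shows "card {e \<in> half_edges G. flip G e \<noteq> e \<and> he_type G e = \<tau>} = num_edges G j"
proof -
  have "bij_betw (\<lambda>e. {e, flip G e}) {e \<in> half_edges G. flip G e \<noteq> e \<and> he_type G e = \<tau>}
      {E \<in> int_edges G. type_mset G E = edge_mset j}"
    unfolding bij_betw_def
  proof
    show "inj_on (\<lambda>e. {e, flip G e}) {e \<in> half_edges G. flip G e \<noteq> e \<and> he_type G e = \<tau>}"
    proof (rule inj_onI, clarify)
      fix e e' assume *: "e \<in> half_edges G" "flip G e \<noteq> e" "e' \<in> half_edges G" "flip G e' \<noteq> e'"
        "\<tau> = he_type G e" "he_type G e' = he_type G e" "{e, flip G e} = {e', flip G e'}"
      show "e = e'"
      proof (rule ccontr)
        assume "e \<noteq> e'"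
        with *(7) have "e = flip G e'" by auto
        then show False using conj[of e'] * assms(2) by auto
      qed
    qed
    show "(\<lambda>e. {e, flip G e}) ` {e \<in> half_edges G. flip G e \<noteq> e \<and> he_type G e = \<tau>} =
        {E \<in> int_edges G. type_mset G E = edge_mset j}"
    proof (intro equalityI subsetI)
      fix E assume "E \<in> {E \<in> int_edges G. type_mset G E = edge_mset j}"
      then obtain e where e: "e \<in> half_edges G" "flip G e \<noteq> e" "E = {e, flip G e}"
        and "type_mset G E = edge_mset j" by (auto simp: int_edges_def)
      then have "\<tau> \<in># {#he_type G e, he_type G (flip G e)#}"
        by (simp add: type_mset_int_edge conj[symmetric] assms(1))
      then consider "he_type G e = \<tau>" | "he_type G (flip G e) = \<tau>" by auto
      then show "E \<in> (\<lambda>e. {e, flip G e}) ` {e \<in> half_edges G. flip G e \<noteq> e \<and> he_type G e = \<tau>}"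
      proof cases
        case 1
        then show ?thesis using e by auto
      next
        case 2
        then show ?thesis using e pregraphD[OF G]
          by (intro image_eqI[of _ _ "flip G e"]) auto
      qed
    qed (auto simp: type_mset_int_edge assms(1) int_edges_def)
  qed
  then show ?thesis by (simp add: num_edges_def bij_betw_same_card)
qed

text \<open>Both ends have type \<open>\<tau>\<close>, and distinct edges are disjoint.\<close>

lemma num_edges_unoriented:
  assumes "edge_mset j = {#\<tau>, \<tau>#}" "conj_type \<tau> = \<tau>"
  shows "card {e \<in> half_edges G. flip G e \<noteq> e \<and> he_type G e = \<tau>} = 2 * num_edges G j"
proof -
  let ?C = "{E \<in> int_edges G. type_mset G E = edge_mset j}"
  have U: "\<Union>?C = {e \<in> half_edges G. flip G e \<noteq> e \<and> he_type G e = \<tau>}"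
  proof (intro equalityI subsetI)
    fix x assume "x \<in> \<Union>?C"
    then obtain e where e: "e \<in> half_edges G" "flip G e \<noteq> e" "x \<in> {e, flip G e}"
      "type_mset G {e, flip G e} = edge_mset j" by (auto simp: int_edges_def)
    then have "he_type G e = \<tau>" by (auto simp: type_mset_int_edge assms(1) add_eq_conv_ex)
    have "he_type G (flip G e) = \<tau>" using conj[OF e(1,2)] \<open>he_type G e = \<tau>\<close> assms(2) by simp
    moreover have "flip G e \<in> half_edges G" "flip G (flip G e) \<noteq> flip G e"
      using e(1,2) pregraphD(6,8)[OF G e(1)] by simp_all
    ultimately show "x \<in> {e \<in> half_edges G. flip G e \<noteq> e \<and> he_type G e = \<tau>}"
      using e(1-3) \<open>he_type G e = \<tau>\<close> by blast
  next
    fix e assume "e \<in> {e \<in> half_edges G. flip G e \<noteq> e \<and> he_type G e = \<tau>}"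
    then have "{e, flip G e} \<in> ?C" by (auto simp: int_edges_def type_mset_int_edge assms)
    then show "e \<in> \<Union>?C" by blast
  qed
  have fin: "finite {e \<in> half_edges G. flip G e \<noteq> e \<and> he_type G e = \<tau>}"
    using pregraphD(1)[OF G] by simp
  have "2 * card ?C = card (\<Union>?C)"
  proof (rule card_partition)
    show "finite ?C" using fin by (intro finite_UnionD) (simp add: U)
    show "card c = 2" if "c \<in> ?C" for c using that by (auto simp: int_edges_def card_insert_if)
    show "c1 \<inter> c2 = {}" if "c1 \<in> ?C" "c2 \<in> ?C" "c1 \<noteq> c2" for c1 c2
    proof -
      obtain e1 e2 where e: "e1 \<in> half_edges G" "e2 \<in> half_edges G" "c1 = {e1, flip G e1}" "c2 = {e2, flip G e2}"
        using \<open>c1 \<in> ?C\<close> \<open>c2 \<in> ?C\<close> unfolding int_edges_def by blast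
      then show ?thesis using \<open>c1 \<noteq> c2\<close> pregraphD(8)[OF G, of e1] pregraphD(8)[OF G, of e2]
        by (auto simp: insert_commute)
    qed
  qed (use fin U in simp)
  then show ?thesis by (simp only: U num_edges_def)
qed

end

section \<open>Degrees and edge counts of 1PI graphs\<close>

definition ext_shift :: "ext_type \<Rightarrow> rat ^ vertex_type" where
  "ext_shift i = (case i of Inl j \<Rightarrow> axis j 1 | Inr _ \<Rightarrow> 0)"

text \<open>The vector \<open>u\<^sub>c\<close> of the introduction.\<close>

definition loop_vector :: "ext_type \<Rightarrow> fgraph \<Rightarrow> rat ^ vertex_type" where
  "loop_vector i G = vertex_vector G - ext_shift i"

text \<open>With a single component the structure vector is a unit vector; for edge types it meets
  one of the zero columns, which leaves \<open>ext_shift i\<close>.\<close>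

lemma graph_degree_one_PI:
  assumes "one_PI G" "type_mset G (ext_half_edges G) = ext_type_mset i"
  shows "graph_degree C G = C *v loop_vector i G"
proof -
  have S: "structure_vector G $ i' = (if i' = i then 1 else 0)" for i'
  proof -
    have "{K \<in> components G. type_mset K (ext_half_edges K) = ext_type_mset i'} = (if i' = i then {G} else {})"
      using assms by (auto simp: components_one_PI inj_ext_type_mset)
    then show ?thesis by (simp add: structure_vector_def num_components_def)
  qed
  have "zero_extend C *v structure_vector G = C *v ext_shift i"
    by (auto simp: vec_eq_iff matrix_vector_mult_def S zero_extend_def ext_shift_def axis_def
        mult_delta_right split: sum.split)
  then show ?thesis
    by (simp add: graph_degree_def loop_vector_def matrix_vector_mult_diff_distrib)
qed

text \<open>Double counting of quarks, ghosts and gluons: those at the vertices are the external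
  ones plus those on internal edges. For vertex types the external contribution is absorbed by the
  shift in \<open>loop_vector\<close>; for edge types it remains as a constant.\<close>

lemma num_edges_one_PI:
  assumes P: "one_PI G" and E: "type_mset G (ext_half_edges G) = ext_type_mset i"
  shows "rat_of_nat (num_edges G T5) = loop_vector i G $ T1 - (if i = Inr T5 then 1 else 0)"
    and "rat_of_nat (num_edges G T6) = loop_vector i G $ T2 - (if i = Inr T6 then 1 else 0)"
    and "2 * rat_of_nat (num_edges G T7) = loop_vector i G $ T1 + loop_vector i G $ T2 + 3 * loop_vector i G $ T3
      + 4 * loop_vector i G $ T4 - (if i = Inr T7 then 2 else 0)"
proof -
  have G: "pregraph G" and conj: "\<And>e. e \<in> half_edges G \<Longrightarrow> flip G e \<noteq> e \<Longrightarrow> conj_type (he_type G e) = he_type G (flip G e)"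
    and v: "\<And>v. v \<in> verts G \<Longrightarrow> \<exists>j. vertex_type_mset G v = vertex_mset j"
    using P by (auto simp: one_PI_def)
  note eq = half_edges_split[OF G] half_edges_by_vertices[OF G v] E UNIV_vertex_type
  have 5: "num_vertices G T1 = count (ext_type_mset i) Quark + num_edges G T5"
    using eq(1)[of Quark] eq(2)[of Quark] num_edges_oriented[OF G conj, of T5 Quark] by (simp add: E UNIV_vertex_type)
  have 6: "num_vertices G T2 = count (ext_type_mset i) Ghost + num_edges G T6"
    using eq(1)[of Ghost] eq(2)[of Ghost] num_edges_oriented[OF G conj, of T6 Ghost] by (simp add: E UNIV_vertex_type)
  have 7: "num_vertices G T1 + num_vertices G T2 + 3 * num_vertices G T3 + 4 * num_vertices G T4 =
      count (ext_type_mset i) Gluon + 2 * num_edges G T7"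
    using eq(1)[of Gluon] eq(2)[of Gluon] num_edges_unoriented[OF G conj, of T7 Gluon] by (simp add: E UNIV_vertex_type)
  have "vertex_vector G $ j = of_nat (num_vertices G j)" for j by (simp add: vertex_vector_def)
  note defs = loop_vector_def this ext_shift_def ext_type_mset_def axis_def
  have T: "i = Inl T1 \<or> i = Inl T2 \<or> i = Inl T3 \<or> i = Inl T4 \<or> i = Inr T5 \<or> i = Inr T6 \<or> i = Inr T7"
  proof (cases i)
    case (Inl a)
    then show ?thesis by (cases a) auto
  next
    case (Inr b)
    then show ?thesis by (cases b) auto
  qed
  show "rat_of_nat (num_edges G T5) = loop_vector i G $ T1 - (if i = Inr T5 then 1 else 0)"
    using T arg_cong[OF 5, of rat_of_nat] by (auto simp: defs)
  show "rat_of_nat (num_edges G T6) = loop_vector i G $ T2 - (if i = Inr T6 then 1 else 0)"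
    using T arg_cong[OF 6, of rat_of_nat] by (auto simp: defs)
  show "2 * rat_of_nat (num_edges G T7) = loop_vector i G $ T1 + loop_vector i G $ T2 + 3 * loop_vector i G $ T3
      + 4 * loop_vector i G $ T4 - (if i = Inr T7 then 2 else 0)"
    using T arg_cong[OF 7, of rat_of_nat] by (auto simp: defs)
qed

section \<open>Primitive graphs\<close>

text \<open>A one-element set has only one enumeration without repetition, so the choice in
  \<open>quotient_graph\<close> is forced.\<close>

lemma quotient_graph_single_component:
  assumes "components K = {K'}"
  shows "quotient_graph G K = contract G K'"
proof -
  have "(SOME Ks. distinct Ks \<and> set Ks = components K) = [K']"
  proof (rule some_equality)
    fix Ks assume "distinct Ks \<and> set Ks = components K"
    then have "distinct Ks" "set Ks = {K'}" using assms by auto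
    then have "length Ks = 1" using distinct_card[of Ks] by simp
    then show "Ks = [K']" using \<open>set Ks = {K'}\<close> by (cases Ks) auto
  qed (simp add: assms)
  then show ?thesis by (simp add: quotient_graph_def)
qed

lemma quotient_graph_empty: "quotient_graph G empty_graph = G"
proof -
  have "(SOME Ks. distinct Ks \<and> set Ks = components empty_graph) = []"
    by (rule some_equality) (auto simp: components_def empty_graph_def)
  then show ?thesis by (simp add: quotient_graph_def)
qed

lemma quotient_graph_self: "one_PI G \<Longrightarrow> quotient_graph G G = empty_graph"
  by (simp add: quotient_graph_single_component components_one_PI contract_def Let_def empty_graph_def one_PI_def
      pregraph_def) (auto simp: restrict_def)

lemma feynman_empty_graph: "feynman empty_graph"
  by (simp add: feynman_def pregraph_def components_def empty_graph_def)

lemma int_edges_subgraph: "subgraph K G \<Longrightarrow> int_edges K \<subseteq> int_edges G"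
  unfolding subgraph_def int_edges_def by (auto 4 4)

text \<open>No vertex is isolated, because every vertex type is a nonempty multiset.\<close>

lemma verts_eq_src_image:
  assumes "one_PI G"
  shows "verts G = src G ` half_edges G"
proof
  show "verts G \<subseteq> src G ` half_edges G"
  proof
    fix v assume "v \<in> verts G"
    then obtain j where "vertex_type_mset G v = vertex_mset j" using assms unfolding one_PI_def by blast
    then have "vertex_type_mset G v \<noteq> {#}" by (cases j) auto
    then have "{e \<in> half_edges G. src G e = v} \<noteq> {}"
      unfolding vertex_type_mset_def type_mset_def by (intro notI) simp
    then show "v \<in> src G ` half_edges G" by auto
  qed
  show "src G ` half_edges G \<subseteq> verts G"
    using assms by (auto simp: one_PI_def pregraph_def)
qed

lemma subgraph_self: "one_PI G \<Longrightarrow> subgraph G G"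
  using verts_eq_src_image[of G]
  by (auto simp: subgraph_def feynman_one_PI) (auto simp: one_PI_def pregraph_def PiE_def extensional_restrict)

lemma subgraph_empty: "subgraph empty_graph G"
  by (auto simp: subgraph_def feynman_empty_graph) (auto simp: empty_graph_def restrict_def)

lemma subgraph_verts:
  assumes "pregraph G" "subgraph K G"
  shows "verts K \<subseteq> verts G"
  using assms(2) pregraphD(7)[OF assms(1)] by (auto simp: subgraph_def)

lemma subgraph_no_verts:
  assumes "subgraph K G" "verts K = {}"
  shows "K = empty_graph"
proof -
  have K: "pregraph K" using assms by (simp add: subgraph_def feynman_def)
  then have H: "half_edges K = {}" using assms(2) pregraphD(7) by blast
  have "he_type K = (\<lambda>_. undefined)" "flip K = (\<lambda>_. undefined)" "src K = (\<lambda>_. undefined)"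
    using pregraphD(3,4,5)[OF K] by (simp_all add: H)
  then show ?thesis using H assms(2) by (cases K) (simp add: empty_graph_def)
qed

lemma subgraph_component:
  assumes K: "subgraph K G" and K': "K' \<in> components K"
  shows "subgraph K' G"
proof -
  have pK: "pregraph K" and fK: "feynman K" using K by (simp_all add: subgraph_def feynman_def)
  obtain v where v: "v \<in> verts K" "K' = induced K {u. reachable K (int_edges K) v u}"
    using K' by (auto simp: components_def)
  define W where "W = {u. reachable K (int_edges K) v u}"
  have W: "W \<subseteq> verts K" using reachable_verts[OF pK order.refl] v(1) by (auto simp: W_def)
  define H where "H = {e \<in> half_edges K. src K e \<in> W}"
  have K'_eq: "K' = \<lparr>half_edges = H, he_type = restrict (he_type K) H, verts = W,
      flip = restrict (flip K) H, src = restrict (src K) H\<rparr>"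
    by (simp add: v(2) induced_def Let_def H_def W_def)
  have HK: "H \<subseteq> half_edges K" "H \<subseteq> half_edges G" using K by (auto simp: H_def subgraph_def)
  have srcK: "src K e = src G e" if "e \<in> half_edges K" for e using K that by (simp add: subgraph_def)
  have tyK: "he_type K e = he_type G e" if "e \<in> half_edges K" for e using K that by (simp add: subgraph_def)
  have "W = src G ` H"
  proof
    show "W \<subseteq> src G ` H"
    proof
      fix w assume w: "w \<in> W"
      then obtain e where "e \<in> half_edges K" "w = src G e" using W K by (auto simp: subgraph_def)
      then show "w \<in> src G ` H" using w by (auto simp: H_def srcK)
    qed
  qed (auto simp: H_def srcK)
  moreover have "feynman K'" using fK K' feynman_one_PI by (auto simp: feynman_def)
  moreover have "restrict (he_type K) H = restrict (he_type G) H" "restrict (src K) H = restrict (src G) H"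
    using HK tyK srcK by (auto simp: restrict_def fun_eq_iff)
  moreover have "flip K e = e \<or> flip K e = flip G e" if "e \<in> H" for e
    using K that HK by (auto simp: subgraph_def)
  ultimately show ?thesis unfolding subgraph_def K'_eq using HK by simp
qed

text \<open>If \<open>K\<close> misses an external half-edge of \<open>G\<close>, that half-edge has no source in \<open>G/K\<close>.\<close>

lemma admissible_minimal:
  assumes G: "one_PI G"
    and minimal: "\<And>K. subgraph K G \<Longrightarrow> one_PI K \<Longrightarrow> verts K = verts G \<and> int_edges K = int_edges G"
    and K: "admissible K G" and ne: "K \<noteq> empty_graph"
  shows "K = G"
proof -
  have pG: "pregraph G" using G by (simp add: one_PI_def)
  have sub: "subgraph K G" and fq: "feynman (quotient_graph G K)" using K by (simp_all add: admissible_def)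
  then have fK: "feynman K" and pK: "pregraph K" by (simp_all add: subgraph_def feynman_def)
  obtain v where v: "v \<in> verts K" using subgraph_no_verts[OF sub] ne by blast
  \<comment> \<open>A component of \<open>K\<close> is a 1PI subgraph of \<open>G\<close>, so by
    minimality it already has all vertices, which leaves no room for a second component.\<close>
  define K' where "K' = induced K {u. reachable K (int_edges K) v u}"
  have K': "K' \<in> components K" using v by (auto simp: components_def K'_def)
  then have "one_PI K'" "subgraph K' G" using fK subgraph_component[OF sub] by (auto simp: feynman_def)
  then have "verts K' = verts G" using minimal by blast
  moreover have "verts K' \<subseteq> verts K"
    using reachable_verts[OF pK order.refl] v by (auto simp: K'_def induced_def Let_def)
  moreover have "verts K \<subseteq> verts G" by (rule subgraph_verts[OF pG sub])
  ultimately have VK: "verts K = verts G" "verts K' = verts K" by auto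
  then have "{u. reachable K (int_edges K) v u} = verts K" by (simp add: K'_def induced_def Let_def)
  then have "K' = K" by (simp add: K'_def induced_verts[OF pK])
  then have oneK: "one_PI K" using \<open>one_PI K'\<close> by simp
  then have IK: "int_edges K = int_edges G" using minimal[OF sub] by blast
  have srcG: "src G h \<in> verts G" if "h \<in> half_edges G" for h using pregraphD(7)[OF pG that] .
  show "K = G"
  proof (cases "half_edges K = half_edges G")
    case True
    have "flip K e = flip G e" for e
    proof (cases "e \<in> half_edges G")
      case e: True
      show ?thesis
      proof (cases "flip G e = e")
        case True
        then show ?thesis using sub e \<open>half_edges K = half_edges G\<close> by (auto simp: subgraph_def)
      next
        case False
        then have "{e, flip G e} \<in> int_edges G"
          unfolding int_edges_def using e by (intro CollectI exI[of _ e]) simp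
        then have "{e, flip G e} \<in> int_edges K" by (simp only: IK)
        from int_edges_pair(3)[OF pK this] show ?thesis by simp
      qed
    next
      case False
      then show ?thesis using True pregraphD(4)[OF pK] pregraphD(4)[OF pG]
        by (simp add: PiE_def extensional_def)
    qed
    then have "flip K = flip G" by blast
    moreover have "he_type K = he_type G" "src K = src G"
      using sub True pregraphD(3,5)[OF pG] by (auto simp: subgraph_def PiE_def extensional_restrict)
    ultimately show ?thesis using True VK(1) by (cases K; cases G) simp
  next
    case False
    then obtain h where h: "h \<in> half_edges G" "h \<notin> half_edges K" using sub by (auto simp: subgraph_def)
    have "quotient_graph G K = contract G K"
      by (rule quotient_graph_single_component[OF components_one_PI[OF oneK]])
    then have pq: "pregraph (contract G K)" using fq feynman_pregraph by simp
    have "K \<noteq> G" using False by auto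
    then have "K \<notin> components G" by (simp add: components_one_PI[OF G])
    \<comment> \<open>The vertex created by a contraction of vertex type. Being fresh, it cannot
      serve as the source of the omitted half-edge \<open>h\<close>.\<close>
    define w where "w = (LEAST n. n \<notin> verts G \<union> src G ` half_edges G)"
    have "finite (verts G \<union> src G ` half_edges G)" using pregraphD(1,2)[OF pG] by simp
    then obtain n where "n \<notin> verts G \<union> src G ` half_edges G" using infinite_UNIV_nat ex_new_if_finite by blast
    then have "w \<notin> verts G \<union> src G ` half_edges G" unfolding w_def by (rule LeastI)
    then have w: "w \<notin> verts G" by simp
    show ?thesis
    proof (cases "\<exists>j. type_mset K (ext_half_edges K) = vertex_mset j")
      case True
      have "h \<notin> ext_half_edges K" using h by (simp add: ext_half_edges_def)
      then have "h \<in> half_edges (contract G K)" "src (contract G K) h = src G h" "verts (contract G K) = {w}"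
        using True h VK \<open>K \<notin> components G\<close> by (simp_all add: contract_def Let_def w_def)
      then show ?thesis using pregraphD(7)[OF pq] srcG[OF h(1)] w by (metis singletonD)
    next
      case no: False
      have "h \<in> half_edges (contract G K)" "verts (contract G K) = {}"
        using no h VK \<open>K \<notin> components G\<close> by (simp_all add: contract_def Let_def)
      then show ?thesis using pregraphD(7)[OF pq] by blast
    qed
  qed
qed

text \<open>The hypothesis concerns vertices and internal edges only, since a subgraph may still
  omit external legs: a four-gluon vertex without one leg is a three-gluon vertex. Such subgraphs
  are excluded by admissibility.\<close>

lemma primitive_minimal:
  assumes G: "one_PI G"
    and minimal: "\<And>K. subgraph K G \<Longrightarrow> one_PI K \<Longrightarrow> verts K = verts G \<and> int_edges K = int_edges G"
  shows "primitive TYPE('k::field_char_0) G"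
proof -
  have "admissible G G"
    by (simp add: admissible_def subgraph_self G quotient_graph_self feynman_empty_graph)
  moreover have "admissible empty_graph G"
    by (simp add: admissible_def subgraph_empty quotient_graph_empty feynman_one_PI G)
  ultimately have A: "{K. admissible K G} = {G, empty_graph}"
    using admissible_minimal[OF G minimal] by blast
  have "G \<noteq> empty_graph" using G by (auto simp: one_PI_def empty_graph_def)
  then show ?thesis
    by (simp add: primitive_def graph_coproduct_def A quotient_graph_self G quotient_graph_empty)
qed

section \<open>Explicit one-loop graphs\<close>

definition leg_graph :: "(half_edge_type \<times> nat) list \<Rightarrow> nat set \<Rightarrow> (nat \<Rightarrow> nat) \<Rightarrow> fgraph" where
  "leg_graph P V \<phi> = \<lparr>half_edges = {..<length P}, he_type = restrict (\<lambda>e. fst (P ! e)) {..<length P},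
     verts = V, flip = restrict \<phi> {..<length P}, src = restrict (\<lambda>e. snd (P ! e)) {..<length P}\<rparr>"

lemma leg_graph_simps [simp]:
  "half_edges (leg_graph P V \<phi>) = {..<length P}" "verts (leg_graph P V \<phi>) = V"
  "e < length P \<Longrightarrow> he_type (leg_graph P V \<phi>) e = fst (P ! e)"
  "e < length P \<Longrightarrow> flip (leg_graph P V \<phi>) e = \<phi> e"
  "e < length P \<Longrightarrow> src (leg_graph P V \<phi>) e = snd (P ! e)"
  by (simp_all add: leg_graph_def)

lemma pregraph_leg_graph:
  assumes "finite V" "snd ` set P \<subseteq> V" "\<And>e. e < length P \<Longrightarrow> \<phi> e < length P \<and> \<phi> (\<phi> e) = e"
  shows "pregraph (leg_graph P V \<phi>)"
proof -
  have "snd (P ! e) \<in> V" if "e < length P" for e using assms(2) nth_mem[OF that] by blast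
  then show ?thesis using assms by (auto simp: pregraph_def) (auto simp: leg_graph_def split: if_splits)
qed

lemma type_mset_leg_graph:
  "type_mset (leg_graph P V \<phi>) {e \<in> {..<length P}. Q e} = mset (map (\<lambda>e. fst (P ! e)) (filter Q [0..<length P]))"
proof -
  have "{e \<in> {..<length P}. Q e} = set (filter Q [0..<length P])" by auto
  then have *: "mset_set {e \<in> {..<length P}. Q e} = mset (filter Q [0..<length P])"
    by (simp only: mset_set_set distinct_filter distinct_upt)
  have "type_mset (leg_graph P V \<phi>) {e \<in> {..<length P}. Q e} =
      image_mset (he_type (leg_graph P V \<phi>)) (mset (filter Q [0..<length P]))"
    unfolding type_mset_def * ..
  also have "\<dots> = mset (map (\<lambda>e. fst (P ! e)) (filter Q [0..<length P]))"
    unfolding mset_map[symmetric] by (intro arg_cong[of _ _ mset] map_cong) auto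
  finally show ?thesis .
qed

text \<open>Turns the vertex condition into the evaluation of a concrete list of pairs of type and
  source.\<close>

lemma vertex_type_mset_leg_graph:
  "vertex_type_mset (leg_graph P V \<phi>) v = mset (map fst (filter (\<lambda>p. snd p = v) P))"
proof -
  have "{e \<in> half_edges (leg_graph P V \<phi>). src (leg_graph P V \<phi>) e = v} = {e \<in> {..<length P}. snd (P ! e) = v}"
    by auto
  then have "vertex_type_mset (leg_graph P V \<phi>) v = mset (map (\<lambda>e. fst (P ! e)) (filter (\<lambda>e. snd (P ! e) = v) [0..<length P]))"
    unfolding vertex_type_mset_def by (simp only: type_mset_leg_graph)
  also have "map (\<lambda>e. fst (P ! e)) (filter (\<lambda>e. snd (P ! e) = v) [0..<length P]) =
      map fst (filter (\<lambda>p. snd p = v) (map (nth P) [0..<length P]))"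
    by (simp add: filter_map comp_def)
  finally show ?thesis by (simp add: map_nth)
qed

lemma type_mset_ext_leg_graph:
  "type_mset (leg_graph P V \<phi>) (ext_half_edges (leg_graph P V \<phi>)) =
    mset (map (\<lambda>e. fst (P ! e)) (filter (\<lambda>e. \<phi> e = e) [0..<length P]))"
proof -
  have "ext_half_edges (leg_graph P V \<phi>) = {e \<in> {..<length P}. \<phi> e = e}"
    by (auto simp: ext_half_edges_def)
  then show ?thesis by (simp only: type_mset_leg_graph)
qed

lemma connected_two_vertices:
  assumes "verts G = {u, v}" "{a, b} \<in> E" "src G a = u" "src G b = v"
  shows "connected_graph G E"
proof -
  let ?R = "{(src G a, src G b) |a b. {a, b} \<in> E}"
  have "{b, a} \<in> E" using assms(2) by (simp add: insert_commute)
  then have "(src G a, src G b) \<in> ?R" "(src G b, src G a) \<in> ?R"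
    using assms(2) by blast+
  then have "(u, v) \<in> ?R\<^sup>*" "(v, u) \<in> ?R\<^sup>*"
    unfolding assms(3,4) by (simp_all only: r_into_rtrancl)
  then show ?thesis
    unfolding connected_graph_def reachable_def assms(1) by (simp del: mem_Collect_eq)
qed

text \<open>Two vertices joined by two edges. Half-edges 0 and 1 leave vertex 0 and are paired with
  2 and 3 at vertex 1; \<open>L\<close> lists the external legs from position 4 on.\<close>

definition bubble :: "half_edge_type \<Rightarrow> half_edge_type \<Rightarrow> (half_edge_type \<times> nat) list \<Rightarrow> fgraph" where
  "bubble a b L = leg_graph ((a, 0) # (b, 0) # (conj_type a, 1) # (conj_type b, 1) # L) {0, 1}
     (\<lambda>e. if e < 2 then e + 2 else if e < 4 then e - 2 else e)"

lemma conj_conj_type [simp]: "conj_type (conj_type a) = a"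
  by (cases a) auto

text \<open>A 1PI subgraph contains an edge, hence both vertices; a single edge between them would
  be a bridge, so it contains both edges. Thus the bubble is minimal.\<close>

lemma bubble_primitive:
  fixes a b L i j0 j1
  defines "P \<equiv> (a, 0) # (b, 0) # (conj_type a, 1) # (conj_type b, 1) # L"
  assumes L: "snd ` set L \<subseteq> {0, 1}"
    and v0: "mset (map fst (filter (\<lambda>p. snd p = 0) P)) = vertex_mset j0"
    and v1: "mset (map fst (filter (\<lambda>p. snd p = 1) P)) = vertex_mset j1"
    and ext: "mset (map fst L) = ext_type_mset i"
  shows "one_PI (bubble a b L)"
    and "type_mset (bubble a b L) (ext_half_edges (bubble a b L)) = ext_type_mset i"
    and "primitive TYPE('k::field_char_0) (bubble a b L)"
    and "num_vertices (bubble a b L) j = (if j = j0 then 1 else 0) + (if j = j1 then 1 else 0)"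
proof -
  define \<phi> :: "nat \<Rightarrow> nat" where "\<phi> = (\<lambda>e. if e < 2 then e + 2 else if e < 4 then e - 2 else e)"
  let ?G = "bubble a b L"
  have G: "?G = leg_graph P {0, 1} \<phi>" by (simp add: bubble_def P_def \<phi>_def)
  have len: "length P = 4 + length L" by (simp add: P_def)
  have pre: "pregraph ?G"
    unfolding G by (rule pregraph_leg_graph) (use L in \<open>auto simp: \<phi>_def len P_def\<close>)
  have small: "e = 0 \<or> e = 1 \<or> e = 2 \<or> e = 3" if "e < 4" for e :: nat using that by auto
  have int: "int_edges ?G = {{0, 2}, {1, 3}}"
  proof (intro equalityI subsetI)
    fix E assume "E \<in> int_edges ?G"
    then obtain e where e: "e < length P" "\<phi> e \<noteq> e" "E = {e, \<phi> e}" by (auto simp: int_edges_def G)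
    then have "e < 4" by (auto simp: \<phi>_def split: if_splits)
    then show "E \<in> {{0, 2}, {1, 3}}" using small[of e] e(3) by (auto simp: \<phi>_def)
  next
    fix E assume "E \<in> {{0, 2}, {1, 3 :: nat}}"
    then have "E = {0, \<phi> 0} \<or> E = {1, \<phi> 1}" by (auto simp: \<phi>_def)
    then show "E \<in> int_edges ?G"
    proof
      assume "E = {0, \<phi> 0}"
      then show ?thesis unfolding int_edges_def G by (intro CollectI exI[of _ 0]) (simp add: len, simp add: \<phi>_def)
    next
      assume "E = {1, \<phi> 1}"
      then show ?thesis unfolding int_edges_def G by (intro CollectI exI[of _ 1]) (simp add: len, simp add: \<phi>_def)
    qed
  qed
  have verts: "verts ?G = {0, 1}" by (simp add: G)
  have src: "src ?G 0 = 0" "src ?G 1 = 0" "src ?G 2 = 1" "src ?G 3 = 1"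
    using len by (simp_all add: G P_def)
  have conn: "connected_graph ?G E" if "{0, 2} \<in> E \<or> {1, 3} \<in> E" for E
    using that connected_two_vertices[OF verts, of 0 2 E] connected_two_vertices[OF verts, of 1 3 E] src by blast
  have vt: "vertex_type_mset ?G 0 = vertex_mset j0" "vertex_type_mset ?G 1 = vertex_mset j1"
    using v0 v1 by (simp_all add: G vertex_type_mset_leg_graph)
  have ne: "{0, 2} \<noteq> {1, 3 :: nat}" by (simp add: doubleton_eq_iff)
  have upt: "[0..<length P] = 0 # 1 # 2 # 3 # map ((+) 4) [0..<length L]"
    by (rule nth_equalityI) (auto simp: len nth_Cons' add.commute)
  show e: "type_mset ?G (ext_half_edges ?G) = ext_type_mset i"
  proof -
    have "filter (\<lambda>e. \<phi> e = e) (map ((+) 4) [0..<length L]) = map ((+) 4) [0..<length L]"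
      by (simp add: filter_id_conv \<phi>_def)
    then have "filter (\<lambda>e. \<phi> e = e) [0..<length P] = map ((+) 4) [0..<length L]"
      by (simp add: upt) (simp add: \<phi>_def)
    moreover have "map (\<lambda>e. fst (P ! e)) (map ((+) 4) [0..<length L]) = map fst L"
      by (rule nth_equalityI) (auto simp: P_def)
    ultimately have "type_mset ?G (ext_half_edges ?G) = mset (map fst L)"
      unfolding G type_mset_ext_leg_graph by metis
    then show ?thesis by (simp only: ext)
  qed
  have conj: "conj_type (he_type ?G e) = he_type ?G (flip ?G e)" if e: "e \<in> half_edges ?G" "flip ?G e \<noteq> e" for e
  proof -
    have e': "e < length P" "\<phi> e \<noteq> e" using e by (auto simp: G)
    then have "e < 4" by (auto simp: \<phi>_def split: if_splits)
    then show ?thesis using small[of e] e' by (auto simp: G len \<phi>_def) (auto simp: P_def)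
  qed
  show one: "one_PI ?G"
    unfolding one_PI_def
  proof (intro conjI ballI impI)
    show "half_edges ?G \<noteq> {}" "verts ?G \<noteq> {}" by (simp_all add: G len lessThan_empty_iff)
    show "\<exists>j. vertex_type_mset ?G v = vertex_mset j" if "v \<in> verts ?G" for v
      using that vt by (auto simp: verts)
    show "connected_graph ?G (int_edges ?G - {E})" for E
    proof (rule conn)
      have "A \<in> {A, B} - {E} \<or> B \<in> {A, B} - {E}" if "A \<noteq> B" for A B :: "nat set" using that by auto
      from this[OF ne] show "{0, 2} \<in> int_edges ?G - {E} \<or> {1, 3} \<in> int_edges ?G - {E}" unfolding int .
    qed
    show "connected_graph ?G (int_edges ?G)" by (rule conn) (simp add: int)
    show "\<exists>i. type_mset ?G (ext_half_edges ?G) = ext_type_mset i" using e by blast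
  qed (use pre conj int in auto)
  have "{v \<in> {0, 1}. Q v} = (if Q 0 then {0} else {}) \<union> (if Q 1 then {1} else {})" for Q :: "nat \<Rightarrow> bool"
  proof (rule set_eqI)
    fix x :: nat
    consider "x = 0" | "x = 1" | "x \<noteq> 0" "x \<noteq> 1" by blast
    then show "x \<in> {v \<in> {0, 1}. Q v} \<longleftrightarrow> x \<in> (if Q 0 then {0} else {}) \<union> (if Q 1 then {1} else {})"
      by cases simp_all
  qed
  then have "{v \<in> verts ?G. vertex_type_mset ?G v = vertex_mset j} = (if j = j0 then {0} else {}) \<union> (if j = j1 then {1} else {})"
    unfolding verts by (simp only: vt inj_vertex_mset eq_commute[of j])
  then show "num_vertices ?G j = (if j = j0 then 1 else 0) + (if j = j1 then 1 else 0)"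
    by (simp add: num_vertices_def)
  show "primitive TYPE('k) ?G"
  proof (rule primitive_minimal[OF one])
    fix K assume K: "subgraph K ?G" "one_PI K"
    have pK: "pregraph K" using K(2) by (simp add: one_PI_def)
    have sub: "int_edges K \<subseteq> {{0, 2}, {1, 3}}" using int_edges_subgraph[OF K(1)] by (simp add: int)
    have vK: "src ?G e \<in> verts K" if "e \<in> half_edges K" for e
      using K(1) that by (auto simp: subgraph_def)
    obtain E where E: "E \<in> int_edges K" using K(2) by (auto simp: one_PI_def)
    then have "{0, 2} \<in> int_edges K \<or> {1, 3} \<in> int_edges K" using sub by blast
    then have "0 \<in> verts K \<and> 1 \<in> verts K"
    proof
      assume "{0, 2} \<in> int_edges K"
      from int_edges_pair(1,2)[OF pK this] show ?thesis using vK[of 0] vK[of 2] src by simp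
    next
      assume "{1, 3} \<in> int_edges K"
      from int_edges_pair(1,2)[OF pK this] show ?thesis using vK[of 1] vK[of 3] src by simp
    qed
    moreover have "verts K \<subseteq> {0, 1}" using subgraph_verts[OF pre K(1)] by (simp only: verts)
    ultimately have V: "verts K = {0, 1}" by blast
    have nonempty: "int_edges K - {E'} \<noteq> {}" if "E' \<in> int_edges K" for E'
    proof
      assume 0: "int_edges K - {E'} = {}"
      have "connected_graph K (int_edges K - {E'})" using K(2) that by (simp add: one_PI_def)
      then have "reachable K {} 0 1" using V by (simp add: connected_graph_def 0)
      then show False by (simp add: reachable_def)
    qed
    have two: "I = {A, B}" if "I \<subseteq> {A, B}" "E \<in> I" "\<And>E. E \<in> I \<Longrightarrow> I - {E} \<noteq> {}" for A B and I :: "nat set set"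
      using that(1,2) that(3)[of A] that(3)[of B] by auto
    have "int_edges K = {{0, 2}, {1, 3}}" by (rule two[OF sub E nonempty])
    then show "verts K = verts ?G \<and> int_edges K = int_edges ?G"
      by (simp only: V verts int)
  qed
qed

text \<open>Half-edges 0 and 1 form a loop at the only vertex, and 2 and 3 are external.\<close>

definition tadpole :: fgraph where
  "tadpole = leg_graph [(Gluon, 0), (Gluon, 0), (Gluon, 0), (Gluon, 0)] {0} (\<lambda>e. if e < 2 then 1 - e else e)"

lemma tadpole_primitive:
  shows "one_PI tadpole"
    and "type_mset tadpole (ext_half_edges tadpole) = ext_type_mset (Inr T7)"
    and "primitive TYPE('k::field_char_0) tadpole"
    and "num_vertices tadpole j = (if j = T4 then 1 else 0)"
proof -
  define P where "P = [(Gluon, 0 :: nat), (Gluon, 0), (Gluon, 0), (Gluon, 0)]"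
  define \<phi> :: "nat \<Rightarrow> nat" where "\<phi> = (\<lambda>e. if e < 2 then 1 - e else e)"
  let ?G = "tadpole"
  have G: "?G = leg_graph P {0} \<phi>" by (simp add: tadpole_def P_def \<phi>_def)
  have len: "length P = 4" by (simp add: P_def)
  have small: "e = 0 \<or> e = 1 \<or> e = 2 \<or> e = 3" if "e < 4" for e :: nat using that by auto
  have Pe: "P ! e = (Gluon, 0)" if "e < 4" for e using small[OF that] by (auto simp: P_def)
  have pre: "pregraph ?G"
    unfolding G by (rule pregraph_leg_graph) (auto simp: \<phi>_def len, auto simp: P_def)
  have int: "int_edges ?G = {{0, 1}}"
  proof (intro equalityI subsetI)
    fix E assume "E \<in> int_edges ?G"
    then obtain e where e: "e < length P" "\<phi> e \<noteq> e" "E = {e, \<phi> e}" by (auto simp: int_edges_def G)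
    then have "e = 0 \<or> e = 1" by (auto simp: \<phi>_def split: if_splits)
    then show "E \<in> {{0, 1}}" using e(3) by (auto simp: \<phi>_def)
  next
    fix E assume "E \<in> {{0, 1 :: nat}}"
    then have "E = {0, \<phi> 0}" by (simp add: \<phi>_def)
    then show "E \<in> int_edges ?G"
      unfolding int_edges_def G by (intro CollectI exI[of _ 0]) (simp add: len, simp add: \<phi>_def)
  qed
  have verts: "verts ?G = {0}" by (simp add: G)
  have vt: "vertex_type_mset ?G 0 = vertex_mset T4"
    by (simp add: G vertex_type_mset_leg_graph P_def)
  show e: "type_mset ?G (ext_half_edges ?G) = ext_type_mset (Inr T7)"
    unfolding G type_mset_ext_leg_graph len
    by (simp add: upt_rec[of _ 4] \<phi>_def Pe ext_type_mset_def)
  show one: "one_PI ?G"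
    unfolding one_PI_def
  proof (intro conjI ballI impI)
    show "half_edges ?G \<noteq> {}" "verts ?G \<noteq> {}" by (simp_all add: G len lessThan_empty_iff)
    show "conj_type (he_type ?G e) = he_type ?G (flip ?G e)" if e: "e \<in> half_edges ?G" for e
      using e by (auto simp: G len Pe \<phi>_def)
    show "\<exists>j. vertex_type_mset ?G v = vertex_mset j" if "v \<in> verts ?G" for v
      using that vt unfolding verts by blast
    show "connected_graph ?G (int_edges ?G)" "connected_graph ?G (int_edges ?G - {E})" for E
      by (simp_all add: connected_graph_def verts reachable_refl)
    show "\<exists>i. type_mset ?G (ext_half_edges ?G) = ext_type_mset i" using e by blast
  qed (use pre int in auto)
  have "{v \<in> {0}. Q v} = (if Q 0 then {0} else {})" for Q :: "nat \<Rightarrow> bool"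
    by (auto split: if_splits)
  then have "{v \<in> verts ?G. vertex_type_mset ?G v = vertex_mset j} = (if j = T4 then {0} else {})"
    unfolding verts by (simp only: vt inj_vertex_mset eq_commute[of j])
  then show "num_vertices ?G j = (if j = T4 then 1 else 0)"
    by (simp add: num_vertices_def)
  show "primitive TYPE('k) ?G"
  proof (rule primitive_minimal[OF one])
    fix K assume K: "subgraph K ?G" "one_PI K"
    have "int_edges K \<subseteq> {{0, 1}}" using int_edges_subgraph[OF K(1)] by (simp add: int)
    moreover have "int_edges K \<noteq> {}" "verts K \<noteq> {}" using K(2) by (auto simp: one_PI_def)
    moreover have "verts K \<subseteq> {0}" using subgraph_verts[OF pre K(1)] by (simp only: verts)
    ultimately show "verts K = verts ?G \<and> int_edges K = int_edges ?G" unfolding verts int by blast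
  qed
qed

section \<open>Integer powers of invertible series\<close>

definition unit_power :: "('a, 'k::field) mset_series \<Rightarrow> int \<Rightarrow> ('a, 'k) mset_series" where
  "unit_power f k = f ^ nat k * series_inverse f ^ nat (- k)"

lemma series_inverse_unit: "coeff f {#} = 1 \<Longrightarrow> f * series_inverse f = 1"
  using series_inverse[of "1 - f"] by (simp add: coeff_simps)

lemma coeff_series_inverse_empty: "coeff f {#} = 1 \<Longrightarrow> coeff (series_inverse f) {#} = 1"
  using arg_cong[OF series_inverse_unit[of f], of "\<lambda>h. coeff h {#}"] by (simp add: coeff_simps(2))

text \<open>Frees \<open>unit_power\<close> from the case distinction on the sign: any
  representation of the exponent as a difference may be used.\<close>

lemma unit_power_diff:
  assumes "coeff f {#} = 1"
  shows "unit_power f (int m - int n) = f ^ m * series_inverse f ^ n"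
proof -
  let ?g = "series_inverse f"
  have 1: "f ^ k * ?g ^ k = 1" for k
    by (simp add: series_inverse_unit[OF assms] flip: power_mult_distrib)
  consider d where "m = n + d" | d where "n = m + d" by (metis le_iff_add nat_le_linear)
  then show ?thesis
  proof cases
    case 1
    have "f ^ m * ?g ^ n = f ^ d * (f ^ n * ?g ^ n)" by (simp add: 1 power_add ac_simps)
    then show ?thesis by (simp add: 1 \<open>f ^ n * ?g ^ n = 1\<close> unit_power_def)
  next
    case 2
    have "f ^ m * ?g ^ n = (f ^ m * ?g ^ m) * ?g ^ d" by (simp add: 2 power_add ac_simps)
    then show ?thesis by (simp add: 2 \<open>f ^ m * ?g ^ m = 1\<close> unit_power_def)
  qed
qed

lemma unit_power_add:
  assumes "coeff f {#} = 1"
  shows "unit_power f (a + b) = unit_power f a * unit_power f b"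
proof -
  obtain m n where a: "a = int m - int n" by (rule int_diff_cases)
  obtain m' n' where b: "b = int m' - int n'" by (rule int_diff_cases)
  have "a + b = int (m + m') - int (n + n')" by (simp add: a b)
  then have "unit_power f (a + b) = f ^ (m + m') * series_inverse f ^ (n + n')"
    by (simp only: unit_power_diff[OF assms])
  then show ?thesis by (simp add: a b unit_power_diff[OF assms] power_add ac_simps)
qed

lemma unit_power_0 [simp]: "unit_power f 0 = 1"
  and unit_power_1: "unit_power f 1 = f"
  and unit_power_of_nat: "unit_power f (int k) = f ^ k"
  and unit_power_minus_of_nat: "unit_power f (- int k) = series_inverse f ^ k"
  by (simp_all add: unit_power_def)

lemma coeff_power_empty: "coeff f {#} = 1 \<Longrightarrow> coeff (f ^ n) {#} = 1"
  by (induction n) (auto simp: coeff_simps)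

lemma coeff_unit_power_empty: "coeff f {#} = 1 \<Longrightarrow> coeff (unit_power f k) {#} = 1"
  by (simp add: unit_power_def coeff_power_empty coeff_series_inverse_empty)

lemma splits_single: "splits {#v#} = {({#}, {#v#}), ({#v#}, {#})}"
  by (auto simp: union_is_single)

lemma coeff_mult_single: "coeff (f * g) {#v#} = coeff f {#} * coeff g {#v#} + coeff f {#v#} * coeff g {#}"
  unfolding coeff_mult splits_single by simp

text \<open>On series with constant coefficient 1, a linear coefficient is a logarithm.\<close>

lemma coeff_power_single: "coeff f {#} = 1 \<Longrightarrow> coeff (f ^ n) {#v#} = of_nat n * coeff f {#v#}"
  by (induction n) (auto simp: coeff_simps coeff_mult_single coeff_power_empty algebra_simps)

lemma coeff_unit_power_single:
  fixes f :: "('a, 'k::field) mset_series"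
  assumes f: "coeff f {#} = 1"
  shows "coeff (unit_power f k) {#v#} = of_int k * coeff f {#v#}"
proof -
  have "coeff (f * series_inverse f) {#v#} = 0" by (simp only: series_inverse_unit[OF f]) (simp add: coeff_simps)
  then have i: "coeff (series_inverse f) {#v#} = - coeff f {#v#}"
    by (simp add: coeff_mult_single f coeff_series_inverse_empty eq_neg_iff_add_eq_0)
  have "coeff (unit_power f k) {#v#} = (of_nat (nat k) - of_nat (nat (- k))) * coeff f {#v#}"
    by (simp add: unit_power_def coeff_mult_single coeff_power_single coeff_power_empty f
        coeff_series_inverse_empty i algebra_simps)
  also have "(of_nat (nat k) - of_nat (nat (- k)) :: 'k) = of_int k"
    by (cases "k \<ge> 0") auto
  finally show ?thesis .
qed

lemma coeff_prod_single:
  assumes "finite I" "\<And>i. i \<in> I \<Longrightarrow> coeff (f i) {#} = 1"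
  shows "coeff (\<Prod>i\<in>I. f i) {#} = 1 \<and> coeff (\<Prod>i\<in>I. f i) {#v#} = (\<Sum>i\<in>I. coeff (f i) {#v#})"
  using assms by (induction I rule: finite_induct) (auto simp: coeff_simps coeff_mult_single)

section \<open>The system of QCD\<close>

definition ext_of :: "graph_class \<Rightarrow> ext_type" where
  "ext_of c = (SOME i. type_mset (class_rep c) (ext_half_edges (class_rep c)) = ext_type_mset i)"

definition class_vector :: "graph_class \<Rightarrow> rat ^ vertex_type" where
  "class_vector c = loop_vector (ext_of c) (class_rep c)"

text \<open>The right-hand side of the equation of index \<open>i\<close> at \<open>c\<close> is \<open>X i\<close> times the product of the powers of the
  \<open>X j\<close> with these exponents, where \<open>X j = 1 + Y j\<close> for vertex types and \<open>X j = 1 - Y j\<close> for edge types.\<close>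

definition class_exponent :: "graph_class \<Rightarrow> ext_type \<Rightarrow> int" where
  "class_exponent c i = (case i of Inl j \<Rightarrow> int (num_vertices (class_rep c) j) | Inr j \<Rightarrow> - int (num_edges (class_rep c) j))
     - (if i = ext_of c then 1 else 0)"

text \<open>The last clause returns from the representative to a graph whose class is
  \<open>c\<close>, the form in which the finiteness condition of the graduation is stated.\<close>

lemma prim_graphsD:
  assumes "c \<in> prim_graphs K i"
  shows "one_PI (class_rep c)" "type_mset (class_rep c) (ext_half_edges (class_rep c)) = ext_type_mset i" "ext_of c = i"
    and "class_degree C c = C *v class_vector c"
    and "\<exists>G. feynman G \<and> c = iso_class G \<and> graph_degree C G = class_degree C c"
proof -
  obtain G where G: "c = iso_class G" "one_PI G" "type_mset G (ext_half_edges G) = ext_type_mset i"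
    using assms by (auto simp: prim_graphs_def)
  note r = class_rep_prim_graphs[OF G(2,3), folded G(1)]
  show 1: "one_PI (class_rep c)" "type_mset (class_rep c) (ext_half_edges (class_rep c)) = ext_type_mset i"
    by (rule r)+
  show 2: "ext_of c = i" using 1(2) by (simp add: ext_of_def inj_ext_type_mset)
  show 3: "class_degree C c = C *v class_vector c"
    using graph_degree_one_PI[OF 1] by (simp add: class_degree_def class_vector_def 2)
  have "loop_vector i G = class_vector c"
    by (simp add: class_vector_def 2 loop_vector_def vertex_vector_def r(3))
  then have "graph_degree C G = class_degree C c" by (simp add: 3 graph_degree_one_PI[OF G(2,3)])
  then show "\<exists>G. feynman G \<and> c = iso_class G \<and> graph_degree C G = class_degree C c"
    using G feynman_one_PI by blast
qed

text \<open>The 1 subtracted at the own type of \<open>c\<close> cancels the constant left by the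
  external legs in the edge counts, so no constant term remains and the formulas can be summed over
  a forest.\<close>

lemma class_exponent_eq:
  assumes "c \<in> prim_graphs K i"
  shows "rat_of_int (class_exponent c (Inl j)) = class_vector c $ j"
    and "rat_of_int (class_exponent c (Inr T5)) = - class_vector c $ T1"
    and "rat_of_int (class_exponent c (Inr T6)) = - class_vector c $ T2"
    and "2 * rat_of_int (class_exponent c (Inr T7)) =
      - (class_vector c $ T1 + class_vector c $ T2 + 3 * class_vector c $ T3 + 4 * class_vector c $ T4)"
proof -
  note P = prim_graphsD[OF assms]
  note e = num_edges_one_PI[OF P(1,2), folded class_vector_def[of c, unfolded P(3)]]
  show "rat_of_int (class_exponent c (Inl j)) = class_vector c $ j"
    by (auto simp: class_exponent_def class_vector_def loop_vector_def vertex_vector_def ext_shift_def P(3)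
      axis_def split: sum.split)
  show "rat_of_int (class_exponent c (Inr T5)) = - class_vector c $ T1"
    using e(1) by (simp add: class_exponent_def P(3) split: if_splits)
  show "rat_of_int (class_exponent c (Inr T6)) = - class_vector c $ T2"
    using e(2) by (simp add: class_exponent_def P(3) split: if_splits)
  show "2 * rat_of_int (class_exponent c (Inr T7)) =
      - (class_vector c $ T1 + class_vector c $ T2 + 3 * class_vector c $ T3 + 4 * class_vector c $ T4)"
    using e(3) by (simp add: class_exponent_def P(3) algebra_simps split: if_splits)
qed

lemma prod_UNIV_ext_type: "(\<Prod>i\<in>(UNIV :: ext_type set). f i) = (\<Prod>j\<in>UNIV. f (Inl j)) * (\<Prod>j\<in>UNIV. f (Inr j))"
  using prod.Plus[of "UNIV :: vertex_type set" "UNIV :: edge_type set" f] by (simp add: comp_def)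

locale qcd_sdse =
  fixes C :: "rat ^ vertex_type ^ 'n"
    and Y :: "ext_type \<Rightarrow> (graph_class dtree, 'k::field_char_0) mset_series"
  assumes graduation: "connected_graduation C" and solves: "solves_sdse Y"
begin

definition sgn_type :: "ext_type \<Rightarrow> 'k" where
  "sgn_type i = (case i of Inl _ \<Rightarrow> 1 | Inr _ \<Rightarrow> - 1)"

definition X :: "ext_type \<Rightarrow> (graph_class dtree, 'k) mset_series" where
  "X i = 1 + const_series (sgn_type i) * Y i"

definition M :: "graph_class \<Rightarrow> (graph_class dtree, 'k) mset_series" where
  "M c = (\<Prod>i\<in>UNIV. unit_power (X i) (class_exponent c i))"

text \<open>Since \<open>of_nat_vec\<close> is injective, the choice is unique where it exists; on
  primitive classes it exists by integrality of the graduation.\<close>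

definition nat_degree :: "graph_class \<Rightarrow> nat ^ 'n" where
  "nat_degree c = (SOME v. class_degree C c = of_nat_vec v)"

lemma Y_over: "Y i \<in> series_over (\<Union>i. prim_graphs TYPE('k) i)" and Y_fix: "Y i = sdse_map Y i"
  using solves unfolding solves_sdse_iff by blast+

lemma coeff_Y_Node: "coeff (Y i) {#Node c A#} = (if c \<in> prim_graphs TYPE('k) i then coeff (sdse_term Y c) {#Node c A#} else 0)"
  by (subst Y_fix) (rule coeff_sdse_map_Node)

lemma Y_tree: "tree_series (Y i)"
proof -
  have "coeff (Y i) F = 0" if "\<nexists>c A. F = {#Node c A#}" for F
    by (subst Y_fix) (rule coeff_sdse_map_eq_0[OF that])
  then show ?thesis unfolding tree_series_def by blast
qed

lemma Y_empty [simp]: "coeff (Y i) {#} = 0"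
  using Y_tree[of i] by (auto simp: tree_series_def)

lemma X_empty [simp]: "coeff (X i) {#} = 1"
  by (simp add: X_def coeff_simps coeff_const_mult del: coeff_mult_empty)

lemma X_Inl: "X (Inl j) = 1 + Y (Inl j)" and X_Inr: "X (Inr j') = 1 - Y (Inr j')"
  by (rule mset_series_eqI, simp add: X_def sgn_type_def coeff_simps coeff_const_mult)+

lemma sdse_term_eq:
  assumes "c \<in> prim_graphs TYPE('k) i"
  shows "sdse_term Y c = series_graft c (X i * M c)"
proof -
  let ?e = "\<lambda>i. case i of Inl j \<Rightarrow> int (num_vertices (class_rep c) j) | Inr j \<Rightarrow> - int (num_edges (class_rep c) j)"
  have "(\<Prod>j\<in>UNIV. (1 + Y (Inl j)) ^ num_vertices (class_rep c) j) *
      (\<Prod>j\<in>UNIV. series_inverse (1 - Y (Inr j)) ^ num_edges (class_rep c) j) = (\<Prod>i'\<in>UNIV. unit_power (X i') (?e i'))"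
    by (simp add: prod_UNIV_ext_type unit_power_of_nat unit_power_minus_of_nat X_Inl X_Inr)
  also have "\<dots> = (\<Prod>i'\<in>UNIV. (if i' = i then X i' else 1) * unit_power (X i') (class_exponent c i'))"
  proof (rule prod.cong)
    fix i'
    have "?e i' = (if i' = i then 1 else 0) + class_exponent c i'"
      by (simp add: class_exponent_def prim_graphsD(3)[OF assms])
    then show "unit_power (X i') (?e i') = (if i' = i then X i' else 1) * unit_power (X i') (class_exponent c i')"
      by (simp add: unit_power_add unit_power_1)
  qed simp
  also have "\<dots> = X i * M c"
    by (simp add: prod.distrib M_def)
  finally show ?thesis by (simp only: sdse_term_def)
qed

lemma coeff_Y: "coeff (Y i) {#Node c A#} = (if c \<in> prim_graphs TYPE('k) i then coeff (X i * M c) A else 0)"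
  by (simp add: coeff_Y_Node sdse_term_eq coeff_graft)

lemma class_degree_nat:
  assumes "c \<in> (\<Union>i. prim_graphs TYPE('k) i)"
  shows "class_degree C c = of_nat_vec (nat_degree c)"
proof -
  have "feynman (class_rep c)" using assms prim_graphsD(1) feynman_one_PI by blast
  then have "\<forall>k. class_degree C c $ k \<in> \<nat>" using graduation by (simp add: connected_graduation_def class_degree_def)
  then have "\<forall>k. \<exists>n. class_degree C c $ k = of_nat n" by (simp add: Nats_def image_iff)
  from choice[OF this] obtain v where "\<And>k. class_degree C c $ k = of_nat (v k)" by blast
  then have "class_degree C c = of_nat_vec (\<chi> k. v k)" by (simp add: of_nat_vec_def vec_eq_iff)
  then show ?thesis unfolding nat_degree_def by (rule someI)
qed

lemma unit_group_X: "unit_power (X i) k \<in> unit_group X" "1 \<in> unit_group X"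
proof -
  have g: "series_inverse (X i) \<in> unit_group X" for i
    by (rule unit_group.inv[OF unit_group.gen series_inverse_unit]) simp
  have "X undefined * series_inverse (X undefined) \<in> unit_group X"
    by (intro unit_group.mult unit_group.gen g)
  then show 1: "1 \<in> unit_group X" by (simp add: series_inverse_unit)
  have p: "f ^ n \<in> unit_group X" if "f \<in> unit_group X" for f n
    by (induction n) (auto intro: 1 unit_group.mult that)
  show "unit_power (X i) k \<in> unit_group X"
    unfolding unit_power_def by (intro unit_group.mult p g unit_group.gen)
qed

lemma M_unit: "M c \<in> unit_group X"
proof -
  have "(\<Prod>i\<in>I. unit_power (X i) (class_exponent c i)) \<in> unit_group X" if "finite I" for I
    using that by (induction I) (auto intro: unit_group.mult unit_group_X)
  then show ?thesis by (simp add: M_def)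
qed

sublocale graded_sdse "\<Union>i. prim_graphs TYPE('k) i" "class_degree C" nat_degree Y X sgn_type M
proof
  fix c assume c: "c \<in> (\<Union>i. prim_graphs TYPE('k) i)"
  show "class_degree C c = of_nat_vec (nat_degree c)" using c by (rule class_degree_nat)
  show "nat_degree c \<noteq> 0"
  proof
    assume "nat_degree c = 0"
    then have "graph_degree C (class_rep c) = 0" using class_degree_nat[OF c] by (simp add: class_degree_def)
    moreover have P: "one_PI (class_rep c)" using c prim_graphsD(1) by blast
    moreover from P have "class_rep c \<noteq> empty_graph" by (auto simp: one_PI_def empty_graph_def)
    ultimately show False using graduation feynman_one_PI[OF P] by (simp add: connected_graduation_def)
  qed
next
  fix d
  have "{c \<in> \<Union>i. prim_graphs TYPE('k) i. nat_degree c = d} \<subseteq> {iso_class G |G. feynman G \<and> graph_degree C G = of_nat_vec d}"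
  proof
    fix c assume c: "c \<in> {c \<in> \<Union>i. prim_graphs TYPE('k) i. nat_degree c = d}"
    then have "class_degree C c = of_nat_vec d" using class_degree_nat by blast
    then show "c \<in> {iso_class G |G. feynman G \<and> graph_degree C G = of_nat_vec d}"
      using c prim_graphsD(5)[where C = C] by fastforce
  qed
  then show "finite {c \<in> \<Union>i. prim_graphs TYPE('k) i. nat_degree c = d}"
    by (rule finite_subset) (use graduation in \<open>simp add: connected_graduation_def\<close>)
next
  fix i
  have "tree_series (X i' - 1)" for i'
    using Y_tree[of i'] by (simp add: X_def tree_series_def coeff_const_mult)
  \<comment> \<open>The scalar is the sign of the type, or 0 if \<open>c\<close> is not a primitive
    class of type \<open>i'\<close>, as then no tree with root \<open>c\<close> occurs in
    \<open>X i'\<close>.\<close>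
  moreover have "\<exists>\<epsilon>. \<forall>A. coeff (X i') {#Node c A#} = \<epsilon> * coeff (X i' * M c) A" for i' c
  proof (intro exI allI)
    fix A
    show "coeff (X i') {#Node c A#} = (if c \<in> prim_graphs TYPE('k) i' then sgn_type i' else 0) * coeff (X i' * M c) A"
      by (simp add: X_def[of i', THEN arg_cong[of _ _ "\<lambda>f. coeff f {#Node c A#}"]] coeff_simps coeff_const_mult coeff_Y)
  qed
  ultimately show "series_coproduct (X i) = const_series (X i) * twist M (X i)"
    by (intro series_coproduct_eq_twist) (auto intro: M_unit)
qed (auto intro: Y_over Y_tree M_unit simp: X_def sgn_type_def split: sum.split)

lemma sdse_hopf_iff: "sdse_hopf C Y \<longleftrightarrow> hopf_subalgebra (\<Union>i. prim_graphs TYPE('k) i) alg"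
  by (simp add: sdse_hopf_def sdse_algebra_def alg_def gens_def)

section \<open>Monomials and degrees of forests\<close>

definition exponent :: "graph_class forest \<Rightarrow> ext_type \<Rightarrow> int" where
  "exponent F i = (\<Sum>c\<in>#decor F. class_exponent c i)"

definition total_vector :: "graph_class forest \<Rightarrow> rat ^ vertex_type" where
  "total_vector F = (\<Sum>c\<in>#decor F. class_vector c)"

lemma MM_eq: "MM F = (\<Prod>i\<in>UNIV. unit_power (X i) (exponent F i))"
proof -
  have "(\<Prod>c\<in>#N. M c) = (\<Prod>i\<in>UNIV. unit_power (X i) (\<Sum>c\<in>#N. class_exponent c i))" for N
    by (induction N) (auto simp: unit_power_add prod.distrib M_def)
  then show ?thesis by (simp add: MM_def exponent_def)
qed

lemma exponent_eq:
  assumes "F \<in> forests (\<Union>i. prim_graphs TYPE('k) i)"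
  shows "rat_of_int (exponent F (Inl j)) = total_vector F $ j"
    and "rat_of_int (exponent F (Inr T5)) = - total_vector F $ T1"
    and "rat_of_int (exponent F (Inr T6)) = - total_vector F $ T2"
    and "2 * rat_of_int (exponent F (Inr T7)) =
      - (total_vector F $ T1 + total_vector F $ T2 + 3 * total_vector F $ T3 + 4 * total_vector F $ T4)"
proof -
  have "rat_of_int (\<Sum>c\<in>#N. class_exponent c (Inl j)) = (\<Sum>c\<in>#N. class_vector c) $ j \<and>
    rat_of_int (\<Sum>c\<in>#N. class_exponent c (Inr T5)) = - (\<Sum>c\<in>#N. class_vector c) $ T1 \<and>
    rat_of_int (\<Sum>c\<in>#N. class_exponent c (Inr T6)) = - (\<Sum>c\<in>#N. class_vector c) $ T2 \<and>
    2 * rat_of_int (\<Sum>c\<in>#N. class_exponent c (Inr T7)) = - ((\<Sum>c\<in>#N. class_vector c) $ T1 +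
      (\<Sum>c\<in>#N. class_vector c) $ T2 + 3 * (\<Sum>c\<in>#N. class_vector c) $ T3 + 4 * (\<Sum>c\<in>#N. class_vector c) $ T4)"
    if "set_mset N \<subseteq> (\<Union>i. prim_graphs TYPE('k) i)" for N
    using that
  proof (induction N)
    case (add c N)
    then obtain i where "c \<in> prim_graphs TYPE('k) i" by auto
    note class_exponent_eq[OF this]
    with add show ?case by (simp add: algebra_simps)
  qed simp
  from this[of "decor F"] assms
  show "rat_of_int (exponent F (Inl j)) = total_vector F $ j"
    and "rat_of_int (exponent F (Inr T5)) = - total_vector F $ T1"
    and "rat_of_int (exponent F (Inr T6)) = - total_vector F $ T2"
    and "2 * rat_of_int (exponent F (Inr T7)) =
      - (total_vector F $ T1 + total_vector F $ T2 + 3 * total_vector F $ T3 + 4 * total_vector F $ T4)"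
    by (simp_all add: exponent_def total_vector_def forests_decor)
qed

lemma deg_total_vector:
  assumes "F \<in> forests (\<Union>i. prim_graphs TYPE('k) i)"
  shows "of_nat_vec (deg F) = C *v total_vector F"
proof -
  have "of_nat_vec (\<Sum>c\<in>#N. nat_degree c) = C *v (\<Sum>c\<in>#N. class_vector c)" if "set_mset N \<subseteq> (\<Union>i. prim_graphs TYPE('k) i)" for N
    using that
  proof (induction N)
    case (add c N)
    then have "of_nat_vec (nat_degree c) = C *v class_vector c"
      using class_degree_nat[of c] prim_graphsD(4)[of c _ _ C] by auto
    with add show ?case by (simp add: of_nat_vec_add matrix_vector_right_distrib)
  qed simp
  then show ?thesis using assms by (simp add: forests_decor deg_def total_vector_def)
qed

lemma exponent_cong:
  assumes F: "F \<in> forests (\<Union>i. prim_graphs TYPE('k) i)" and F': "F' \<in> forests (\<Union>i. prim_graphs TYPE('k) i)"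
    and eq: "total_vector F = total_vector F'"
  shows "exponent F = exponent F'"
proof
  fix i
  note e = exponent_eq[OF F, unfolded eq, folded exponent_eq[OF F']]
  show "exponent F i = exponent F' i"
  proof (cases i)
    case (Inl j)
    then show ?thesis using e(1)[of j] by simp
  next
    case (Inr j)
    then show ?thesis using e(2-4) by (cases j) auto
  qed
qed

theorem hopf_if_injective:
  assumes "inj ((*v) C)"
  shows "sdse_hopf C Y"
  unfolding sdse_hopf_iff
proof (rule hopf_subalgebraI)
  fix i B B' assume *: "coeff (Y i) B \<noteq> 0" "coeff (Y i) B' \<noteq> 0" "deg B = deg B'"
  then have B: "B \<in> forests (\<Union>i. prim_graphs TYPE('k) i)" "B' \<in> forests (\<Union>i. prim_graphs TYPE('k) i)"
    using Y_over[of i] by (auto simp: series_over_def)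
  have "C *v total_vector B = C *v total_vector B'"
    using deg_total_vector[OF B(1)] deg_total_vector[OF B(2)] *(3) by simp
  then have "total_vector B = total_vector B'" using assms by (simp add: inj_eq)
  then show "MM B = MM B'" using exponent_cong[OF B] by (simp add: MM_eq)
qed

end

section \<open>Necessity of the rank condition\<close>

lemma bubble_prim_graphs:
  fixes a b L i j0 j1
  defines "P \<equiv> (a, 0) # (b, 0) # (conj_type a, 1) # (conj_type b, 1) # L"
  assumes "snd ` set L \<subseteq> {0, 1}"
    and "mset (map fst (filter (\<lambda>p. snd p = 0) P)) = vertex_mset j0"
    and "mset (map fst (filter (\<lambda>p. snd p = 1) P)) = vertex_mset j1"
    and "mset (map fst L) = ext_type_mset i"
  shows "iso_class (bubble a b L) \<in> prim_graphs TYPE('k::field_char_0) i"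
    and "class_vector (iso_class (bubble a b L)) $ j = (if j = j0 then 1 else 0) + (if j = j1 then 1 else 0) - ext_shift i $ j"
proof -
  note G = bubble_primitive[OF assms(2-5)[unfolded P_def]]
  show P: "iso_class (bubble a b L) \<in> prim_graphs TYPE('k) i"
    unfolding prim_graphs_def using G(1-3) by blast
  show "class_vector (iso_class (bubble a b L)) $ j = (if j = j0 then 1 else 0) + (if j = j1 then 1 else 0) - ext_shift i $ j"
    by (simp add: class_vector_def prim_graphsD(3)[OF P] loop_vector_def vertex_vector_def
        class_rep_prim_graphs(3)[OF G(1,2)] G(4))
qed

lemma tadpole_prim_graphs:
  shows "iso_class tadpole \<in> prim_graphs TYPE('k::field_char_0) (Inr T7)"
    and "class_vector (iso_class tadpole) $ j = (if j = T4 then 1 else 0)"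
proof -
  note G = tadpole_primitive
  show P: "iso_class tadpole \<in> prim_graphs TYPE('k) (Inr T7)"
    unfolding prim_graphs_def using G(1-3) by blast
  show "class_vector (iso_class tadpole) $ j = (if j = T4 then 1 else 0)"
    by (simp add: class_vector_def prim_graphsD(3)[OF P] loop_vector_def vertex_vector_def
        class_rep_prim_graphs(3)[OF G(1,2)] G(4) ext_shift_def)
qed

text \<open>All four are gluon propagator graphs, so \<open>ext_shift\<close> vanishes and each uses
  one type of vertex only: two vertices in a bubble, one in the tadpole, whence
  \<open>loop_weight\<close>.\<close>

fun loop_class :: "vertex_type \<Rightarrow> graph_class" where
  "loop_class T1 = iso_class (bubble Quark Antiquark [(Gluon, 0), (Gluon, 1)])"
| "loop_class T2 = iso_class (bubble Ghost Antighost [(Gluon, 0), (Gluon, 1)])"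
| "loop_class T3 = iso_class (bubble Gluon Gluon [(Gluon, 0), (Gluon, 1)])"
| "loop_class T4 = iso_class tadpole"

definition loop_weight :: "vertex_type \<Rightarrow> nat" where
  "loop_weight j = (if j = T4 then 1 else 2)"

lemma loop_class_prim: "loop_class j \<in> prim_graphs TYPE('k::field_char_0) (Inr T7)"
  by (cases j) (auto simp: ext_type_mset_def intro: tadpole_prim_graphs
    bubble_prim_graphs(1)[of _ _ _ T1 T1] bubble_prim_graphs(1)[of _ _ _ T2 T2] bubble_prim_graphs(1)[of _ _ _ T3 T3])

lemma loop_class_vector: "class_vector (loop_class j) $ j' = (if j' = j then of_nat (loop_weight j) else 0)"
proof (cases j)
  case T1
  have "class_vector (loop_class T1) $ j' = (if j' = T1 then 1 else 0) + (if j' = T1 then 1 else 0) - ext_shift (Inr T7) $ j'"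
    unfolding loop_class.simps by (rule bubble_prim_graphs(2)) (auto simp: ext_type_mset_def)
  then show ?thesis by (simp add: T1 loop_weight_def ext_shift_def)
next
  case T2
  have "class_vector (loop_class T2) $ j' = (if j' = T2 then 1 else 0) + (if j' = T2 then 1 else 0) - ext_shift (Inr T7) $ j'"
    unfolding loop_class.simps by (rule bubble_prim_graphs(2)) (auto simp: ext_type_mset_def)
  then show ?thesis by (simp add: T2 loop_weight_def ext_shift_def)
next
  case T3
  have "class_vector (loop_class T3) $ j' = (if j' = T3 then 1 else 0) + (if j' = T3 then 1 else 0) - ext_shift (Inr T7) $ j'"
    unfolding loop_class.simps by (rule bubble_prim_graphs(2)) (auto simp: ext_type_mset_def)
  then show ?thesis by (simp add: T3 loop_weight_def ext_shift_def)
next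
  case T4
  then show ?thesis by (simp add: tadpole_prim_graphs loop_weight_def)
qed

declare loop_class.simps [simp del]

text \<open>Grafting a leaf \<open>probe_class j\<close> on a tree detects the component \<open>j\<close> of its total vector.\<close>

fun probe_class :: "vertex_type \<Rightarrow> graph_class" where
  "probe_class T1 = iso_class (bubble Quark Gluon [(Antiquark, 0), (Quark, 1)])"
| "probe_class T2 = iso_class (bubble Ghost Gluon [(Antighost, 0), (Ghost, 1)])"
| "probe_class T3 = iso_class (bubble Gluon Gluon [(Gluon, 0), (Gluon, 1), (Gluon, 1)])"
| "probe_class T4 = iso_class (bubble Gluon Gluon [(Gluon, 0), (Gluon, 0), (Gluon, 1), (Gluon, 1)])"

text \<open>A bubble with three legs has a four-gluon vertex and hence only gluons, so none has type
  \<open>T1\<close> or \<open>T2\<close>. These components are read from the quark and ghost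
  propagators instead, whose exponents are their negatives. The gluon propagator is avoided, as it
  is the type of the prefactor.\<close>

fun probe_type :: "vertex_type \<Rightarrow> ext_type" where
  "probe_type T1 = Inr T5"
| "probe_type T2 = Inr T6"
| "probe_type T3 = Inl T3"
| "probe_type T4 = Inl T4"

lemma probe_class_prim: "probe_class j \<in> prim_graphs TYPE('k::field_char_0) (probe_type j)"
  by (cases j) (auto simp: ext_type_mset_def intro: bubble_prim_graphs(1)[of _ _ _ T1 T1]
    bubble_prim_graphs(1)[of _ _ _ T2 T2] bubble_prim_graphs(1)[of _ _ _ T3 T4] bubble_prim_graphs(1)[of _ _ _ T4 T4])

declare probe_class.simps [simp del]

abbreviation loop_leaf :: "vertex_type \<Rightarrow> graph_class dtree" where
  "loop_leaf j \<equiv> Node (loop_class j) {#}"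

definition loop_forest :: "(vertex_type \<Rightarrow> nat) \<Rightarrow> graph_class forest" where
  "loop_forest n = (\<Sum>j\<in>UNIV. replicate_mset (n j) (loop_leaf j))"

definition loop_tree :: "(vertex_type \<Rightarrow> nat) \<Rightarrow> graph_class dtree" where
  "loop_tree n = Node (loop_class T4) (loop_forest n)"

lemma set_loop_forest: "t \<in># loop_forest n \<Longrightarrow> \<exists>j. t = loop_leaf j"
  by (auto simp: loop_forest_def UNIV_vertex_type split: if_splits)

text \<open>The product of all denominators serves as \<open>q\<close>.\<close>

lemma common_denominator:
  fixes w :: "rat ^ 'n"
  obtains q :: nat and z :: "'n \<Rightarrow> int" where "q > 0" "\<And>j. of_nat q * w $ j = of_int (z j)"
proof -
  define b where "b j = snd (quotient_of (w $ j))" for j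
  have b: "b j > 0" for j by (simp add: b_def quotient_of_denom_pos')
  define q where "q = (\<Prod>j\<in>UNIV. nat (b j))"
  have "q > 0" using b by (simp add: q_def)
  moreover have *: "of_nat q * w $ j = of_int (fst (quotient_of (w $ j)) * (\<Prod>i\<in>UNIV - {j}. b i))" for j
  proof -
    have "rat_of_nat q = (\<Prod>i\<in>UNIV. of_int (b i))"
      using b by (simp add: q_def less_imp_le)
    also have "\<dots> = of_int (b j) * (\<Prod>i\<in>UNIV - {j}. of_int (b i))"
      by (rule prod.remove) auto
    finally have q: "rat_of_nat q = of_int (b j) * (\<Prod>i\<in>UNIV - {j}. of_int (b i))" .
    have "w $ j = of_int (fst (quotient_of (w $ j))) / of_int (b j)"
      unfolding b_def by (rule quotient_of_div) simp
    then have "of_int (b j) * w $ j = of_int (fst (quotient_of (w $ j)))"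
      using b[of j] by (metis less_irrefl mult.commute nonzero_eq_divide_eq of_int_eq_0_iff)
    then have "(of_int (b j) * w $ j) * (\<Prod>i\<in>UNIV - {j}. of_int (b i)) =
        of_int (fst (quotient_of (w $ j))) * (\<Prod>i\<in>UNIV - {j}. of_int (b i))"
      by simp
    then have "of_int (b j) * (\<Prod>i\<in>UNIV - {j}. of_int (b i)) * w $ j =
        of_int (fst (quotient_of (w $ j))) * (\<Prod>i\<in>UNIV - {j}. of_int (b i))"
      by (simp only: ac_simps)
    then show ?thesis unfolding q by simp
  qed
  ultimately show ?thesis by (intro that[of q, OF _ *])
qed

context qcd_sdse
begin

lemma prim_graphs_disjoint: "c \<in> prim_graphs TYPE('k) i \<Longrightarrow> c \<in> prim_graphs TYPE('k) j \<Longrightarrow> i = j"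
  using prim_graphsD(3) by blast

lemma coeff_M_empty: "coeff (M c) {#} = 1"
  using coeff_prod_single[of "UNIV :: ext_type set" "\<lambda>i. unit_power (X i) (class_exponent c i)"]
  by (simp add: M_def coeff_unit_power_empty)

lemma coeff_Y_leaf: "coeff (Y i) {#Node c {#}#} = (if c \<in> prim_graphs TYPE('k) i then 1 else 0)"
  by (simp add: coeff_Y coeff_M_empty)

text \<open>The inverse satisfies \<open>g = 1 + Y * g\<close> with \<open>Y\<close> the gluon
  propagator series. On forests of leaves this recursion adds natural numbers, and splitting off a
  single leaf gives a positive summand.\<close>

lemma coeff_inverse_loop_leaves:
  assumes "\<And>t. t \<in># F \<Longrightarrow> \<exists>j. t = loop_leaf j"
  shows "\<exists>k > 0. coeff (series_inverse (X (Inr T7))) F = of_nat k"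
  using assms
proof (induction "size F" arbitrary: F rule: less_induct)
  case less
  let ?g = "series_inverse (X (Inr T7))"
  have g: "coeff ?g F = coeff 1 F + coeff (Y (Inr T7) * ?g) F" for F
  proof -
    have "?g = X (Inr T7) * ?g + Y (Inr T7) * ?g" by (simp add: X_Inr algebra_simps)
    then have "?g = 1 + Y (Inr T7) * ?g" by (simp only: series_inverse_unit[OF X_empty])
    then show ?thesis by (metis plus_mset_series.rep_eq)
  qed
  show ?case
  proof (cases "F = {#}")
    case True
    then show ?thesis by (intro exI[of _ 1]) (simp add: coeff_series_inverse_empty)
  next
    case False
    have "\<exists>k. coeff (Y (Inr T7)) (fst p) * coeff ?g (snd p) = of_nat k \<and> (size (fst p) = 1 \<longrightarrow> k > 0)"
      if p: "p \<in> splits F" for p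
    proof (cases "\<exists>c A. fst p = {#Node c A#}")
      case True
      then obtain c A where cA: "fst p = {#Node c A#}" by blast
      have F: "F = fst p + snd p" using p by simp
      then have "Node c A \<in># F" by (simp add: cA)
      then obtain j where j: "Node c A = loop_leaf j" using less.prems by blast
      have "size (snd p) < size F" by (simp add: F cA)
      moreover have "\<exists>j. t = loop_leaf j" if "t \<in># snd p" for t using less.prems that by (simp add: F)
      ultimately have "\<exists>k > 0. coeff ?g (snd p) = of_nat k" by (intro less.hyps)
      then obtain k where "k > 0" "coeff ?g (snd p) = of_nat k" by blast
      then show ?thesis using j loop_class_prim[of j, where 'k = 'k] by (intro exI[of _ k]) (simp add: cA coeff_Y_leaf)
    next
      case False
      then have "coeff (Y (Inr T7)) (fst p) = 0" using Y_tree[of "Inr T7"] unfolding tree_series_def by blast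
      moreover have "size (fst p) \<noteq> 1"
      proof
        assume "size (fst p) = 1"
        from size_1_singleton_mset[OF this] obtain t where "fst p = {#t#}" by blast
        then show False using False by (cases t) auto
      qed
      ultimately show ?thesis by (intro exI[of _ 0]) simp
    qed
    then obtain K where K: "\<And>p. p \<in> splits F \<Longrightarrow> coeff (Y (Inr T7)) (fst p) * coeff ?g (snd p) = of_nat (K p)"
      "\<And>p. p \<in> splits F \<Longrightarrow> size (fst p) = 1 \<Longrightarrow> K p > 0"
      using bchoice[of "splits F" "\<lambda>p k. coeff (Y (Inr T7)) (fst p) * coeff ?g (snd p) = of_nat k \<and> (size (fst p) = 1 \<longrightarrow> k > 0)"]
      by blast
    have "coeff ?g F = of_nat (\<Sum>p\<in>splits F. K p)"
      unfolding g[of F] coeff_mult of_nat_sum using False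
      by (simp add: coeff_simps) (intro sum.cong refl K(1), simp)
    moreover have "(\<Sum>p\<in>splits F. K p) > 0"
    proof -
      obtain t where t: "t \<in># F" using False by blast
      have p: "({#t#}, F - {#t#}) \<in> splits F" using t by simp
      have "K ({#t#}, F - {#t#}) \<le> (\<Sum>p\<in>splits F. K p)" by (rule member_le_sum[OF p]) auto
      moreover have "K ({#t#}, F - {#t#}) > 0" by (rule K(2)[OF p]) simp
      ultimately show ?thesis by simp
    qed
    ultimately show ?thesis by blast
  qed
qed

lemma M_tadpole: "X (Inr T7) * M (loop_class T4) = X (Inl T4) * series_inverse (X (Inr T7))"
proof -
  note e = class_exponent_eq[OF loop_class_prim[of T4, where 'k = 'k]]
  have "rat_of_int (class_exponent (loop_class T4) (Inl j)) = rat_of_int (if j = T4 then 1 else 0)" for j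
    unfolding e(1) by (simp add: loop_class_vector loop_weight_def)
  then have l: "class_exponent (loop_class T4) (Inl j) = (if j = T4 then 1 else 0)" for j
    by (simp only: of_int_eq_iff)
  have r: "class_exponent (loop_class T4) (Inr T5) = 0" "class_exponent (loop_class T4) (Inr T6) = 0"
    using e(2,3) by (simp_all add: loop_class_vector loop_weight_def)
  \<comment> \<open>The value \<open>- 2\<close> consists of one internal gluon edge and the removed
    factor \<open>X (Inr T7)\<close>.\<close>
  have "2 * rat_of_int (class_exponent (loop_class T4) (Inr T7)) = 2 * rat_of_int (- 2)"
    using e(4) by (simp add: loop_class_vector loop_weight_def)
  then have r7: "class_exponent (loop_class T4) (Inr T7) = - 2"
    by (metis mult_left_cancel of_int_eq_iff zero_neq_numeral)
  have "M (loop_class T4) = X (Inl T4) * unit_power (X (Inr T7)) (- 2)"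
    by (simp add: M_def prod_UNIV_ext_type UNIV_vertex_type UNIV_edge_type l r r7 unit_power_1)
  then have "X (Inr T7) * M (loop_class T4) = X (Inl T4) * (unit_power (X (Inr T7)) 1 * unit_power (X (Inr T7)) (- 2))"
    by (simp add: unit_power_1 ac_simps)
  also have "unit_power (X (Inr T7)) 1 * unit_power (X (Inr T7)) (- 2) = series_inverse (X (Inr T7))"
    unfolding unit_power_add[OF X_empty, symmetric] by (simp add: unit_power_def)
  finally show ?thesis .
qed

text \<open>All leaves have type \<open>Inr T7\<close>, so the factor \<open>1 + Y (Inl T4)\<close>
  of the tadpole acts as 1. The positive integer that remains is nonzero in characteristic
  zero.\<close>

lemma coeff_Y_loop_tree: "coeff (Y (Inr T7)) {#loop_tree n#} \<noteq> 0"
proof -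
  let ?g = "series_inverse (X (Inr T7))" and ?F = "loop_forest n"
  have "coeff (Y (Inr T7)) {#loop_tree n#} = coeff (X (Inl T4) * ?g) ?F"
    using loop_class_prim[of T4, where 'k = 'k]
    by (simp add: loop_tree_def coeff_Y M_tadpole)
  also have "\<dots> = coeff ?g ?F + coeff (Y (Inl T4) * ?g) ?F"
    by (simp add: X_Inl distrib_right coeff_simps)
  also have "coeff (Y (Inl T4) * ?g) ?F = 0"
    unfolding coeff_mult
  proof (rule sum.neutral, rule ballI)
    fix p assume p: "p \<in> splits ?F"
    have "coeff (Y (Inl T4)) (fst p) = 0"
    proof (cases "\<exists>c A. fst p = {#Node c A#}")
      case True
      then obtain c A where cA: "fst p = {#Node c A#}" by blast
      have F: "?F = fst p + snd p" using p by simp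
      have "Node c A \<in># ?F" unfolding F cA by simp
      then obtain j where j: "Node c A = loop_leaf j" using set_loop_forest by blast
      then have "c \<notin> prim_graphs TYPE('k) (Inl T4)"
        using loop_class_prim[of j, where 'k = 'k] prim_graphs_disjoint by blast
      then show ?thesis by (simp add: cA coeff_Y)
    next
      case False
      then show ?thesis using Y_tree[of "Inl T4"] unfolding tree_series_def by blast
    qed
    then show "coeff (Y (Inl T4)) (fst p) * coeff ?g (snd p) = 0" by simp
  qed
  finally have "coeff (Y (Inr T7)) {#loop_tree n#} = coeff ?g ?F" by simp
  moreover obtain k where "k > 0" "coeff ?g ?F = of_nat k"
    using coeff_inverse_loop_leaves[of ?F] set_loop_forest by blast
  ultimately show ?thesis by simp
qed

lemma loop_tree_forests: "{#loop_tree n#} \<in> forests (\<Union>i. prim_graphs TYPE('k) i)"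
  using coeff_Y_loop_tree[of n] Y_over[of "Inr T7"] by (auto simp: series_over_def)

lemma total_vector_loop_tree:
  "total_vector {#loop_tree n#} $ j = (if j = T4 then 1 else 0) + of_nat (n j * loop_weight j)"
proof -
  have d: "decor (replicate_mset k (loop_leaf j)) = replicate_mset k (loop_class j)" for k j
  proof (induction k)
    case (Suc k)
    have "decor (replicate_mset (Suc k) (loop_leaf j)) = decor ({#loop_leaf j#} + replicate_mset k (loop_leaf j))" by simp
    also have "\<dots> = replicate_mset (Suc k) (loop_class j)" unfolding decor_add decor_graft Suc by simp
    finally show ?case .
  qed simp
  have "decor {#loop_tree n#} = add_mset (loop_class T4) (\<Sum>j\<in>UNIV. replicate_mset (n j) (loop_class j))"
    by (simp add: loop_tree_def loop_forest_def UNIV_vertex_type d)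
  then have "total_vector {#loop_tree n#} $ j = class_vector (loop_class T4) $ j + (\<Sum>i\<in>UNIV. of_nat (n i) * class_vector (loop_class i) $ j)"
    by (simp add: total_vector_def UNIV_vertex_type of_nat_index)
  also have "\<dots> = (if j = T4 then 1 else 0) + (\<Sum>i\<in>UNIV. if i = j then of_nat (n i * loop_weight i) else 0)"
    by (intro arg_cong2[of _ _ _ _ "(+)"] sum.cong refl)
      (auto simp: loop_class_vector loop_weight_def)
  finally show ?thesis by simp
qed

text \<open>The probe occurs in exactly one \<open>X i\<close>, with coefficient the sign of its
  type, and the linear part of a monomial is the combination of linear parts weighted by the
  exponents. The prefactor does not see the probe.\<close>

lemma coeff_MM_probe:
  "coeff (X (Inr T7) * MM F) {#Node (probe_class j) {#}#} = of_int (exponent F (probe_type j)) * sgn_type (probe_type j)"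
proof -
  let ?u = "Node (probe_class j) {#}"
  have c: "coeff (X i) {#?u#} = (if i = probe_type j then sgn_type i else 0)" for i
  proof -
    have "coeff (X i) {#?u#} = sgn_type i * coeff (Y i) {#?u#}"
      unfolding X_def by (simp add: coeff_simps coeff_const_mult)
    moreover have "probe_class j \<in> prim_graphs TYPE('k) i \<longleftrightarrow> i = probe_type j"
      using probe_class_prim[of j, where 'k = 'k] prim_graphs_disjoint by blast
    ultimately show ?thesis by (simp add: coeff_Y_leaf)
  qed
  have "probe_type j \<noteq> Inr T7" by (cases j) auto
  moreover have "coeff (MM F) {#} = 1 \<and> coeff (MM F) {#?u#} = (\<Sum>i\<in>UNIV. coeff (unit_power (X i) (exponent F i)) {#?u#})"
    unfolding MM_eq by (rule coeff_prod_single) (auto simp: coeff_unit_power_empty)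
  ultimately have "coeff (X (Inr T7) * MM F) {#?u#} = (\<Sum>i\<in>UNIV. of_int (exponent F i) * coeff (X i) {#?u#})"
    by (simp add: coeff_mult_single c coeff_unit_power_single)
  also have "\<dots> = of_int (exponent F (probe_type j)) * sgn_type (probe_type j)"
    by (simp add: c mult_delta_right)
  finally show ?thesis .
qed

theorem injective_if_hopf:
  assumes hopf: "sdse_hopf C Y"
  shows "inj ((*v) C)"
proof (rule injI)
  fix x y assume "C *v x = C *v y"
  define w where "w = x - y"
  have w: "C *v w = 0" using \<open>C *v x = C *v y\<close> by (simp add: w_def matrix_vector_mult_diff_distrib)
  obtain q z where q: "q > 0" "\<And>j. of_nat q * w $ j = of_int (z j)" using common_denominator[of w] by blast
  \<comment> \<open>\<open>n\<close> and \<open>n'\<close> are the positive and negative parts of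
    \<open>z\<close>. The factor 2 lifts the weight 1 of the tadpole to the weight 2 of the bubbles,
    so the total vectors differ by exactly \<open>2 q w\<close>.\<close>
  define n where "n j = nat (z j) * (if j = T4 then 2 else 1)" for j
  define n' where "n' j = nat (- z j) * (if j = T4 then 2 else 1)" for j
  let ?t = "loop_tree n" and ?t' = "loop_tree n'"
  have diff: "total_vector {#?t#} = total_vector {#?t'#} + (2 * of_nat q) *s w"
  proof (subst vec_eq_iff, rule allI)
    fix j
    have "rat_of_nat (nat (z j)) - of_nat (nat (- z j)) = of_nat q * w $ j"
      unfolding q(2) by (cases "z j \<ge> 0") auto
    then show "total_vector {#?t#} $ j = (total_vector {#?t'#} + (2 * of_nat q) *s w) $ j"
      by (auto simp: total_vector_loop_tree n_def n'_def loop_weight_def algebra_simps)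
  qed
  have "of_nat_vec (deg {#?t#}) = of_nat_vec (deg {#?t'#})"
    by (simp add: deg_total_vector loop_tree_forests diff matrix_vector_right_distrib vec.scale w)
  then have deg_eq: "deg {#?t#} = deg {#?t'#}" by simp
  have other: "coeff (Y i) {#loop_tree n#} = 0" if "i \<noteq> Inr T7" for i n
  proof -
    have "loop_class T4 \<notin> prim_graphs TYPE('k) i"
      using that loop_class_prim[of T4, where 'k = 'k] prim_graphs_disjoint by blast
    then show ?thesis by (simp add: loop_tree_def coeff_Y)
  qed
  have "total_vector {#?t#} $ j = total_vector {#?t'#} $ j" for j
  proof -
    have "coeff (X (Inr T7) * MM {#?t#}) {#Node (probe_class j) {#}#} = coeff (X (Inr T7) * MM {#?t'#}) {#Node (probe_class j) {#}#}"
      by (rule hopf_subalgebraD[OF hopf[unfolded sdse_hopf_iff] coeff_Y_loop_tree coeff_Y_loop_tree deg_eq])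
        (auto intro: other)
    then have "of_int (exponent {#?t#} (probe_type j)) * sgn_type (probe_type j) =
        of_int (exponent {#?t'#} (probe_type j)) * sgn_type (probe_type j)"
      by (simp only: coeff_MM_probe)
    then have e: "exponent {#?t#} (probe_type j) = exponent {#?t'#} (probe_type j)"
      using s_nonzero by simp
    note ex = exponent_eq[OF loop_tree_forests]
    show ?thesis
    proof (cases j)
      case T1
      then show ?thesis using e ex(2)[of n] ex(2)[of n'] by simp
    next
      case T2
      then show ?thesis using e ex(3)[of n] ex(3)[of n'] by simp
    next
      case T3
      then show ?thesis using e ex(1)[of n T3] ex(1)[of n' T3] by simp
    next
      case T4
      then show ?thesis using e ex(1)[of n T4] ex(1)[of n' T4] by simp
    qed
  qed
  then have "(2 * of_nat q) *s w = 0" using diff by (simp add: vec_eq_iff)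
  then have "w = 0" using q(1) by simp
  then show "x = y" by (simp add: w_def)
qed

end

theorem proposition44:
  fixes C :: "rat ^ vertex_type ^ 'n"
    and Y :: "ext_type \<Rightarrow> (graph_class dtree, 'k::field_char_0) mset_series"
  assumes "connected_graduation C"
    and "solves_sdse Y"
  shows "sdse_hopf C Y \<longleftrightarrow> rank C = 4"
proof -
  interpret qcd_sdse C Y using assms by (rule qcd_sdse.intro)
  have "rank C = 4 \<longleftrightarrow> inj ((*v) C)"
    using full_rank_iff_inj[of C] by (simp add: card_vertex_type)
  then show ?thesis using hopf_if_injective injective_if_hopf by blast
qed

end
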